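(* Consider the AD model on the infinite rooted binary tree $\mathcal{T}$ with parameter $p\in[0,1)$, generator $\mathcal{L}$ and reversible Bernoulli($p$) product measure $\mu$. Let $0\le p'<p_c$, where $p_c=1/2$ is the ergodicity threshold of the model, let $\nu$ be the Bernoulli($p'$) product measure on $\{0,1\}^{\mathcal{T}}$, and assume that $\mathrm{gap}(\mathcal{L})>0$ (so that necessarily $p<p_c$). Then there exists $m>0$ and, for any local function $f$, there exists $C_f<\infty$ such that: (a) for any $t>0$ $$\int d\nu(\eta)\,\bigl|\mathbb{E}\bigl(f(\eta_t)\bigr)-\mu(f)\bigr|\le C_f\,e^{-mt};$$ (b) for $\nu$-almost all configurations $\eta$ there exists $t_0(\eta,f)$ such that for any $t>t_0(\eta,f)$ $$\bigl|\mathbb{E}\bigl(f(\eta_t)\bigr)-\mu(f)\bigr|\le C_f\,e^{-mt}.$$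
   Context: Let $\mathcal{T}$ be the infinite rooted binary tree (each vertex has two children), with root $0$; let $\Omega=\{0,1\}^{\mathcal{T}}$ and let $\mu=\bigotimes_{x\in\mathcal{T}}\mu_x$ be the product measure with each $\mu_x$ Bernoulli($p$) on $\{0,1\}$ (value $1$ with probability $p$). A function $f:\Omega\to\mathbb{R}$ is local if it depends on finitely many variables. The AD model is the Markov process on $\Omega$ whose generator acts on local functions by $$\mathcal{L}f(\omega)=\sum_{x\in\mathcal{T}}c_x(\omega)\,[\mu_x(f)-f(\omega)],$$ where $\mu_x(f)=\int d\mu_x(\omega_x)f(\omega)$ averages over $\omega_x$ only, all other variables being held fixed, and $c_x(\omega)=1$ if $\omega$ is $0$ at both children of $x$, $c_x(\omega)=0$ otherwise. The operator $\mathcal{L}$ extends to a self-adjoint non-positive operator on $L^2(\Omega,\mu)$, and $\mathrm{gap}(\mathcal{L})$ is its spectral gap, i.e. the infimum of $\langle f,-\mathcal{L}f\rangle_{L^2(\mu)}/\mathrm{Var}_\mu(f)$ over $f$ in the domain with $\mathrm{Var}_\mu(f)>0$. $\mathbb{E}(f(\eta_t))$ denotes the expectation of $f$ at time $t$ over the process started from $\eta$. The threshold is $p_c=\sup\{p\in[0,1]: 0 \text{ is a simple eigenvalue of } \mathcal{L}\}$; it is known to equal the critical density for (oriented, parent-to-child) site percolation on $\mathcal{T}$, which is $1/2$. *)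

theory Defs
  imports "HOL-Probability.Probability"
begin

(* The infinite rooted binary tree: a vertex is its path from the root, so [] is the root
   and x @ [False], x @ [True] are the two children of x.  In a configuration, True stands
   for the value 1 and False for the value 0. *)

type_synonym vertex = "bool list"
type_synonym config = "vertex \<Rightarrow> bool"

definition config_space :: "config measure" where
  "config_space = (\<Pi>\<^sub>M x\<in>UNIV. count_space UNIV)"

definition bernoulli_product :: "real \<Rightarrow> config measure" where
  "bernoulli_product p = (\<Pi>\<^sub>M x\<in>UNIV. measure_pmf (bernoulli_pmf p))"

definition local_function :: "(config \<Rightarrow> real) \<Rightarrow> bool" where
  "local_function f \<longleftrightarrow>
     (\<exists>A. finite A \<and> (\<forall>\<omega> \<omega>'. (\<forall>x\<in>A. \<omega> x = \<omega>' x) \<longrightarrow> f \<omega> = f \<omega>'))"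

definition ad_rate :: "vertex \<Rightarrow> config \<Rightarrow> real" where
  "ad_rate x \<omega> = (if \<not> \<omega> (x @ [False]) \<and> \<not> \<omega> (x @ [True]) then 1 else 0)"

definition site_average :: "real \<Rightarrow> vertex \<Rightarrow> (config \<Rightarrow> real) \<Rightarrow> config \<Rightarrow> real" where
  "site_average p x f \<omega> = measure_pmf.expectation (bernoulli_pmf p) (\<lambda>b. f (fun_upd \<omega> x b))"

(* Applied to local functions only; the sum then has finitely many nonzero terms. *)
definition ad_generator :: "real \<Rightarrow> (config \<Rightarrow> real) \<Rightarrow> config \<Rightarrow> real" where
  "ad_generator p f \<omega> = (\<Sum>\<^sub>\<infinity>x\<in>UNIV. ad_rate x \<omega> * (site_average p x f \<omega> - f \<omega>))"

(* K t \<eta> is the law at time t of the process started from \<eta>.  The process is given by a Feller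
   transition function on the compact space config (product topology) whose infinitesimal
   generator, with respect to uniform convergence, acts on local functions as ad_generator.
   Local functions are a core for the generator, so these conditions determine K t for t \<ge> 0. *)
definition ad_process :: "real \<Rightarrow> (real \<Rightarrow> config \<Rightarrow> config measure) \<Rightarrow> bool" where
  "ad_process p K \<longleftrightarrow>
     (\<forall>t\<ge>0. K t \<in> config_space \<rightarrow>\<^sub>M prob_algebra config_space) \<and>
     (\<forall>\<eta>. K 0 \<eta> = return config_space \<eta>) \<and>
     (\<forall>s\<ge>0. \<forall>t\<ge>0. \<forall>\<eta>. K (s + t) \<eta> = bind (K s \<eta>) (K t)) \<and>
     (\<forall>t\<ge>0. \<forall>f :: config \<Rightarrow> real. continuous_on UNIV f \<longrightarrow>
        continuous_on UNIV (\<lambda>\<eta>. \<integral>\<omega>. f \<omega> \<partial>K t \<eta>)) \<and>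
     (\<forall>f. local_function f \<longrightarrow>
        uniform_limit UNIV (\<lambda>t \<eta>. ((\<integral>\<omega>. f \<omega> \<partial>K t \<eta>) - f \<eta>) / t) (ad_generator p f) (at_right 0))"

definition square_integrable :: "'a measure \<Rightarrow> ('a \<Rightarrow> real) \<Rightarrow> bool" where
  "square_integrable M f \<longleftrightarrow> f \<in> borel_measurable M \<and> integrable M (\<lambda>x. (f x)\<^sup>2)"

(* Graph of the self-adjoint extension to L^2 of the Bernoulli(p) product measure: the L^2-closure
   of ad_generator on local functions, on which it is essentially self-adjoint.  Elements of L^2
   are represented by functions, so the relation is single-valued up to null sets. *)
definition ad_L2_generator :: "real \<Rightarrow> ((config \<Rightarrow> real) \<times> (config \<Rightarrow> real)) set" where
  "ad_L2_generator p =
     {(f, g). square_integrable (bernoulli_product p) f \<and> square_integrable (bernoulli_product p) g \<and>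
        (\<exists>F. (\<forall>n. local_function (F n)) \<and>
           (\<lambda>n. \<integral>\<omega>. (F n \<omega> - f \<omega>)\<^sup>2 \<partial>bernoulli_product p) \<longlonglongrightarrow> 0 \<and>
           (\<lambda>n. \<integral>\<omega>. (ad_generator p (F n) \<omega> - g \<omega>)\<^sup>2 \<partial>bernoulli_product p) \<longlonglongrightarrow> 0)}"

(* Valued in ereal: for p = 0 all variances vanish and the infimum over the empty set is \<infinity>. *)
definition ad_gap :: "real \<Rightarrow> ereal" where
  "ad_gap p =
     (INF (f, g) \<in> {(f, g) \<in> ad_L2_generator p. prob_space.variance (bernoulli_product p) f > 0}.
        ereal ((\<integral>\<omega>. f \<omega> * (- g \<omega>) \<partial>bernoulli_product p) /
               prob_space.variance (bernoulli_product p) f))"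

definition ad_simple_eigenvalue :: "real \<Rightarrow> real \<Rightarrow> bool" where
  "ad_simple_eigenvalue p l \<longleftrightarrow>
     (\<exists>h. (h, \<lambda>\<omega>. l * h \<omega>) \<in> ad_L2_generator p \<and> \<not> (AE \<omega> in bernoulli_product p. h \<omega> = 0) \<and>
        (\<forall>f. (f, \<lambda>\<omega>. l * f \<omega>) \<in> ad_L2_generator p \<longrightarrow>
           (\<exists>c. AE \<omega> in bernoulli_product p. f \<omega> = c * h \<omega>)))"

(* The value p = 1 is left out: there the product measure is a point mass, L^2 is one-dimensional
   and 0 is a simple eigenvalue for a trivial reason, so the supremum would be 1 and not the
   percolation threshold 1/2. *)
definition ad_critical :: real where
  "ad_critical = Sup {p. 0 \<le> p \<and> p < 1 \<and> ad_simple_eigenvalue p 0}"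

end

(* The law of the process is compared with equilibrium inside an enclosure: a finite prefix-closed
   set A of vertices whose outer boundary is vacant. A boundary site stays vacant until its first
   legal update, at which moment it becomes Bernoulli(p) independently of the past and its two
   children are vacant. It can then be added to A, and the enlarged set is again an enclosure. So A
   only grows, at times determined from outside, and the L^2 distance to equilibrium on A keeps
   decaying at the rate of the spectral gap with vacant boundary condition, which is at least the gap
   in infinite volume. Starting from a single configuration costs a factor exponential in card A.
   Under Bernoulli(p') with p' < 1/2 the occupied clusters are subcritical, so card A has an
   exponential moment, and interpolating with the trivial bound gives an exponential rate.
   The growth of A is encoded without a graphical construction: for the dynamics restricted to a
   finite set of sites, the second moments over all enclosures satisfy a finite system of
   differential inequalities to which a maximum principle applies. *)

theory Submission
  imports Defs
begin

section \<open>Local functions and the Bernoulli product measure\<close>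

text \<open>The inner terms form a Dirichlet form with vacant boundary. Vacant children only raise
  rates, so it dominates the infinite-volume form on functions of the sites of \<open>A\<close>. The
  gap bounds a variance, while the system follows a second moment about the fixed equilibrium mean;
  the two agree because the block mean of the evolved function stays at that value, by the same
  maximum principle applied to first moments. Two matters lie outside this scheme. At
  \<open>p = 0\<close> all variances vanish and the gap carries no information, so a decreasing
  weighted count of occupied sites replaces it. And \<open>ad_critical\<close> is defined through an
  eigenvalue, so \<open>p' < 1 / 2\<close> must be extracted from it: for \<open>p\<close> between
  1/2 and 1 the normalised number of occupied paths from the root to a deep generation converges in
  L^2 to a nonconstant element of the kernel, because legal updates above the last generation cannot
  change that number.\<close>

lemma finite_vertex_ball [simp]: "finite {x :: vertex. length x \<le> N}"
  using finite_lists_length_le[of "UNIV :: bool set" N] by simp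

lemma finite_vertex_open_ball [simp]: "finite {x :: vertex. length x < N}"
  by (rule finite_subset[OF _ finite_vertex_ball[of N]]) auto

lemma finite_generation [simp]: "finite {x :: vertex. length x = N}"
  using finite_lists_length_eq[of "UNIV :: bool set" N] by simp

lemma card_generation: "card {x :: vertex. length x = N} = 2 ^ N"
  using card_lists_length_eq[of "UNIV :: bool set" N] by simp

text \<open>The dependence set stays explicit because the finite systems of inequalities need one
  finite set \<open>S\<close> on which a function, its truncated generator and its whole evolution
  depend.\<close>

definition depends_on :: "vertex set \<Rightarrow> (config \<Rightarrow> 'a) \<Rightarrow> bool" where
  "depends_on S F \<longleftrightarrow> (\<forall>\<eta> \<eta>'. (\<forall>x\<in>S. \<eta> x = \<eta>' x) \<longrightarrow> F \<eta> = F \<eta>')"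

lemma depends_onI: "(\<And>\<eta> \<eta>'. (\<And>x. x \<in> S \<Longrightarrow> \<eta> x = \<eta>' x) \<Longrightarrow> F \<eta> = F \<eta>') \<Longrightarrow> depends_on S F"
  unfolding depends_on_def by blast

lemma depends_onD: "depends_on S F \<Longrightarrow> (\<And>x. x \<in> S \<Longrightarrow> \<eta> x = \<eta>' x) \<Longrightarrow> F \<eta> = F \<eta>'"
  unfolding depends_on_def by blast

lemma depends_on_mono: "depends_on S F \<Longrightarrow> S \<subseteq> T \<Longrightarrow> depends_on T F"
  unfolding depends_on_def by blast

lemma depends_on_const [simp]: "depends_on S (\<lambda>_. c)"
  by (simp add: depends_on_def)

lemma depends_on_coordinate: "x \<in> S \<Longrightarrow> depends_on S (\<lambda>\<eta>. h (\<eta> x))"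
  by (auto simp: depends_on_def)

lemma depends_on_map: "depends_on S F \<Longrightarrow> depends_on S (\<lambda>\<eta>. h (F \<eta>))"
  unfolding depends_on_def by metis

lemma depends_on_map2: "depends_on S F \<Longrightarrow> depends_on S G \<Longrightarrow> depends_on S (\<lambda>\<eta>. h (F \<eta>) (G \<eta>))"
  unfolding depends_on_def by metis

lemma depends_on_sum: "(\<And>i. i \<in> I \<Longrightarrow> depends_on S (F i)) \<Longrightarrow> depends_on S (\<lambda>\<eta>. \<Sum>i\<in>I. F i \<eta>)"
  unfolding depends_on_def by (intro allI impI sum.cong refl) blast

lemma depends_on_prod: "(\<And>i. i \<in> I \<Longrightarrow> depends_on S (F i)) \<Longrightarrow> depends_on S (\<lambda>\<eta>. \<Prod>i\<in>I. F i \<eta>)"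
  unfolding depends_on_def by (intro allI impI prod.cong refl) blast

lemma depends_on_fun_upd: "depends_on S F \<Longrightarrow> depends_on (S - {x}) (\<lambda>\<eta>. F (\<eta>(x := b)))"
  by (intro depends_onI, erule depends_onD) simp

lemma depends_on_fun_upd': "depends_on S F \<Longrightarrow> depends_on S (\<lambda>\<eta>. F (\<eta>(x := b)))"
  by (rule depends_on_mono[OF depends_on_fun_upd]) auto

lemma depends_on_override_on:
  "depends_on S F \<Longrightarrow> depends_on (S \<inter> A) (\<lambda>\<sigma>. F (override_on \<zeta> \<sigma> A))"
  by (intro depends_onI, erule depends_onD) (simp add: override_on_def)

lemma local_function_iff: "local_function f \<longleftrightarrow> (\<exists>S. finite S \<and> depends_on S f)"
  by (simp add: local_function_def depends_on_def)

lemma depends_on_ad_rate: "x @ [False] \<in> S \<Longrightarrow> x @ [True] \<in> S \<Longrightarrow> depends_on S (ad_rate x)"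
  by (auto simp: depends_on_def ad_rate_def)

lemma ad_rate_fun_upd [simp]: "ad_rate x (\<eta>(x := b)) = ad_rate x \<eta>"
  by (simp add: ad_rate_def)

lemma ad_rate_nonneg [simp]: "0 \<le> ad_rate x \<eta>" and ad_rate_le_1 [simp]: "ad_rate x \<eta> \<le> 1"
  by (simp_all add: ad_rate_def)

text \<open>A pattern on \<open>S\<close> is coded by the set \<open>B\<close> of its occupied sites.\<close>

definition cylinder :: "vertex set \<Rightarrow> vertex set \<Rightarrow> config \<Rightarrow> real" where
  "cylinder S B \<eta> = (if \<forall>x\<in>S. \<eta> x = (x \<in> B) then 1 else 0)"

lemma depends_on_cylinder: "depends_on S (cylinder S B)"
  by (auto simp: depends_on_def cylinder_def)

text \<open>Exactly one pattern on \<open>S\<close> agrees with \<eta>. The expansion makes local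
  functions measurable and bounded, and in Duhamel's formula it separates time-dependent
  coefficients from fixed functions.\<close>

lemma cylinder_expansion:
  fixes F :: "config \<Rightarrow> real"
  assumes "finite S" "depends_on S F"
  shows "F \<eta> = (\<Sum>B\<in>Pow S. F (\<lambda>x. x \<in> B) * cylinder S B \<eta>)"
proof -
  let ?B = "{x\<in>S. \<eta> x}"
  have "(\<Sum>B\<in>Pow S. F (\<lambda>x. x \<in> B) * cylinder S B \<eta>) = (\<Sum>B\<in>{?B}. F (\<lambda>x. x \<in> B) * cylinder S B \<eta>)"
    using assms by (intro sum.mono_neutral_right) (auto simp: cylinder_def)
  also have "\<dots> = F \<eta>"
    by (simp add: cylinder_def) (rule depends_onD[OF assms(2)], simp)
  finally show ?thesis by simp
qed

lemma space_config_space [simp]: "space config_space = UNIV"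
  by (simp add: config_space_def space_PiM)

lemma sets_bernoulli_product [measurable_cong]: "sets (bernoulli_product p) = sets config_space"
  unfolding bernoulli_product_def config_space_def by (intro sets_PiM_cong) auto

lemma space_bernoulli_product [simp]: "space (bernoulli_product p) = UNIV"
  by (simp add: bernoulli_product_def space_PiM)

lemma prob_space_bernoulli_product: "prob_space (bernoulli_product p)"
  unfolding bernoulli_product_def by (intro prob_space_PiM prob_space_measure_pmf)

lemma measurable_coordinate [measurable]: "(\<lambda>\<eta>. \<eta> x) \<in> measurable config_space (count_space UNIV)"
  unfolding config_space_def by (rule measurable_component_singleton) simp

lemma measurable_cylinder: "finite S \<Longrightarrow> cylinder S B \<in> borel_measurable config_space"
  unfolding cylinder_def by measurable

lemma measurable_depends_on:
  fixes F :: "config \<Rightarrow> real"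
  assumes "finite S" "depends_on S F"
  shows "F \<in> borel_measurable config_space"
proof -
  have "F = (\<lambda>\<eta>. \<Sum>B\<in>Pow S. F (\<lambda>x. x \<in> B) * cylinder S B \<eta>)"
    by (rule ext) (rule cylinder_expansion[OF assms])
  also have "\<dots> \<in> borel_measurable config_space"
    using measurable_cylinder[OF assms(1)] by measurable
  finally show ?thesis .
qed

lemma bounded_depends_on:
  fixes F :: "config \<Rightarrow> real"
  assumes "finite S" "depends_on S F"
  obtains B where "0 \<le> B" "\<And>\<eta>. \<bar>F \<eta>\<bar> \<le> B"
proof
  show "0 \<le> (\<Sum>B\<in>Pow S. \<bar>F (\<lambda>x. x \<in> B)\<bar>)" by (simp add: sum_nonneg)
  fix \<eta>
  have "\<bar>F \<eta>\<bar> \<le> (\<Sum>B\<in>Pow S. \<bar>F (\<lambda>x. x \<in> B) * cylinder S B \<eta>\<bar>)"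
    by (subst cylinder_expansion[OF assms]) (rule sum_abs)
  also have "\<dots> \<le> (\<Sum>B\<in>Pow S. \<bar>F (\<lambda>x. x \<in> B)\<bar>)"
    by (intro sum_mono) (simp add: cylinder_def)
  finally show "\<bar>F \<eta>\<bar> \<le> (\<Sum>B\<in>Pow S. \<bar>F (\<lambda>x. x \<in> B)\<bar>)" .
qed

lemma integrable_depends_on:
  fixes F :: "config \<Rightarrow> real"
  assumes "finite S" "depends_on S F"
  shows "integrable (bernoulli_product p) F"
proof -
  interpret prob_space "bernoulli_product p" by (rule prob_space_bernoulli_product)
  obtain B where "\<And>\<eta>. \<bar>F \<eta>\<bar> \<le> B" using bounded_depends_on[OF assms] by metis
  then show ?thesis
    using measurable_depends_on[OF assms] by (intro integrable_const_bound[of _ B]) auto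
qed

lemma measure_bernoulli_product_UNIV [simp]: "measure (bernoulli_product p) UNIV = 1"
  using prob_space.prob_space[OF prob_space_bernoulli_product] by simp

lemma integral_const_bernoulli_product [simp]: "(\<integral>\<eta>. c \<partial>bernoulli_product p) = (c::real)"
proof -
  interpret prob_space "bernoulli_product p" by (rule prob_space_bernoulli_product)
  show ?thesis using prob_space by simp
qed

lemma abs_integral_local_le:
  fixes f :: "config \<Rightarrow> real"
  assumes "finite S" "depends_on S f" "\<And>\<eta>. \<bar>f \<eta>\<bar> \<le> B"
  shows "\<bar>\<integral>\<eta>. f \<eta> \<partial>bernoulli_product p\<bar> \<le> B"
proof -
  have "\<bar>\<integral>\<eta>. f \<eta> \<partial>bernoulli_product p\<bar> \<le> (\<integral>\<eta>. \<bar>f \<eta>\<bar> \<partial>bernoulli_product p)"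
    by (rule integral_abs_bound)
  also have "\<dots> \<le> (\<integral>\<eta>. B \<partial>bernoulli_product p)"
    using assms(3)
    by (intro integral_mono integrable_abs integrable_depends_on[OF assms(1,2)]
        integrable_depends_on[OF finite.emptyI depends_on_const])
  finally show ?thesis by (simp only: integral_const_bernoulli_product)
qed

section \<open>Resampling one site, and integrals of local functions as finite sums\<close>

locale bernoulli_parameter =
  fixes p :: real
  assumes p_nonneg: "0 \<le> p" and p_le_1: "p \<le> 1"
begin

abbreviation \<mu> :: "config measure" where "\<mu> \<equiv> bernoulli_product p"

lemma site_average_eq:
  "site_average p x F \<eta> = p * F (\<eta>(x := True)) + (1 - p) * F (\<eta>(x := False))"
  using p_nonneg p_le_1 by (simp add: site_average_def algebra_simps)

lemma depends_on_site_average_remove: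
  "depends_on S F \<Longrightarrow> depends_on (S - {x}) (site_average p x F)"
  unfolding site_average_eq[abs_def]
  by (intro depends_on_map2[where h="(+)"] depends_on_map[where h="\<lambda>r. _ * r"] depends_on_fun_upd)

lemma depends_on_site_average: "depends_on S F \<Longrightarrow> depends_on S (site_average p x F)"
  by (rule depends_on_mono[OF depends_on_site_average_remove]) auto

lemma site_average_trivial: "depends_on S F \<Longrightarrow> x \<notin> S \<Longrightarrow> site_average p x F \<eta> = F \<eta>"
proof -
  assume *: "depends_on S F" "x \<notin> S"
  then have "F (\<eta>(x := b)) = F \<eta>" for b by (intro depends_onD[OF *(1)]) auto
  then show ?thesis by (simp add: site_average_eq algebra_simps)
qed

text \<open>Overwriting one coordinate of a product-distributed configuration by an independent
  Bernoulli variable reproduces the product law; Fubini then separates the new coordinate.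
  Independence of the sites enters the later computations through this identity.\<close>

lemma integral_site_average:
  assumes S: "finite S" "depends_on S F"
  shows "(\<integral>\<eta>. site_average p x F \<eta> \<partial>\<mu>) = (\<integral>\<eta>. F \<eta> \<partial>\<mu>)"
proof -
  let ?b = "measure_pmf (bernoulli_pmf p)"
  interpret M: prob_space \<mu> by (rule prob_space_bernoulli_product)
  interpret b: prob_space ?b by (rule prob_space_measure_pmf)
  interpret P: pair_prob_space ?b \<mu> ..
  obtain B where B: "\<And>\<eta>. \<bar>F \<eta>\<bar> \<le> B" using bounded_depends_on[OF S] by metis
  have F [measurable]: "F \<in> borel_measurable config_space" by (rule measurable_depends_on[OF S])
  have upd: "(\<lambda>(b, X). X(x := b)) \<in> measurable (?b \<Otimes>\<^sub>M \<mu>) \<mu>"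
    unfolding bernoulli_product_def
    unfolding case_prod_beta by (rule measurable_fun_upd[where J=UNIV]) (auto intro: measurable_snd measurable_fst)
  have "(\<integral>\<eta>. F \<eta> \<partial>\<mu>) = (\<integral>\<eta>. F \<eta> \<partial>distr (?b \<Otimes>\<^sub>M \<mu>) \<mu> (\<lambda>(b, X). X(x := b)))"
    using distr_pair_PiM_eq_PiM[of "UNIV::vertex set" "\<lambda>_. ?b" x]
    by (simp add: bernoulli_product_def prob_space_measure_pmf)
  also have "\<dots> = (\<integral>z. F ((snd z)(x := fst z)) \<partial>(?b \<Otimes>\<^sub>M \<mu>))"
    by (subst integral_distr[OF upd]) (simp_all add: case_prod_beta)
  also have "\<dots> = (\<integral>\<eta>. (\<integral>b. F (\<eta>(x := b)) \<partial>?b) \<partial>\<mu>)"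
  proof -
    have "(\<lambda>z. F ((\<lambda>(b, X). X(x := b)) z)) \<in> borel_measurable (?b \<Otimes>\<^sub>M \<mu>)"
      by (rule measurable_compose[OF upd]) simp
    then have "integrable (?b \<Otimes>\<^sub>M \<mu>) (\<lambda>(b, \<eta>). F (\<eta>(x := b)))"
      using B by (intro P.integrable_const_bound[of _ B]) (auto simp: case_prod_beta)
    from P.integral_snd[OF this] show ?thesis by (simp add: case_prod_unfold)
  qed
  finally show ?thesis by (simp add: site_average_def[abs_def])
qed

definition weight :: "vertex set \<Rightarrow> vertex set \<Rightarrow> real" where
  "weight S B = (\<Prod>x\<in>S. if x \<in> B then p else 1 - p)"

lemma weight_nonneg: "0 \<le> weight S B"
  using p_nonneg p_le_1 by (auto simp: weight_def intro!: prod_nonneg)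

text \<open>The sites of \<open>S\<close> are averaged out one at a time; at each stage the patterns
  split according to the state of the removed site.\<close>

lemma integral_eq_sum_patterns:
  assumes "finite S" "depends_on S F"
  shows "(\<integral>\<eta>. F \<eta> \<partial>\<mu>) = (\<Sum>B\<in>Pow S. weight S B * F (\<lambda>x. x \<in> B))"
  using assms
proof (induction S arbitrary: F rule: finite_induct)
  case empty
  then have "F = (\<lambda>_. F (\<lambda>x. False))" by (intro ext depends_onD[OF empty(1)]) auto
  then have "(\<integral>\<eta>. F \<eta> \<partial>\<mu>) = F (\<lambda>x. False)" by (metis integral_const_bernoulli_product)
  then show ?case by (simp add: weight_def)
next
  case (insert x S)
  have d: "depends_on S (site_average p x F)"
    using depends_on_site_average_remove[OF insert.prems, of x] insert.hyps by simp
  have "(\<integral>\<eta>. F \<eta> \<partial>\<mu>) = (\<integral>\<eta>. site_average p x F \<eta> \<partial>\<mu>)"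
    using integral_site_average[of "insert x S" F x] insert by simp
  also have "\<dots> = (\<Sum>B\<in>Pow S. weight S B * site_average p x F (\<lambda>x. x \<in> B))"
    by (rule insert.IH[OF d])
  also have "\<dots> = (\<Sum>B\<in>Pow S. weight (insert x S) B * F (\<lambda>x. x \<in> B)) +
      (\<Sum>B\<in>Pow S. weight (insert x S) (insert x B) * F (\<lambda>y. y \<in> insert x B))"
  proof (subst sum.distrib[symmetric], rule sum.cong[OF refl])
    fix B assume "B \<in> Pow S"
    then have "x \<notin> B" using insert by auto
    then have "weight (insert x S) B = (1 - p) * weight S B"
      "weight (insert x S) (insert x B) = p * (\<Prod>y\<in>S. if y \<in> insert x B then p else 1 - p)"
      "(\<lambda>y. y \<in> B)(x := False) = (\<lambda>y. y \<in> B)" "(\<lambda>y. y \<in> B)(x := True) = (\<lambda>y. y \<in> insert x B)"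
      using insert.hyps by (auto simp: weight_def fun_eq_iff)
    moreover have "(\<Prod>y\<in>S. if y \<in> insert x B then p else 1 - p) = weight S B"
      using insert.hyps by (auto simp: weight_def intro!: prod.cong)
    ultimately show "weight S B * site_average p x F (\<lambda>x. x \<in> B) =
      weight (insert x S) B * F (\<lambda>x. x \<in> B) + weight (insert x S) (insert x B) * F (\<lambda>y. y \<in> insert x B)"
      by (simp add: site_average_eq ring_distribs del: insert_iff)
  qed
  also have "\<dots> = (\<Sum>B\<in>Pow (insert x S). weight (insert x S) B * F (\<lambda>x. x \<in> B))"
  proof -
    have "Pow (insert x S) = Pow S \<union> insert x ` Pow S" by (simp add: Pow_insert)
    moreover have "Pow S \<inter> insert x ` Pow S = {}" using insert by auto
    moreover have "inj_on (insert x) (Pow S)" using insert.hyps by (intro inj_onI) (metis Diff_insert_absorb PowD subsetD)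
    ultimately show ?thesis
      using insert.hyps by (simp add: sum.union_disjoint sum.reindex)
  qed
  finally show ?case .
qed

text \<open>The integral is a finite sum over patterns, so it can be differentiated term by
  term.\<close>

lemma has_derivative_integral:
  assumes "finite S" "\<And>t. depends_on S (F t)" "depends_on S F'"
    and "\<And>\<eta>. ((\<lambda>t. F t \<eta>) has_real_derivative F' \<eta>) (at t)"
  shows "((\<lambda>t. \<integral>\<eta>. F t \<eta> \<partial>\<mu>) has_real_derivative (\<integral>\<eta>. F' \<eta> \<partial>\<mu>)) (at t)"
  unfolding integral_eq_sum_patterns[OF assms(1,2)] integral_eq_sum_patterns[OF assms(1,3)]
  by (auto intro!: derivative_eq_intros assms(4) simp: mult.commute)

text \<open>Keeping a single term of a nonnegative sum turns an integral bound into a pointwise one;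
  dividing by the weight of the pattern is the price of a deterministic starting
  configuration.\<close>

lemma pattern_weight_le_integral:
  assumes "finite S" "depends_on S F" "\<And>\<eta>. 0 \<le> F \<eta>"
  shows "weight S {x\<in>S. \<eta> x} * F \<eta> \<le> (\<integral>\<eta>. F \<eta> \<partial>\<mu>)"
proof -
  have "F \<eta> = F (\<lambda>x. x \<in> {x\<in>S. \<eta> x})" by (intro depends_onD[OF assms(2)]) auto
  then have "weight S {x\<in>S. \<eta> x} * F \<eta> = (\<Sum>B\<in>{{x\<in>S. \<eta> x}}. weight S B * F (\<lambda>x. x \<in> B))" by simp
  also have "\<dots> \<le> (\<Sum>B\<in>Pow S. weight S B * F (\<lambda>x. x \<in> B))"
    using assms by (intro sum_mono2) (auto intro!: mult_nonneg_nonneg weight_nonneg)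
  also have "\<dots> = (\<integral>\<eta>. F \<eta> \<partial>\<mu>)" using integral_eq_sum_patterns[OF assms(1,2)] by simp
  finally show ?thesis .
qed

lemma weight_ge: "finite S \<Longrightarrow> min p (1 - p) ^ card S \<le> weight S B"
proof (induction S rule: finite_induct)
  case (insert x S)
  have "min p (1 - p) * min p (1 - p) ^ card S \<le> (if x \<in> B then p else 1 - p) * weight S B"
    using insert p_nonneg p_le_1 by (intro mult_mono) auto
  then show ?case using insert by (simp add: weight_def)
qed (simp add: weight_def)

lemma ad_generator_eq_sum:
  assumes "finite S" "depends_on S f"
  shows "ad_generator p f \<eta> = (\<Sum>x\<in>S. ad_rate x \<eta> * (site_average p x f \<eta> - f \<eta>))"
proof -
  have "ad_generator p f \<eta> = (\<Sum>\<^sub>\<infinity>x\<in>S. ad_rate x \<eta> * (site_average p x f \<eta> - f \<eta>))"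
    unfolding ad_generator_def using site_average_trivial[OF assms(2)]
    by (intro infsum_cong_neutral) auto
  then show ?thesis using assms by simp
qed

definition children :: "vertex set \<Rightarrow> vertex set" where
  "children S = (\<Union>x\<in>S. {x @ [False], x @ [True]})"

lemma finite_children [simp]: "finite S \<Longrightarrow> finite (children S)"
  by (simp add: children_def)

lemma depends_on_ad_generator:
  assumes "finite S" "depends_on S f"
  shows "depends_on (S \<union> children S) (ad_generator p f)"
proof -
  have "depends_on (S \<union> children S) (\<lambda>\<eta>. \<Sum>x\<in>S. ad_rate x \<eta> * (site_average p x f \<eta> - f \<eta>))"
  proof (rule depends_on_sum)
    fix x assume "x \<in> S"
    then have "depends_on (S \<union> children S) (ad_rate x)"
      by (intro depends_on_ad_rate) (auto simp: children_def)
    moreover have "depends_on (S \<union> children S) (\<lambda>\<eta>. site_average p x f \<eta> - f \<eta>)"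
      using assms depends_on_site_average by (intro depends_on_map2[where h="(-)"]) (blast intro: depends_on_mono)+
    ultimately show "depends_on (S \<union> children S) (\<lambda>\<eta>. ad_rate x \<eta> * (site_average p x f \<eta> - f \<eta>))"
      by (rule depends_on_map2)
  qed
  then show ?thesis
    unfolding ad_generator_eq_sum[OF assms, abs_def] .
qed

end

section \<open>The dynamics restricted to finitely many sites\<close>

text \<open>After multiplication by \<open>exp (- a * t)\<close> and subtraction of
  \<open>\<epsilon> * t\<close>, consider the largest value over \<open>I\<close> and
  \<open>{0..t}\<close>. If it exceeded \<open>M\<close>, it would be attained at a positive time,
  where the left difference quotients are nonnegative; but the inequality assumed at a maximising
  index forces a derivative of at most \<open>- \<epsilon>\<close>.\<close>

lemma finite_maximum_principle:
  fixes v v' :: "'i \<Rightarrow> real \<Rightarrow> real"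
  assumes I: "finite I"
    and deriv: "\<And>i t. i \<in> I \<Longrightarrow> 0 \<le> t \<Longrightarrow> (v i has_real_derivative v' i t) (at t)"
    and max: "\<And>i t. i \<in> I \<Longrightarrow> 0 \<le> t \<Longrightarrow> (\<And>j. j \<in> I \<Longrightarrow> v j t \<le> v i t) \<Longrightarrow> v' i t \<le> a * v i t"
    and init: "\<And>i. i \<in> I \<Longrightarrow> v i 0 \<le> M"
    and i: "i \<in> I" and t: "0 \<le> t"
  shows "v i t \<le> exp (a * t) * M"
proof -
  have key: "exp (- a * t) * v i t - \<epsilon> * t \<le> M" if \<epsilon>: "0 < \<epsilon>" for \<epsilon>
  proof (rule ccontr)
    define w where "w j s = exp (- a * s) * v j s - \<epsilon> * s" for j s
    assume "\<not> ?thesis"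
    then have gt: "M < w i t" by (simp add: w_def)
    have w_deriv: "(w j has_real_derivative exp (- a * s) * (v' j s - a * v j s) - \<epsilon>) (at s)"
      if "j \<in> I" "0 \<le> s" for j s
      unfolding w_def by (auto intro!: derivative_eq_intros deriv that simp: algebra_simps)
    have "\<exists>s\<in>{0..t}. \<forall>s'\<in>{0..t}. w j s' \<le> w j s" if "j \<in> I" for j
      using t that
      by (intro continuous_attains_sup continuous_at_imp_continuous_on ballI)
         (auto intro!: DERIV_isCont w_deriv)
    then obtain \<tau> where \<tau>: "\<And>j. j \<in> I \<Longrightarrow> \<tau> j \<in> {0..t}"
      "\<And>j s'. j \<in> I \<Longrightarrow> s' \<in> {0..t} \<Longrightarrow> w j s' \<le> w j (\<tau> j)"
      by metis
    obtain j where j: "j \<in> I" "\<And>k. k \<in> I \<Longrightarrow> w k (\<tau> k) \<le> w j (\<tau> j)"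
    proof -
      have "(\<lambda>j. w j (\<tau> j)) ` I \<noteq> {}" "finite ((\<lambda>j. w j (\<tau> j)) ` I)" using i I by auto
      from Max_in[OF this(2,1)] Max_ge[OF this(2)] that show ?thesis by fastforce
    qed
    have top: "w k s \<le> w j (\<tau> j)" if "k \<in> I" "s \<in> {0..t}" for k s
      using \<tau>(2)[OF that] j(2)[OF that(1)] by linarith
    have "w j (\<tau> j) > M" using top[OF i, of t] gt t by auto
    moreover have "w j 0 \<le> M" using init[OF j(1)] by (simp add: w_def)
    ultimately have pos: "0 < \<tau> j" using \<tau>(1)[OF j(1)] by (cases "\<tau> j = 0") auto
    \<comment> \<open>At a common time the factor and the slack are the same for all indices, so
      maximality of \<open>w\<close> passes to \<open>v\<close>.\<close>
    have "v k (\<tau> j) \<le> v j (\<tau> j)" if "k \<in> I" for k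
      using top[OF that \<tau>(1)[OF j(1)]] by (simp add: w_def)
    then have "v' j (\<tau> j) \<le> a * v j (\<tau> j)" using pos j(1) by (intro max) auto
    then have "exp (- a * \<tau> j) * (v' j (\<tau> j) - a * v j (\<tau> j)) - \<epsilon> < 0"
      using \<epsilon> by (smt (verit, best) exp_gt_zero mult_nonneg_nonpos)
    from DERIV_neg_dec_left[OF w_deriv this] obtain d where d: "0 < d"
      "\<And>h. 0 < h \<Longrightarrow> h < d \<Longrightarrow> w j (\<tau> j) < w j (\<tau> j - h)"
      using j(1) pos by auto
    define h where "h = min (d / 2) (\<tau> j)"
    have "0 < h" "h < d" "\<tau> j - h \<in> {0..t}"
      using d(1) pos \<tau>(1)[OF j(1)] by (auto simp: h_def)
    with d(2)[of h] top[OF j(1), of "\<tau> j - h"] show False by simp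
  qed
  have "exp (- a * t) * v i t \<le> M"
  proof (rule field_le_epsilon)
    fix e :: real assume e: "0 < e"
    \<comment> \<open>The slope \<open>e / (t + 1)\<close> keeps the slack below \<open>e\<close>,
      also at \<open>t = 0\<close>.\<close>
    have "exp (- a * t) * v i t - e / (t + 1) * t \<le> M" using e t by (intro key) auto
    moreover have "e / (t + 1) * t \<le> e" using e t by (simp add: field_simps)
    ultimately show "exp (- a * t) * v i t \<le> M + e" by linarith
  qed
  then have "exp (a * t) * (exp (- a * t) * v i t) \<le> exp (a * t) * M" by simp
  then show ?thesis by (simp add: exp_minus field_simps)
qed

text \<open>One representative for each pattern on \<open>S\<close>, vacant elsewhere: the maximum
  principle needs configurations to range over a finite set.\<close>

definition supported :: "vertex set \<Rightarrow> config set" where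
  "supported S = (\<lambda>B x. x \<in> B) ` Pow S"

lemma finite_supported [simp]: "finite S \<Longrightarrow> finite (supported S)"
  by (simp add: supported_def)

lemma supported_iff: "\<zeta> \<in> supported S \<longleftrightarrow> (\<forall>x. \<zeta> x \<longrightarrow> x \<in> S)"
proof
  assume "\<forall>x. \<zeta> x \<longrightarrow> x \<in> S"
  then show "\<zeta> \<in> supported S" unfolding supported_def
    by (intro image_eqI[where x="{x. \<zeta> x}"]) auto
qed (auto simp: supported_def)

lemma supported_fun_upd: "\<zeta> \<in> supported S \<Longrightarrow> x \<in> S \<Longrightarrow> \<zeta>(x := b) \<in> supported S"
  by (auto simp: supported_iff)

definition restrict_config :: "vertex set \<Rightarrow> config \<Rightarrow> config" where
  "restrict_config S \<eta> = (\<lambda>x. \<eta> x \<and> x \<in> S)"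

lemma restrict_config_supported [simp]: "restrict_config S \<eta> \<in> supported S"
  by (simp add: supported_iff restrict_config_def)

context bernoulli_parameter begin

text \<open>Only the sites of \<Lambda> are updated; their rates may still read children outside
  \<Lambda>, which are frozen. On bounded functions this is a bounded operator.\<close>

definition partial_generator :: "vertex set \<Rightarrow> (config \<Rightarrow> real) \<Rightarrow> config \<Rightarrow> real" where
  "partial_generator \<Lambda> f \<eta> = (\<Sum>x\<in>\<Lambda>. ad_rate x \<eta> * (site_average p x f \<eta> - f \<eta>))"

lemma depends_on_partial_generator:
  assumes "depends_on S f" "\<Lambda> \<union> children \<Lambda> \<subseteq> S"
  shows "depends_on S (partial_generator \<Lambda> f)"
  unfolding partial_generator_def[abs_def]
proof (rule depends_on_sum)
  fix x assume "x \<in> \<Lambda>"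
  then have "depends_on S (ad_rate x)"
    using assms(2) by (intro depends_on_ad_rate) (auto simp: children_def)
  moreover have "depends_on S (\<lambda>\<eta>. site_average p x f \<eta> - f \<eta>)"
    using assms depends_on_site_average by (intro depends_on_map2[where h="(-)"])
  ultimately show "depends_on S (\<lambda>\<eta>. ad_rate x \<eta> * (site_average p x f \<eta> - f \<eta>))"
    by (rule depends_on_map2)
qed

lemma site_average_abs_le: "(\<And>\<eta>. \<bar>f \<eta>\<bar> \<le> B) \<Longrightarrow> \<bar>site_average p x f \<eta>\<bar> \<le> B"
proof -
  assume B: "\<And>\<eta>. \<bar>f \<eta>\<bar> \<le> B"
  have "\<bar>site_average p x f \<eta>\<bar> \<le> p * \<bar>f (\<eta>(x := True))\<bar> + (1 - p) * \<bar>f (\<eta>(x := False))\<bar>"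
    using p_nonneg p_le_1 by (simp add: site_average_eq abs_mult order_trans[OF abs_triangle_ineq])
  also have "\<dots> \<le> p * B + (1 - p) * B"
    using p_nonneg p_le_1 B by (intro add_mono mult_left_mono) auto
  finally show ?thesis by (simp add: algebra_simps)
qed

lemma partial_generator_abs_le:
  assumes B: "\<And>\<eta>. \<bar>f \<eta>\<bar> \<le> B"
  shows "\<bar>partial_generator \<Lambda> f \<eta>\<bar> \<le> 2 * real (card \<Lambda>) * B"
proof -
  have "\<bar>partial_generator \<Lambda> f \<eta>\<bar> \<le> (\<Sum>x\<in>\<Lambda>. \<bar>ad_rate x \<eta> * (site_average p x f \<eta> - f \<eta>)\<bar>)"
    unfolding partial_generator_def by (rule sum_abs)
  also have "\<dots> \<le> (\<Sum>x\<in>\<Lambda>. 2 * B)"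
  proof (rule sum_mono)
    fix x
    have "\<bar>ad_rate x \<eta> * (site_average p x f \<eta> - f \<eta>)\<bar> \<le> \<bar>site_average p x f \<eta> - f \<eta>\<bar>"
      by (simp add: abs_mult mult_left_le_one_le)
    also have "\<dots> \<le> 2 * B" using site_average_abs_le[of f B x \<eta>, OF B] B[of \<eta>] by linarith
    finally show "\<bar>ad_rate x \<eta> * (site_average p x f \<eta> - f \<eta>)\<bar> \<le> 2 * B" .
  qed
  finally show ?thesis by (simp add: algebra_simps)
qed

text \<open>The exponential series of a bounded operator, which solves the backward equation of the
  truncated dynamics.\<close>

definition partial_flow :: "vertex set \<Rightarrow> (config \<Rightarrow> real) \<Rightarrow> real \<Rightarrow> config \<Rightarrow> real" where
  "partial_flow \<Lambda> f t \<eta> = (\<Sum>k. (partial_generator \<Lambda> ^^ k) f \<eta> / fact k * t ^ k)"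

text \<open>\<open>S\<close> contains all updated sites and everything their rates read, so no
  iterate of the generator leaves the functions of \<open>S\<close>.\<close>

lemma depends_on_partial_flow:
  assumes "depends_on S f" "\<Lambda> \<union> children \<Lambda> \<subseteq> S"
  shows "depends_on S (partial_flow \<Lambda> f t)"
proof -
  have "depends_on S ((partial_generator \<Lambda> ^^ k) f)" for k
    by (induction k) (auto intro: assms(1) depends_on_partial_generator[OF _ assms(2)])
  from depends_onD[OF this] show ?thesis
    unfolding partial_flow_def by (intro depends_onI suminf_cong arg_cong2[where f="(*)"] arg_cong2[where f="(/)"] refl) blast
qed

lemma partial_flow_0 [simp]: "partial_flow \<Lambda> f 0 = f"
proof
  fix \<eta>
  have "(\<lambda>k. (partial_generator \<Lambda> ^^ k) f \<eta> / fact k * 0 ^ k) sums f \<eta>"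
    using powser_sums_zero[of "\<lambda>k. (partial_generator \<Lambda> ^^ k) f \<eta> / fact k"] by simp
  then show "partial_flow \<Lambda> f 0 \<eta> = f \<eta>" unfolding partial_flow_def by (rule sums_unique[symmetric])
qed

lemma summable_partial_flow:
  assumes B: "\<And>\<eta>. \<bar>f \<eta>\<bar> \<le> B"
  shows "summable (\<lambda>k. (partial_generator \<Lambda> ^^ k) f \<eta> / fact k * t ^ k)"
proof (rule summable_comparison_test)
  have bound: "\<bar>(partial_generator \<Lambda> ^^ k) f \<eta>\<bar> \<le> (2 * real (card \<Lambda>)) ^ k * B" for k \<eta>
  proof (induction k arbitrary: \<eta>)
    case (Suc k)
    from partial_generator_abs_le[OF this] show ?case by (simp add: mult.assoc)
  qed (simp add: B)
  show "\<exists>N. \<forall>k\<ge>N. norm ((partial_generator \<Lambda> ^^ k) f \<eta> / fact k * t ^ k) \<le>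
      B * (inverse (fact k) * (2 * real (card \<Lambda>) * \<bar>t\<bar>) ^ k)"
  proof (intro exI[of _ 0] allI impI)
    fix k
    have "norm ((partial_generator \<Lambda> ^^ k) f \<eta> / fact k * t ^ k) =
        \<bar>(partial_generator \<Lambda> ^^ k) f \<eta>\<bar> * (\<bar>t\<bar> ^ k / fact k)"
      by (simp add: abs_mult power_abs)
    also have "\<dots> \<le> (2 * real (card \<Lambda>)) ^ k * B * (\<bar>t\<bar> ^ k / fact k)"
      by (intro mult_right_mono bound) auto
    finally show "norm ((partial_generator \<Lambda> ^^ k) f \<eta> / fact k * t ^ k) \<le>
      B * (inverse (fact k) * (2 * real (card \<Lambda>) * \<bar>t\<bar>) ^ k)"
      by (simp add: power_mult_distrib field_simps)
  qed
  show "summable (\<lambda>k. B * (inverse (fact k) * (2 * real (card \<Lambda>) * \<bar>t\<bar>) ^ k))"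
    by (intro summable_mult summable_exp)
qed

text \<open>Termwise differentiation shifts the coefficients by one place, which amounts to one
  application of the generator to the series.\<close>

lemma partial_flow_deriv:
  assumes S: "finite S" "depends_on S f"
  shows "((\<lambda>t. partial_flow \<Lambda> f t \<eta>) has_real_derivative partial_generator \<Lambda> (partial_flow \<Lambda> f t) \<eta>) (at t)"
proof -
  obtain B where B: "\<And>\<eta>. \<bar>f \<eta>\<bar> \<le> B" using bounded_depends_on[OF S] by metis
  define c where "c \<eta> k = (partial_generator \<Lambda> ^^ k) f \<eta> / fact k" for \<eta> k
  have flow: "partial_flow \<Lambda> f t \<eta> = (\<Sum>k. c \<eta> k * t ^ k)" for t \<eta>
    by (simp add: partial_flow_def c_def)
  have sm: "summable (\<lambda>k. c \<eta> k * t ^ k)" for \<eta> t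
    unfolding c_def using B by (rule summable_partial_flow)
  then have s: "(\<lambda>k. c \<eta> k * t ^ k) sums partial_flow \<Lambda> f t \<eta>" for \<eta>
    by (simp add: flow summable_sums)
  have "(\<lambda>k. \<Sum>x\<in>\<Lambda>. ad_rate x \<eta> * (p * (c (\<eta>(x := True)) k * t ^ k) +
       (1 - p) * (c (\<eta>(x := False)) k * t ^ k) - c \<eta> k * t ^ k)) sums partial_generator \<Lambda> (partial_flow \<Lambda> f t) \<eta>"
    unfolding partial_generator_def site_average_eq
    by (intro sums_sum sums_mult sums_diff sums_add s)
  also have "(\<lambda>k. \<Sum>x\<in>\<Lambda>. ad_rate x \<eta> * (p * (c (\<eta>(x := True)) k * t ^ k) +
       (1 - p) * (c (\<eta>(x := False)) k * t ^ k) - c \<eta> k * t ^ k)) = (\<lambda>k. diffs (c \<eta>) k * t ^ k)"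
  proof
    fix k
    have nz: "real (Suc k) * (X / (of_nat (Suc k) * fact k)) = X / fact k" for k and X :: real by simp
    have "diffs (c \<eta>) k = (partial_generator \<Lambda> ^^ Suc k) f \<eta> / fact k"
      using nz[of k] by (simp only: diffs_def c_def fact_Suc)
    also have "\<dots> = (\<Sum>x\<in>\<Lambda>. ad_rate x \<eta> * (p * c (\<eta>(x := True)) k + (1 - p) * c (\<eta>(x := False)) k - c \<eta> k))"
      unfolding funpow.simps comp_def partial_generator_def site_average_eq c_def sum_divide_distrib
      by (intro sum.cong refl) (simp add: field_simps)
    finally show "(\<Sum>x\<in>\<Lambda>. ad_rate x \<eta> * (p * (c (\<eta>(x := True)) k * t ^ k) +
       (1 - p) * (c (\<eta>(x := False)) k * t ^ k) - c \<eta> k * t ^ k)) = diffs (c \<eta>) k * t ^ k"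
      by (simp only: sum_distrib_right) (intro sum.cong refl, simp add: algebra_simps)
  qed
  finally have "(\<Sum>k. diffs (c \<eta>) k * t ^ k) = partial_generator \<Lambda> (partial_flow \<Lambda> f t) \<eta>"
    by (simp add: sums_iff)
  with termdiffs_strong_converges_everywhere[of "c \<eta>" t, OF sm] show ?thesis by (simp add: flow)
qed

lemma site_average_diff:
  "site_average p y g \<eta> - g \<eta> =
    (if \<eta> y then - (1 - p) else p) * (g (\<eta>(y := True)) - g (\<eta>(y := False)))"
proof (cases "\<eta> y")
  case True
  then have "\<eta>(y := True) = \<eta>" by (auto simp: fun_eq_iff)
  with True show ?thesis by (simp add: site_average_eq algebra_simps)
next
  case False
  then have "\<eta>(y := False) = \<eta>" by (auto simp: fun_eq_iff)
  with False show ?thesis by (simp add: site_average_eq algebra_simps)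
qed

lemma site_average_diff_abs_le:
  "\<bar>site_average p y g \<eta> - g \<eta>\<bar> \<le> \<bar>g (\<eta>(y := True)) - g (\<eta>(y := False))\<bar>"
  unfolding site_average_diff abs_mult using p_nonneg p_le_1 by (intro mult_left_le_one_le) auto

text \<open>Finite speed of propagation: a site influences \<open>f\<close> only through its parent, so weighting the
  discrete gradient at \<open>x\<close> by \<open>4 ^ length x\<close> turns the influence of the parent into a growth rate
  of at most 4, while the weight still beats the \<open>2 ^ length x\<close> sites of that generation.\<close>

lemma partial_flow_gradient:
  assumes S: "finite S" "depends_on S f" "\<Lambda> \<union> children \<Lambda> \<subseteq> S"
    and f: "depends_on {x. length x < n} f" "\<And>\<eta>. \<bar>f \<eta>\<bar> \<le> B"
    and t: "0 \<le> t" and x: "x \<in> S"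
  shows "4 ^ length x * \<bar>partial_flow \<Lambda> f t (\<eta>(x := True)) - partial_flow \<Lambda> f t (\<eta>(x := False))\<bar>
    \<le> exp (4 * t) * (4 ^ n * (2 * B))"
proof -
  define g where "g = partial_flow \<Lambda> f"
  \<comment> \<open>The two signs let one-sided estimates control absolute values.\<close>
  define I where "I = S \<times> {1, -1 :: real} \<times> supported S"
  define D where "D h x \<zeta> = h (\<zeta>(x := True)) - h (\<zeta>(x := False))" for h :: "config \<Rightarrow> real" and x :: vertex and \<zeta>
  define v where "v = (\<lambda>(x, s, \<zeta>) t. 4 ^ length x * s * D (g t) x \<zeta>)"
  define v' where "v' = (\<lambda>(x, s, \<zeta>) t. 4 ^ length x * s * D (partial_generator \<Lambda> (g t)) x \<zeta>)"
  have "0 \<le> \<bar>f (\<lambda>_. True)\<bar>" by simp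
  then have B0: "0 \<le> B" using f(2)[of "\<lambda>_. True"] by linarith
  have bound: "v i t \<le> exp (4 * t) * (4 ^ n * (2 * B))" if "i \<in> I" for i
  proof (rule finite_maximum_principle[where I=I and v'=v'])
    show "finite I" using S by (simp add: I_def)
    show "(v i has_real_derivative v' i t) (at t)" for i t
      unfolding v_def v'_def D_def g_def
      by (auto split: prod.splits intro!: derivative_eq_intros partial_flow_deriv[OF S(1,2)])
    show "v i 0 \<le> 4 ^ n * (2 * B)" if "i \<in> I" for i
    proof -
      obtain x s \<zeta> where i: "i = (x, s, \<zeta>)" "x \<in> S" "s = 1 \<or> s = -1" using \<open>i \<in> I\<close> by (cases i) (auto simp: I_def)
      show ?thesis
      proof (cases "length x < n")
        case True
        have "s * D f x \<zeta> \<le> \<bar>D f x \<zeta>\<bar>" using i(3) by auto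
        also have "\<dots> \<le> 2 * B" using f(2)[of "\<zeta>(x := True)"] f(2)[of "\<zeta>(x := False)"] unfolding D_def by linarith
        finally have "4 ^ length x * (s * D f x \<zeta>) \<le> 4 ^ length x * (2 * B)" by simp
        also have "\<dots> \<le> 4 ^ n * (2 * B)" using True B0 by (intro mult_right_mono power_increasing) auto
        finally show ?thesis by (simp add: i v_def g_def mult.assoc)
      next
        case False
        then have "D f x \<zeta> = 0" unfolding D_def by (simp, intro depends_onD[OF f(1)]) auto
        then show ?thesis using B0 by (simp add: i v_def g_def)
      qed
    qed
    show "v' i t \<le> 4 * v i t" if "i \<in> I" and mx: "\<And>j. j \<in> I \<Longrightarrow> v j t \<le> v i t" for i t
    proof -
      obtain x s \<zeta> where i: "i = (x, s, \<zeta>)" "x \<in> S" "s = 1 \<or> s = -1" "\<zeta> \<in> supported S"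
        using \<open>i \<in> I\<close> by (cases i) (auto simp: I_def)
      define m where "m = v i t"
      have mx': "4 ^ length y * s' * D (g t) y \<zeta>' \<le> m" if "y \<in> S" "s' = 1 \<or> s' = -1" "\<zeta>' \<in> supported S" for y s' \<zeta>'
        using mx[of "(y, s', \<zeta>')"] that by (auto simp: I_def m_def v_def)
      have m: "m = 4 ^ length x * s * D (g t) x \<zeta>" by (simp add: m_def i v_def)
      have m0: "0 \<le> m" using mx'[of x "-s" \<zeta>] i m by auto
      define T where "T y \<eta> = ad_rate y \<eta> * (site_average p y (g t) \<eta> - g t \<eta>)" for y \<eta>
      \<comment> \<open>Resampling \<open>x\<close> itself contracts its gradient. Resampling a site
        whose rate ignores \<open>x\<close> averages gradients at \<open>x\<close>, all bounded by
        \<open>m\<close>. Only the rate of the parent reads \<open>x\<close>: it vanishes when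
        \<open>x\<close> is occupied, and with \<open>x\<close> vacant the term is at most the
        gradient at the parent, where the ratio of the weights gives the factor 4.\<close>
      have T: "4 ^ length x * s * D (T y) x \<zeta> \<le> (if y = butlast x then 4 * m else 0)" if "y \<in> \<Lambda>" for y
      proof -
        have y: "y \<in> S" using that S(3) by auto
        consider "y = x" | b where "x = y @ [b]" | "y \<noteq> x" "\<And>b. x \<noteq> y @ [b]" by blast
        then show ?thesis
        proof cases
          case 1
          have "D (T x) x \<zeta> = - ad_rate x \<zeta> * D (g t) x \<zeta>"
            by (simp add: D_def T_def site_average_eq algebra_simps)
          then have "4 ^ length x * s * D (T y) x \<zeta> = - ad_rate x \<zeta> * m" by (simp add: 1 m)
          also have "\<dots> \<le> 0" using m0 by simp
          finally show ?thesis using m0 by (auto split: if_split)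
        next
          case 2
          let ?\<zeta> = "\<zeta>(x := False)"
          have "T y (\<zeta>(x := True)) = 0" using 2 by (cases b) (auto simp: T_def ad_rate_def)
          then have "s * D (T y) x \<zeta> \<le> \<bar>T y ?\<zeta>\<bar>" using i(3) by (auto simp: D_def)
          also have "\<dots> \<le> \<bar>site_average p y (g t) ?\<zeta> - g t ?\<zeta>\<bar>"
            by (simp add: T_def abs_mult mult_left_le_one_le)
          also have "\<dots> \<le> \<bar>D (g t) y ?\<zeta>\<bar>" unfolding D_def by (rule site_average_diff_abs_le)
          finally have "4 ^ length x * (s * D (T y) x \<zeta>) \<le> 4 ^ length x * \<bar>D (g t) y ?\<zeta>\<bar>" by simp
          also have "\<dots> = 4 * (4 ^ length y * \<bar>D (g t) y ?\<zeta>\<bar>)" using 2 by simp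
          also have "4 ^ length y * \<bar>D (g t) y ?\<zeta>\<bar> \<le> m"
            using mx'[of y 1 ?\<zeta>] mx'[of y "-1" ?\<zeta>] y supported_fun_upd[OF i(4,2)] by (auto simp: abs_if)
          finally show ?thesis using 2 by (simp add: mult.assoc)
        next
          case 3
          have r: "ad_rate y (\<zeta>(x := b)) = ad_rate y \<zeta>" for b
            using 3(2)[of True] 3(2)[of False] by (auto simp: ad_rate_def)
          have tw: "\<zeta>(x := b, y := c) = \<zeta>(y := c, x := b)" for b c using 3(1) by (simp add: fun_upd_twist)
          have "4 ^ length x * s * D (T y) x \<zeta> = ad_rate y \<zeta> *
             (p * (4 ^ length x * s * D (g t) x (\<zeta>(y := True))) + (1 - p) * (4 ^ length x * s * D (g t) x (\<zeta>(y := False))) - m)"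
            by (simp add: D_def T_def r tw m site_average_eq algebra_simps)
          also have "\<dots> \<le> ad_rate y \<zeta> * (p * m + (1 - p) * m - m)"
            using p_nonneg p_le_1 mx'[OF i(2,3) supported_fun_upd[OF i(4) y]]
            by (intro mult_left_mono diff_right_mono add_mono) auto
          also have "\<dots> = 0" by (simp add: algebra_simps)
          finally have "4 ^ length x * s * D (T y) x \<zeta> \<le> 0" .
          also have "0 \<le> (if y = butlast x then 4 * m else 0)" using m0 by simp
          finally show ?thesis .
        qed
      qed
      have "v' i t = (\<Sum>y\<in>\<Lambda>. 4 ^ length x * s * D (T y) x \<zeta>)"
        by (simp add: i v'_def D_def partial_generator_def T_def sum_subtractf flip: sum_distrib_left)
      also have "\<dots> \<le> (\<Sum>y\<in>\<Lambda>. if y = butlast x then 4 * m else 0)" by (rule sum_mono) (rule T)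
      also have "\<dots> \<le> 4 * m" using m0 S(1,3) finite_subset[of \<Lambda> S] by (simp add: sum.delta)
      finally show ?thesis by (simp add: m_def)
    qed
  qed (use that t in auto)
  have "4 ^ length x * s * D (g t) x \<eta> \<le> exp (4 * t) * (4 ^ n * (2 * B))" if s: "s = 1 \<or> s = -1" for s
  proof -
    have "g t (\<eta>(x := b)) = g t ((restrict_config S \<eta>)(x := b))" for b unfolding g_def
      by (rule depends_onD[OF depends_on_partial_flow[OF S(2,3)]]) (simp add: restrict_config_def)
    then have "D (g t) x \<eta> = D (g t) x (restrict_config S \<eta>)" by (simp add: D_def)
    moreover have "(x, s, restrict_config S \<eta>) \<in> I" using x s by (auto simp: I_def)
    ultimately show ?thesis using bound[of "(x, s, restrict_config S \<eta>)"] by (simp add: v_def)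
  qed
  from this[of 1] this[of "-1"] show ?thesis
    unfolding D_def g_def by (auto simp: abs_if right_diff_distrib)
qed

end

section \<open>The semigroup of the process\<close>

locale ad_semigroup = bernoulli_parameter p for p :: real +
  fixes K :: "real \<Rightarrow> config \<Rightarrow> config measure"
  assumes process: "ad_process p K"
begin

definition T :: "real \<Rightarrow> (config \<Rightarrow> real) \<Rightarrow> config \<Rightarrow> real" where
  "T t f \<eta> = (\<integral>\<omega>. f \<omega> \<partial>K t \<eta>)"

lemma kernel_measurable: "0 \<le> t \<Longrightarrow> K t \<in> config_space \<rightarrow>\<^sub>M subprob_algebra config_space"
  using process by (auto simp: ad_process_def intro: measurable_prob_algebraD)

lemma prob_space_kernel: "0 \<le> t \<Longrightarrow> prob_space (K t \<eta>)"
  and sets_kernel: "0 \<le> t \<Longrightarrow> sets (K t \<eta>) = sets config_space"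
proof -
  assume "0 \<le> t"
  then have "K t \<in> config_space \<rightarrow>\<^sub>M prob_algebra config_space" using process by (simp add: ad_process_def)
  then have "K t \<eta> \<in> space (prob_algebra config_space)" by (rule measurable_space) simp
  then show "prob_space (K t \<eta>)" "sets (K t \<eta>) = sets config_space" by (auto simp: space_prob_algebra)
qed

lemma kernel_integrable:
  assumes "0 \<le> t" "f \<in> borel_measurable config_space" "\<And>\<omega>. \<bar>f \<omega>\<bar> \<le> B"
  shows "integrable (K t \<eta>) (f :: config \<Rightarrow> real)"
proof -
  interpret prob_space "K t \<eta>" by (rule prob_space_kernel[OF assms(1)])
  have "f \<in> borel_measurable (K t \<eta>)"
    using assms(2) by (simp add: measurable_cong_sets[OF sets_kernel[OF assms(1)] refl])
  then show ?thesis using assms(3) by (intro integrable_const_bound[of _ B]) auto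
qed

lemma T_abs_le:
  assumes "0 \<le> t" "f \<in> borel_measurable config_space" "\<And>\<omega>. \<bar>f \<omega>\<bar> \<le> B"
  shows "\<bar>T t f \<eta>\<bar> \<le> B"
proof -
  interpret prob_space "K t \<eta>" by (rule prob_space_kernel[OF assms(1)])
  have "\<bar>T t f \<eta>\<bar> \<le> (\<integral>\<omega>. \<bar>f \<omega>\<bar> \<partial>K t \<eta>)" unfolding T_def by (rule integral_abs_bound)
  also have "\<dots> \<le> (\<integral>\<omega>. B \<partial>K t \<eta>)"
    using kernel_integrable[OF assms] assms(3) by (intro integral_mono) auto
  finally show ?thesis using prob_space by simp
qed

lemma T_mono:
  assumes "0 \<le> t" and f: "f \<in> borel_measurable config_space" "\<And>\<omega>. \<bar>f \<omega>\<bar> \<le> B"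
    and g: "g \<in> borel_measurable config_space" "\<And>\<omega>. \<bar>g \<omega>\<bar> \<le> B'"
    and "\<And>\<omega>. f \<omega> \<le> g \<omega>"
  shows "T t f \<eta> \<le> T t g \<eta>"
  unfolding T_def using kernel_integrable[OF assms(1) f] kernel_integrable[OF assms(1) g] assms(6)
  by (rule integral_mono)

lemma T_cmult: "T t (\<lambda>\<omega>. c * f \<omega>) \<eta> = c * T t f \<eta>"
  by (simp add: T_def)

lemma T_diff:
  assumes "0 \<le> t" and f: "f \<in> borel_measurable config_space" "\<And>\<omega>. \<bar>f \<omega>\<bar> \<le> B"
    and g: "g \<in> borel_measurable config_space" "\<And>\<omega>. \<bar>g \<omega>\<bar> \<le> B'"
  shows "T t (\<lambda>\<omega>. f \<omega> - g \<omega>) \<eta> = T t f \<eta> - T t g \<eta>"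
  unfolding T_def using kernel_integrable[OF assms(1) f] kernel_integrable[OF assms(1) g]
  by (rule Bochner_Integration.integral_diff)

lemma T_sum:
  assumes "0 \<le> t" and "\<And>i. i \<in> I \<Longrightarrow> finite S" "\<And>i. i \<in> I \<Longrightarrow> depends_on S (f i)"
  shows "T t (\<lambda>\<omega>. \<Sum>i\<in>I. f i \<omega>) \<eta> = (\<Sum>i\<in>I. T t (f i) \<eta>)"
  unfolding T_def
proof (rule Bochner_Integration.integral_sum)
  fix i assume i: "i \<in> I"
  obtain B where "\<And>\<omega>. \<bar>f i \<omega>\<bar> \<le> B" using bounded_depends_on[OF assms(2,3)[OF i]] by metis
  then show "integrable (K t \<eta>) (f i)"
    by (rule kernel_integrable[OF assms(1) measurable_depends_on[OF assms(2,3)[OF i]]])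
qed

lemma T_measurable:
  assumes "0 \<le> t" "f \<in> borel_measurable config_space" "\<And>\<omega>. \<bar>f \<omega>\<bar> \<le> B"
  shows "T t f \<in> borel_measurable config_space"
proof -
  have "(\<lambda>M. integral\<^sup>L M f) \<in> borel_measurable (subprob_algebra config_space)"
    by (rule integral_measurable_subprob_algebra) (use assms in auto)
  from measurable_compose[OF kernel_measurable[OF assms(1)] this] show ?thesis by (simp add: T_def[abs_def])
qed

lemma T_0: "f \<in> borel_measurable config_space \<Longrightarrow> T 0 f \<eta> = f \<eta>"
  using process by (simp add: T_def ad_process_def integral_return)

lemma T_semigroup:
  assumes "0 \<le> s" "0 \<le> t" and f: "f \<in> borel_measurable config_space" "\<And>\<omega>. \<bar>f \<omega>\<bar> \<le> B"
  shows "T (s + t) f \<eta> = T s (T t f) \<eta>"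
proof -
  interpret s: prob_space "K s \<eta>" by (rule prob_space_kernel[OF assms(1)])
  have "K (s + t) \<eta> = bind (K s \<eta>) (K t)" using process assms by (simp add: ad_process_def)
  then have "T (s + t) f \<eta> = integral\<^sup>L (bind (K s \<eta>) (K t)) f" by (simp add: T_def)
  also have "\<dots> = (\<integral>x. integral\<^sup>L (K t x) f \<partial>K s \<eta>)"
  proof (rule integral_bind[where B=B and B'=1 and K=config_space])
    show "K t \<in> K s \<eta> \<rightarrow>\<^sub>M subprob_algebra config_space"
      using kernel_measurable[OF assms(2)] by (simp add: measurable_cong_sets[OF sets_kernel[OF assms(1)] refl])
    show "AE x in K s \<eta>. emeasure (K t x) (space (K t x)) \<le> ennreal 1"
      using prob_space.emeasure_space_1[OF prob_space_kernel[OF assms(2)]] by simp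
    show "finite_measure (K s \<eta>)" by unfold_locales
  qed (use f in auto)
  finally show ?thesis by (simp add: T_def[abs_def])
qed

lemma T_increment:
  assumes S: "finite S" "depends_on S f" and "0 < \<epsilon>"
  obtains \<delta> where "0 < \<delta>"
    "\<And>h \<eta>. 0 < h \<Longrightarrow> h < \<delta> \<Longrightarrow> \<bar>(T h f \<eta> - f \<eta>) / h - ad_generator p f \<eta>\<bar> < \<epsilon>"
proof -
  have "local_function f" using S by (auto simp: local_function_iff)
  then have "uniform_limit UNIV (\<lambda>t \<eta>. (T t f \<eta> - f \<eta>) / t) (ad_generator p f) (at_right 0)"
    using process by (simp add: ad_process_def T_def)
  from uniform_limitD[OF this \<open>0 < \<epsilon>\<close>] obtain \<delta> where "0 < \<delta>"
    "\<And>h \<eta>. 0 < h \<Longrightarrow> h < \<delta> \<Longrightarrow> \<bar>(T h f \<eta> - f \<eta>) / h - ad_generator p f \<eta>\<bar> < \<epsilon>"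
    by (auto simp: eventually_at_right_field dist_real_def)
  then show ?thesis by (rule that)
qed

text \<open>\<open>T s\<close> contracts the uniform norm, so the uniform limit at time 0 is
  transported to time \<open>s\<close> and gives the right derivative. For the left derivative,
  \<open>T s\<close> and \<open>T (s + h)\<close> applied to the generator of \<open>f\<close> are
  compared; that function is again local, so the defining limit applies to it once more and yields
  an error of order \<open>h\<close>.\<close>

lemma T_deriv:
  assumes S: "finite S" "depends_on S f" and t: "0 \<le> t"
  shows "((\<lambda>t. T t f \<eta>) has_real_derivative T t (ad_generator p f) \<eta>) (at t within {0..})"
  unfolding has_field_derivative_iff LIM_def[abs_def] tendsto_iff eventually_at
proof (intro allI impI)
  fix e :: real assume e: "0 < e"
  let ?L = "ad_generator p f"
  let ?S = "S \<union> children S"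
  have S1: "finite ?S" "depends_on ?S ?L" using S depends_on_ad_generator by auto
  have S2: "finite (?S \<union> children ?S)" "depends_on (?S \<union> children ?S) (ad_generator p ?L)"
    using S1 depends_on_ad_generator[OF S1] by auto
  note fm = measurable_depends_on[OF S] and Lm = measurable_depends_on[OF S1]
  obtain B where B: "\<And>\<omega>. \<bar>f \<omega>\<bar> \<le> B" using bounded_depends_on[OF S] by metis
  obtain B1 where B1: "\<And>\<omega>. \<bar>?L \<omega>\<bar> \<le> B1" using bounded_depends_on[OF S1] by metis
  obtain B2 where B2: "0 \<le> B2" "\<And>\<omega>. \<bar>ad_generator p ?L \<omega>\<bar> \<le> B2" using bounded_depends_on[OF S2] by metis
  obtain d1 where d1: "0 < d1"
    "\<And>h \<eta>. 0 < h \<Longrightarrow> h < d1 \<Longrightarrow> \<bar>(T h f \<eta> - f \<eta>) / h - ?L \<eta>\<bar> < e / 3"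
    using T_increment[OF S, of "e / 3"] e by auto
  obtain d2 where d2: "0 < d2"
    "\<And>h \<eta>. 0 < h \<Longrightarrow> h < d2 \<Longrightarrow> \<bar>(T h ?L \<eta> - ?L \<eta>) / h - ad_generator p ?L \<eta>\<bar> < 1"
    using T_increment[OF S1, of 1] by auto
  \<comment> \<open>The increment of \<open>T h\<close> on \<open>?L\<close> is at most
    \<open>h * (1 + B2)\<close>; the third bound brings this below \<open>e / 3\<close>.\<close>
  define d where "d = min (min d1 d2) (e / (3 * (1 + B2)))"
  have d: "0 < d" using d1 d2 e B2 by (simp add: d_def)
  have Lh: "\<bar>?L \<eta> - T h ?L \<eta>\<bar> \<le> e / 3" if "0 < h" "h < d" for h \<eta>
  proof -
    have "\<bar>(T h ?L \<eta> - ?L \<eta>) / h\<bar> \<le> 1 + B2"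
      using d2(2)[of h \<eta>] B2(2)[of \<eta>] that by (simp add: d_def)
    then have "\<bar>?L \<eta> - T h ?L \<eta>\<bar> \<le> h * (1 + B2)"
      using that by (simp add: abs_div_pos[symmetric] divide_le_eq mult.commute abs_minus_commute)
    also have "\<dots> \<le> e / (3 * (1 + B2)) * (1 + B2)" using that B2 by (intro mult_right_mono) (auto simp: d_def)
    also have "\<dots> = e / 3" using add_pos_nonneg[OF zero_less_one B2(1)] by (simp add: field_simps)
    finally show ?thesis .
  qed
  have main: "\<bar>(T (s + h) f \<eta> - T s f \<eta>) / h - T s ?L \<eta>\<bar> \<le> e / 3" if "0 \<le> s" "0 < h" "h < d" for s h
  proof -
    have hm: "T h f \<in> borel_measurable config_space" "\<And>\<omega>. \<bar>T h f \<omega>\<bar> \<le> B"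
      using T_measurable[OF _ fm B] T_abs_le[OF _ fm B] that by auto
    let ?q = "\<lambda>\<omega>. (T h f \<omega> - f \<omega>)"
    have qb: "\<bar>1 / h * ?q \<omega>\<bar> \<le> B1 + e / 3" for \<omega>
    proof -
      have "\<bar>?q \<omega> / h - ?L \<omega>\<bar> < e / 3" using d1(2)[of h \<omega>] that by (simp add: d_def)
      then have "\<bar>?q \<omega> / h\<bar> \<le> B1 + e / 3" using B1[of \<omega>] by linarith
      then show ?thesis by simp
    qed
    have "T s (\<lambda>\<omega>. 1 / h * ?q \<omega> - ?L \<omega>) \<eta> = T s (\<lambda>\<omega>. 1 / h * ?q \<omega>) \<eta> - T s ?L \<eta>"
      using hm fm by (intro T_diff[OF that(1) _ qb Lm B1]) auto
    also have "T s (\<lambda>\<omega>. 1 / h * ?q \<omega>) \<eta> = 1 / h * (T s (T h f) \<eta> - T s f \<eta>)"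
      unfolding T_cmult by (simp add: T_diff[OF that(1) hm fm B])
    also have "T s (T h f) \<eta> = T (s + h) f \<eta>"
      using that by (intro T_semigroup[symmetric, OF _ _ fm B]) auto
    finally have eq: "(T (s + h) f \<eta> - T s f \<eta>) / h - T s ?L \<eta> = T s (\<lambda>\<omega>. 1 / h * ?q \<omega> - ?L \<omega>) \<eta>" by simp
    show ?thesis unfolding eq
    proof (rule T_abs_le[OF that(1)])
      show "\<bar>1 / h * ?q \<omega> - ?L \<omega>\<bar> \<le> e / 3" for \<omega>
        using d1(2)[of h \<omega>] that by (simp add: d_def)
    qed (use hm fm Lm in auto)
  qed
  show "\<exists>d>0. \<forall>s\<in>{0..}. s \<noteq> t \<and> dist s t < d \<longrightarrow>
      dist ((T s f \<eta> - T t f \<eta>) / (s - t)) (T t ?L \<eta>) < e"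
  proof (intro exI[of _ d] conjI ballI impI d)
    fix s assume s: "s \<in> {0..}" "s \<noteq> t \<and> dist s t < d"
    show "dist ((T s f \<eta> - T t f \<eta>) / (s - t)) (T t ?L \<eta>) < e"
    proof (cases "t < s")
      case True
      then show ?thesis using main[of t "s - t"] s t e by (simp add: dist_real_def)
    next
      case False
      define h where "h = t - s"
      have h: "0 < h" "h < d" "t = s + h" using False s by (auto simp: h_def dist_real_def)
      have s0: "0 \<le> s" using s by simp
      have hm: "T h ?L \<in> borel_measurable config_space" "\<And>\<omega>. \<bar>T h ?L \<omega>\<bar> \<le> B1"
        using T_measurable[OF _ Lm B1] T_abs_le[OF _ Lm B1] h by auto
      have "\<bar>T s ?L \<eta> - T t ?L \<eta>\<bar> \<le> e / 3"
      proof -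
        have "T s ?L \<eta> - T t ?L \<eta> = T s (\<lambda>\<omega>. ?L \<omega> - T h ?L \<omega>) \<eta>"
          using h T_diff[OF s0 Lm B1 hm] T_semigroup[OF s0 _ Lm B1, of h] by simp
        also have "\<bar>\<dots>\<bar> \<le> e / 3" using hm Lm Lh h by (intro T_abs_le[OF s0]) auto
        finally show ?thesis .
      qed
      moreover have "(T s f \<eta> - T t f \<eta>) / (s - t) = (T (s + h) f \<eta> - T s f \<eta>) / h"
        using h by (simp add: field_simps)
      ultimately show ?thesis using main[OF s0 h(1,2)] e unfolding dist_real_def by linarith
    qed
  qed
qed

lemma T_deriv_at:
  assumes S: "finite S" "depends_on S f" and t: "0 < t"
  shows "((\<lambda>t. T t f \<eta>) has_real_derivative T t (ad_generator p f) \<eta>) (at t)"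
proof -
  have "at t within {0..} = at t" using t by (intro at_within_interior) simp
  then show ?thesis using T_deriv[OF S, of t \<eta>] t by simp
qed

lemma T_continuous:
  assumes S: "finite S" "depends_on S f"
  shows "continuous_on {0..} (\<lambda>t. T t f \<eta>)"
  using T_deriv[OF S] by (intro DERIV_continuous_on) auto

text \<open>Duhamel's formula for \<open>s \<mapsto> T (t - s) (partial_flow \<Lambda> f s)\<close>.\<close>

lemma T_minus_partial_flow:
  fixes S \<Lambda> :: "vertex set"
  assumes S: "finite S" "depends_on S f" "\<Lambda> \<union> children \<Lambda> \<subseteq> S" and t: "0 \<le> t"
    and e: "\<And>s \<omega>. 0 \<le> s \<Longrightarrow> s \<le> t \<Longrightarrow>
      \<bar>partial_generator \<Lambda> (partial_flow \<Lambda> f s) \<omega> - ad_generator p (partial_flow \<Lambda> f s) \<omega>\<bar> \<le> e"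
  shows "\<bar>partial_flow \<Lambda> f t \<eta> - T t f \<eta>\<bar> \<le> t * e"
proof (cases "t = 0")
  case True
  then show ?thesis using T_0 measurable_depends_on[OF S(1,2)] by simp
next
  case False
  define g where "g = partial_flow \<Lambda> f"
  define X where "X B = (\<lambda>x. x \<in> B)" for B :: "vertex set"
  have gS: "depends_on S (g s)" for s unfolding g_def by (rule depends_on_partial_flow[OF S(2,3)])
  have LgS: "depends_on (S \<union> children S) (ad_generator p (g s))" for s by (rule depends_on_ad_generator[OF S(1) gS])
  have cS: "depends_on S (cylinder S B)" for B by (rule depends_on_cylinder)
  have expand: "T r h \<eta> = (\<Sum>B\<in>Pow S. h (X B) * T r (cylinder S B) \<eta>)" if "0 \<le> r" "depends_on S h" for r h
  proof -
    have "T r h \<eta> = T r (\<lambda>\<omega>. \<Sum>B\<in>Pow S. h (X B) * cylinder S B \<omega>) \<eta>"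
      unfolding X_def by (rule arg_cong[where f="\<lambda>h. T r h \<eta>"]) (rule ext, rule cylinder_expansion[OF S(1) that(2)])
    also have "\<dots> = (\<Sum>B\<in>Pow S. h (X B) * T r (cylinder S B) \<eta>)"
      by (subst T_sum[where S=S]) (auto simp: that S T_cmult intro: depends_on_map cS)
    finally show ?thesis .
  qed
  have Lexpand: "T r (ad_generator p h) \<eta> = (\<Sum>B\<in>Pow S. h (X B) * T r (ad_generator p (cylinder S B)) \<eta>)"
    if "0 \<le> r" "depends_on S h" for r h
  proof -
    have "ad_generator p h = (\<lambda>\<omega>. \<Sum>B\<in>Pow S. h (X B) * ad_generator p (cylinder S B) \<omega>)"
    proof
      fix \<omega>
      have h: "h \<omega> = (\<Sum>B\<in>Pow S. h (X B) * cylinder S B \<omega>)" for \<omega>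
        unfolding X_def by (rule cylinder_expansion[OF S(1) that(2)])
      have av: "site_average p x h \<omega> - h \<omega> = (\<Sum>B\<in>Pow S. h (X B) * (site_average p x (cylinder S B) \<omega> - cylinder S B \<omega>))" for x
        unfolding site_average_eq h[of \<omega>] h[of "fun_upd \<omega> x True"] h[of "fun_upd \<omega> x False"]
        by (simp add: sum_distrib_left sum.distrib[symmetric] sum_subtractf[symmetric] algebra_simps)
      show "ad_generator p h \<omega> = (\<Sum>B\<in>Pow S. h (X B) * ad_generator p (cylinder S B) \<omega>)"
        unfolding ad_generator_eq_sum[OF S(1) that(2)] ad_generator_eq_sum[OF S(1) cS] av sum_distrib_left
        by (subst sum.swap) (simp add: mult.left_commute)
    qed
    then have "T r (ad_generator p h) \<eta> = T r (\<lambda>\<omega>. \<Sum>B\<in>Pow S. h (X B) * ad_generator p (cylinder S B) \<omega>) \<eta>" by simp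
    also have "\<dots> = (\<Sum>B\<in>Pow S. h (X B) * T r (ad_generator p (cylinder S B)) \<eta>)"
      by (subst T_sum[where S="S \<union> children S"])
         (auto simp: that S T_cmult intro: depends_on_map depends_on_ad_generator[OF S(1) cS])
    finally show ?thesis .
  qed
  \<comment> \<open>Both factors move with \<open>s\<close>; in cylinder coordinates the expression
    is a finite sum of products of real functions, to which the ordinary product rule
    applies.\<close>
  define F where "F s = (\<Sum>B\<in>Pow S. g s (X B) * T (t - s) (cylinder S B) \<eta>)" for s
  define F' where "F' s = (\<Sum>B\<in>Pow S. partial_generator \<Lambda> (g s) (X B) * T (t - s) (cylinder S B) \<eta> -
     g s (X B) * T (t - s) (ad_generator p (cylinder S B)) \<eta>)" for s
  have dT: "((\<lambda>s. T (t - s) (cylinder S B) \<eta>) has_real_derivative - T (t - s) (ad_generator p (cylinder S B)) \<eta>) (at s)"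
    if "0 < s" "s < t" for s B
  proof -
    have "((\<lambda>s. t - s) has_real_derivative - 1) (at s)" by (auto intro!: derivative_eq_intros)
    from DERIV_chain2[where f="\<lambda>t. T t (cylinder S B) \<eta>", OF T_deriv_at[OF S(1) cS] this] that
    show ?thesis by simp
  qed
  have dF: "(F has_real_derivative F' s) (at s)" if "0 < s" "s < t" for s
    unfolding F_def F'_def g_def
    by (auto intro!: derivative_eq_intros partial_flow_deriv[OF S(1,2)] dT that simp: algebra_simps)
  have cT: "continuous_on {0..t} (\<lambda>s. T (t - s) (cylinder S B) \<eta>)" for B
    by (rule continuous_on_compose2[OF T_continuous[OF S(1) cS]]) (auto intro!: continuous_intros)
  have cg: "continuous_on {0..t} (\<lambda>s. g s \<omega>)" for \<omega>
    unfolding g_def by (intro continuous_at_imp_continuous_on ballI DERIV_isCont[OF partial_flow_deriv[OF S(1,2)]])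
  have "continuous_on {0..t} F" unfolding F_def by (intro continuous_intros cT cg)
  \<comment> \<open>The mean value theorem asks for derivatives at interior times only, where
    \<open>T\<close> is differentiable from both sides.\<close>
  then obtain l z where z: "0 < z" "z < t" "(F has_real_derivative l) (at z)" "F t - F 0 = (t - 0) * l"
    using MVT[of 0 t F] dF t False by (auto simp: real_differentiable_def)
  have "l = F' z" using z dF DERIV_unique by blast
  also have "F' z = T (t - z) (partial_generator \<Lambda> (g z)) \<eta> - T (t - z) (ad_generator p (g z)) \<eta>"
    using z by (simp add: F'_def sum_subtractf expand Lexpand gS depends_on_partial_generator[OF gS S(3)])
  also have "\<dots> = T (t - z) (\<lambda>\<omega>. partial_generator \<Lambda> (g z) \<omega> - ad_generator p (g z) \<omega>) \<eta>"
  proof -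
    obtain B1 where "\<And>\<omega>. \<bar>partial_generator \<Lambda> (g z) \<omega>\<bar> \<le> B1"
      using bounded_depends_on[OF S(1) depends_on_partial_generator[OF gS S(3)]] by metis
    moreover obtain B2 where "\<And>\<omega>. \<bar>ad_generator p (g z) \<omega>\<bar> \<le> B2"
      using bounded_depends_on[OF _ LgS] S(1) by (metis finite_Un finite_children)
    ultimately show ?thesis using z measurable_depends_on[OF _ LgS] S(1)
      by (intro T_diff[symmetric] measurable_depends_on[OF S(1) depends_on_partial_generator[OF gS S(3)]]) auto
  qed
  finally have l: "l = \<dots>" .
  have "\<bar>l\<bar> \<le> e" unfolding l
  proof (rule T_abs_le)
    show "(\<lambda>\<omega>. partial_generator \<Lambda> (g z) \<omega> - ad_generator p (g z) \<omega>) \<in> borel_measurable config_space"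
      using measurable_depends_on[OF _ LgS] S(1)
      by (intro borel_measurable_diff measurable_depends_on[OF S(1) depends_on_partial_generator[OF gS S(3)]]) auto
  qed (use z e in \<open>auto simp: g_def\<close>)
  then have "\<bar>F t - F 0\<bar> \<le> t * e" using z t by (simp add: abs_mult mult_left_mono)
  moreover have "F 0 = T t f \<eta>" using expand[OF t S(2)] by (simp add: F_def g_def)
  moreover have "F t = partial_flow \<Lambda> f t \<eta>"
    using expand[of 0 "g t"] gS T_0[OF measurable_depends_on[OF S(1) gS]] by (simp add: F_def g_def)
  ultimately show ?thesis by simp
qed

text \<open>On functions of the ball of radius \<open>N\<close> the two generators differ by the
  updates of generation \<open>N\<close> alone. Each is at most a gradient of order
  \<open>(1 / 4) ^ N\<close> and there are \<open>2 ^ N\<close> of them, so Duhamel's formula leaves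
  an error of order \<open>(1 / 2) ^ N\<close>.\<close>

lemma partial_flow_tendsto_T:
  assumes f: "depends_on {x. length x < n} f" and t: "0 \<le> t"
  shows "(\<lambda>N. partial_flow {x. length x < N} f t \<eta>) \<longlonglongrightarrow> T t f \<eta>"
proof -
  obtain B where B: "\<And>\<omega>. \<bar>f \<omega>\<bar> \<le> B" using bounded_depends_on[OF _ f] by auto
  define C where "C = t * (exp (4 * t) * (4 ^ n * (2 * B)))"
  have bound: "\<bar>partial_flow {x. length x < N} f t \<eta> - T t f \<eta>\<bar> \<le> C * (1 / 2) ^ N" if "n \<le> N" for N
  proof -
    let ?\<Lambda> = "{x :: vertex. length x < N}" and ?S = "{x :: vertex. length x \<le> N}"
    have S: "finite ?S" "depends_on ?S f" "?\<Lambda> \<union> children ?\<Lambda> \<subseteq> ?S"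
      using that by (auto simp: children_def intro: depends_on_mono[OF f])
    have "\<bar>partial_flow ?\<Lambda> f t \<eta> - T t f \<eta>\<bar> \<le> t * (exp (4 * t) * (4 ^ n * (2 * B)) * (1 / 2) ^ N)"
    proof (rule T_minus_partial_flow[OF S t])
      fix s \<omega> assume s: "0 \<le> s" "s \<le> t"
      let ?g = "partial_flow ?\<Lambda> f s"
      have eq: "ad_generator p ?g \<omega> - partial_generator ?\<Lambda> ?g \<omega> =
          (\<Sum>x\<in>{x::vertex. length x = N}. ad_rate x \<omega> * (site_average p x ?g \<omega> - ?g \<omega>))"
      proof -
        have "?S = ?\<Lambda> \<union> {x. length x = N}" "?\<Lambda> \<inter> {x. length x = N} = {}" by auto
        then show ?thesis
          unfolding ad_generator_eq_sum[OF S(1) depends_on_partial_flow[OF S(2,3)]] partial_generator_def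
          by (simp add: sum.union_disjoint)
      qed
      have "\<bar>ad_generator p ?g \<omega> - partial_generator ?\<Lambda> ?g \<omega>\<bar>
          \<le> (\<Sum>x\<in>{x::vertex. length x = N}. \<bar>ad_rate x \<omega> * (site_average p x ?g \<omega> - ?g \<omega>)\<bar>)"
        unfolding eq by (rule sum_abs)
      also have "\<dots> \<le> (\<Sum>x\<in>{x::vertex. length x = N}. exp (4 * t) * (4 ^ n * (2 * B)) * (1 / 4) ^ N)"
      proof (rule sum_mono)
        fix x :: vertex assume x: "x \<in> {x. length x = N}"
        have "\<bar>ad_rate x \<omega> * (site_average p x ?g \<omega> - ?g \<omega>)\<bar> \<le> \<bar>site_average p x ?g \<omega> - ?g \<omega>\<bar>"
          by (simp add: abs_mult mult_left_le_one_le)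
        also have "\<dots> \<le> \<bar>?g (fun_upd \<omega> x True) - ?g (fun_upd \<omega> x False)\<bar>" by (rule site_average_diff_abs_le)
        also have "\<dots> \<le> exp (4 * s) * (4 ^ n * (2 * B)) * (1 / 4) ^ N"
          using partial_flow_gradient[OF S f B s(1), of x \<omega>] x by (simp add: field_simps)
        also have "\<dots> \<le> exp (4 * t) * (4 ^ n * (2 * B)) * (1 / 4) ^ N"
          using s B[of \<omega>] by (intro mult_right_mono) auto
        finally show "\<bar>ad_rate x \<omega> * (site_average p x ?g \<omega> - ?g \<omega>)\<bar> \<le> \<dots>" .
      qed
      also have "\<dots> = exp (4 * t) * (4 ^ n * (2 * B)) * (1 / 2) ^ N"
        by (simp add: card_generation power_divide field_simps flip: power_mult_distrib)
      finally show "\<bar>partial_generator ?\<Lambda> ?g \<omega> - ad_generator p ?g \<omega>\<bar> \<le> exp (4 * t) * (4 ^ n * (2 * B)) * (1 / 2) ^ N"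
        by (simp add: abs_minus_commute)
    qed
    then show ?thesis by (simp add: C_def mult.assoc)
  qed
  have lim: "(\<lambda>N. C * (1 / 2) ^ N) \<longlonglongrightarrow> 0" by (intro tendsto_mult_right_zero LIMSEQ_power_zero) simp
  have "\<forall>\<^sub>F N in sequentially. norm (partial_flow {x. length x < N} f t \<eta> - T t f \<eta>) \<le> C * (1 / 2) ^ N"
    by (rule eventually_sequentiallyI[of n]) (simp only: real_norm_def bound)
  from Lim_null_comparison[OF this lim] have "(\<lambda>N. partial_flow {x. length x < N} f t \<eta> - T t f \<eta>) \<longlonglongrightarrow> 0" .
  then show ?thesis by (simp add: LIM_zero_iff)
qed

end

section \<open>Relaxation from an enclosure\<close>

text \<open>Closed under parents, so that a site outside \<open>A\<close> has both children outside:
  exterior rates do not read the block.\<close>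

definition prefix_closed :: "vertex set \<Rightarrow> bool" where
  "prefix_closed A \<longleftrightarrow> (\<forall>x b. x @ [b] \<in> A \<longrightarrow> x \<in> A)"

text \<open>The condition concerns \<zeta> only at children of \<open>A\<close> lying outside
  \<open>A\<close>, so it is unaffected when the inside of the block is overwritten.\<close>

definition vacant_boundary :: "vertex set \<Rightarrow> config \<Rightarrow> bool" where
  "vacant_boundary A \<zeta> \<longleftrightarrow> (\<forall>x\<in>A. \<forall>b. x @ [b] \<in> A \<or> \<not> \<zeta> (x @ [b]))"

section \<open>The Dirichlet form, the spectral gap and averages over blocks\<close>

context bernoulli_parameter begin

text \<open>Averaging over \<open>x\<close> with \<open>r\<close> unaffected turns \<open>h\<close>
  times its centred average into minus the variance of \<open>h\<close> in that coordinate, and a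
  two-valued variable has variance \<open>p * (1 - p)\<close> times the squared gradient.\<close>

lemma integral_dirichlet_term:
  assumes S: "finite S" "depends_on S r" "depends_on S h" and r: "\<And>\<eta> b. r (\<eta>(x := b)) = r \<eta>"
  shows "(\<integral>\<eta>. r \<eta> * (h \<eta> * (site_average p x h \<eta> - h \<eta>)) \<partial>\<mu>) =
    - (\<integral>\<eta>. r \<eta> * (p * (1 - p) * (h (\<eta>(x := True)) - h (\<eta>(x := False)))\<^sup>2) \<partial>\<mu>)"
proof -
  let ?F = "\<lambda>\<eta>. r \<eta> * (h \<eta> * (site_average p x h \<eta> - h \<eta>))"
  have "depends_on S ?F"
    using S depends_on_site_average by (intro depends_on_map2[where h="(*)"] depends_on_map2[where h="(-)"])
  then have "(\<integral>\<eta>. ?F \<eta> \<partial>\<mu>) = (\<integral>\<eta>. site_average p x ?F \<eta> \<partial>\<mu>)"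
    using S by (simp add: integral_site_average)
  also have "site_average p x ?F = (\<lambda>\<eta>. - (r \<eta> * (p * (1 - p) * (h (\<eta>(x := True)) - h (\<eta>(x := False)))\<^sup>2)))"
    by (simp add: fun_eq_iff site_average_eq r power2_eq_square algebra_simps)
  finally show ?thesis by simp
qed

lemma integral_mult_site_average_diff:
  assumes S: "finite S" "depends_on S r" "depends_on S h" and r: "\<And>\<eta> b. r (\<eta>(x := b)) = r \<eta>"
  shows "(\<integral>\<eta>. r \<eta> * (site_average p x h \<eta> - h \<eta>) \<partial>\<mu>) = 0"
proof -
  let ?F = "\<lambda>\<eta>. r \<eta> * (site_average p x h \<eta> - h \<eta>)"
  have "depends_on S ?F"
    using S depends_on_site_average by (intro depends_on_map2[where h="(*)"] depends_on_map2[where h="(-)"])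
  then have "(\<integral>\<eta>. ?F \<eta> \<partial>\<mu>) = (\<integral>\<eta>. site_average p x ?F \<eta> \<partial>\<mu>)"
    using S by (simp add: integral_site_average)
  also have "site_average p x ?F = (\<lambda>\<eta>. 0)"
    by (simp add: fun_eq_iff site_average_eq r algebra_simps)
  finally show ?thesis by simp
qed

text \<open>As a sum of squared gradients weighted by the rates, the form is monotone in the rates;
  this lets a vacant boundary be compared with the infinite tree.\<close>

lemma dirichlet_form:
  assumes S: "finite S" "depends_on S h"
  shows "(\<integral>\<eta>. h \<eta> * (- ad_generator p h \<eta>) \<partial>\<mu>) =
    (\<Sum>x\<in>S. \<integral>\<eta>. ad_rate x \<eta> * (p * (1 - p) * (h (\<eta>(x := True)) - h (\<eta>(x := False)))\<^sup>2) \<partial>\<mu>)"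
proof -
  let ?S = "S \<union> children S"
  have h: "finite ?S" "depends_on ?S h" using S by (auto intro: depends_on_mono)
  have r: "depends_on ?S (ad_rate x)" if "x \<in> S" for x
    using that by (intro depends_on_ad_rate) (auto simp: children_def)
  have "h \<eta> * (- ad_generator p h \<eta>) =
      (\<Sum>x\<in>S. - (ad_rate x \<eta> * (h \<eta> * (site_average p x h \<eta> - h \<eta>))))" for \<eta>
    by (simp add: ad_generator_eq_sum[OF S] sum_distrib_left sum_negf mult.left_commute)
  then have "(\<integral>\<eta>. h \<eta> * (- ad_generator p h \<eta>) \<partial>\<mu>) =
      (\<integral>\<eta>. (\<Sum>x\<in>S. - (ad_rate x \<eta> * (h \<eta> * (site_average p x h \<eta> - h \<eta>)))) \<partial>\<mu>)" by simp
  also have "\<dots> = (\<Sum>x\<in>S. \<integral>\<eta>. - (ad_rate x \<eta> * (h \<eta> * (site_average p x h \<eta> - h \<eta>))) \<partial>\<mu>)"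
    by (intro Bochner_Integration.integral_sum integrable_depends_on[OF h(1)] depends_on_map[where h=uminus]
        depends_on_map2[where h="(*)"] depends_on_map2[where h="(-)"] depends_on_site_average r h)
  also have "\<dots> = (\<Sum>x\<in>S. \<integral>\<eta>. ad_rate x \<eta> * (p * (1 - p) * (h (\<eta>(x := True)) - h (\<eta>(x := False)))\<^sup>2) \<partial>\<mu>)"
    by (intro sum.cong refl) (simp add: integral_dirichlet_term[OF h(1) r h(2)])
  finally show ?thesis .
qed

lemma square_integrable_local: "finite S \<Longrightarrow> depends_on S f \<Longrightarrow> square_integrable \<mu> f"
  unfolding square_integrable_def measurable_cong_sets[OF sets_bernoulli_product refl]
  by (intro conjI measurable_depends_on integrable_depends_on[OF _ depends_on_map[where h="\<lambda>r. r\<^sup>2"]])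

lemma local_in_ad_L2_generator:
  assumes S: "finite S" "depends_on S f"
  shows "(f, ad_generator p f) \<in> ad_L2_generator p"
proof -
  have "local_function f" using S by (auto simp: local_function_iff)
  then show ?thesis
    using square_integrable_local[OF S] square_integrable_local[OF _ depends_on_ad_generator[OF S]] S(1)
    by (auto simp: ad_L2_generator_def intro!: exI[of _ "\<lambda>_. f"])
qed

text \<open>The gap takes extended real values, so a positive real \<gamma> strictly below it is
  fixed. Functions of variance zero lie outside the infimum and are covered by nonnegativity of the
  form.\<close>

lemma spectral_gap_inequality:
  assumes "ad_gap p > 0"
  obtains \<gamma> where "0 < \<gamma>" "\<And>S h. finite S \<Longrightarrow> depends_on S h \<Longrightarrow>
    \<gamma> * (\<integral>\<eta>. (h \<eta> - (\<integral>\<omega>. h \<omega> \<partial>\<mu>))\<^sup>2 \<partial>\<mu>) \<le> (\<integral>\<eta>. h \<eta> * (- ad_generator p h \<eta>) \<partial>\<mu>)"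
proof -
  obtain \<gamma> where \<gamma>: "0 < ereal \<gamma>" "ereal \<gamma> < ad_gap p" using ereal_dense2[OF assms] by metis
  have "\<gamma> * (\<integral>\<eta>. (h \<eta> - (\<integral>\<omega>. h \<omega> \<partial>\<mu>))\<^sup>2 \<partial>\<mu>) \<le> (\<integral>\<eta>. h \<eta> * (- ad_generator p h \<eta>) \<partial>\<mu>)"
    if S: "finite S" "depends_on S h" for S h
  proof (cases "(\<integral>\<eta>. (h \<eta> - (\<integral>\<omega>. h \<omega> \<partial>\<mu>))\<^sup>2 \<partial>\<mu>) > 0")
    case True
    then have "ad_gap p \<le> ereal ((\<integral>\<eta>. h \<eta> * (- ad_generator p h \<eta>) \<partial>\<mu>) / (\<integral>\<eta>. (h \<eta> - (\<integral>\<omega>. h \<omega> \<partial>\<mu>))\<^sup>2 \<partial>\<mu>))"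
      unfolding ad_gap_def using local_in_ad_L2_generator[OF S] by (intro INF_lower2[of "(h, ad_generator p h)"]) auto
    with \<gamma>(2) have "\<gamma> \<le> (\<integral>\<eta>. h \<eta> * (- ad_generator p h \<eta>) \<partial>\<mu>) / (\<integral>\<eta>. (h \<eta> - (\<integral>\<omega>. h \<omega> \<partial>\<mu>))\<^sup>2 \<partial>\<mu>)"
      using less_le_trans by fastforce
    then show ?thesis unfolding pos_le_divide_eq[OF True] .
  next
    case False
    moreover have "0 \<le> (\<integral>\<eta>. h \<eta> * (- ad_generator p h \<eta>) \<partial>\<mu>)"
      unfolding dirichlet_form[OF S] using p_nonneg p_le_1
      by (intro sum_nonneg integral_nonneg_AE AE_I2 mult_nonneg_nonneg) auto
    ultimately show ?thesis using \<gamma>(1) by (smt (verit, ccfv_SIG) mult_nonneg_nonpos ereal_less(2))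
  qed
  with \<gamma>(1) show ?thesis by (intro that[of \<gamma>]) auto
qed

text \<open>A version of the conditional expectation given the exterior of \<open>A\<close> that is
  defined at every \<zeta> and not merely up to null sets, so that it can be maximised over
  exteriors.\<close>

definition block_integral :: "vertex set \<Rightarrow> (config \<Rightarrow> real) \<Rightarrow> config \<Rightarrow> real" where
  "block_integral A F \<zeta> = (\<integral>\<sigma>. F (override_on \<zeta> \<sigma> A) \<partial>\<mu>)"

lemma depends_on_override_on': "depends_on S F \<Longrightarrow> depends_on S (\<lambda>\<sigma>. F (override_on \<zeta> \<sigma> A))"
  by (rule depends_on_mono[OF depends_on_override_on]) auto

text \<open>By invariance under resampling, a site that has just been updated is in equilibrium and
  can be counted as part of the block.\<close>

lemma block_integral_insert:
  assumes "finite S" "depends_on S F" "x \<notin> A"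
  shows "block_integral (insert x A) F \<zeta> = block_integral A (site_average p x F) \<zeta>"
proof -
  have upd: "override_on \<zeta> (\<sigma>(x := b)) (insert x A) = (override_on \<zeta> \<sigma> A)(x := b)" for \<sigma> b
    by (auto simp: override_on_def fun_eq_iff)
  have "block_integral (insert x A) F \<zeta> = (\<integral>\<sigma>. site_average p x (\<lambda>\<sigma>. F (override_on \<zeta> \<sigma> (insert x A))) \<sigma> \<partial>\<mu>)"
    unfolding block_integral_def using integral_site_average[OF assms(1) depends_on_override_on'[OF assms(2)]] by simp
  also have "\<dots> = block_integral A (site_average p x F) \<zeta>"
    by (simp add: block_integral_def site_average_eq upd)
  finally show ?thesis .
qed

lemma block_integral_site_average:
  assumes "finite S" "depends_on S F" "x \<notin> A"
  shows "block_integral A (site_average p x F) \<zeta> =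
    p * block_integral A F (\<zeta>(x := True)) + (1 - p) * block_integral A F (\<zeta>(x := False))"
proof -
  have upd: "(override_on \<zeta> \<sigma> A)(x := b) = override_on (\<zeta>(x := b)) \<sigma> A" for \<sigma> b
    using assms(3) by (auto simp: override_on_def fun_eq_iff)
  have "integrable \<mu> (\<lambda>\<sigma>. F (override_on \<zeta> \<sigma> A))" for \<zeta>
    by (rule integrable_depends_on[OF assms(1) depends_on_override_on'[OF assms(2)]])
  then show ?thesis by (simp add: block_integral_def site_average_eq upd)
qed

lemma ad_rate_override_on_outside:
  assumes "prefix_closed A" "x \<notin> A"
  shows "ad_rate x (override_on \<zeta> \<sigma> A) = ad_rate x \<zeta>"
proof -
  have "x @ [b] \<notin> A" for b using assms by (auto simp: prefix_closed_def)
  then show ?thesis by (simp add: ad_rate_def override_on_def)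
qed

text \<open>Children inside the block are read from \<sigma> by both rates; a child outside is
  vacant in the overridden configuration, which can only raise its rate.\<close>

lemma ad_rate_override_on_mono:
  assumes "vacant_boundary A \<zeta>" "x \<in> A"
  shows "ad_rate x \<sigma> \<le> ad_rate x (override_on \<zeta> \<sigma> A)"
  using assms by (auto simp: ad_rate_def override_on_def vacant_boundary_def)

text \<open>The lower bound \<open>A\<^sub>0\<close> makes all block integrals of the initial
  function agree at time 0, \<open>A \<subseteq> \<Lambda>\<close> reflects that frozen sites are
  never absorbed, and \<open>supported S\<close> makes the family finite.\<close>

definition enclosures :: "vertex set \<Rightarrow> vertex set \<Rightarrow> vertex set \<Rightarrow> (vertex set \<times> config) set" where
  "enclosures S \<Lambda> A\<^sub>0 = {(A, \<zeta>). A\<^sub>0 \<subseteq> A \<and> A \<subseteq> \<Lambda> \<and> prefix_closed A \<and> \<zeta> \<in> supported S \<and> vacant_boundary A \<zeta>}"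

lemma finite_enclosures: "finite S \<Longrightarrow> finite \<Lambda> \<Longrightarrow> finite (enclosures S \<Lambda> A\<^sub>0)"
  by (rule finite_subset[of _ "Pow \<Lambda> \<times> supported S"]) (auto simp: enclosures_def)

text \<open>A legal update on the boundary of a block finds the two children vacant, so the updated site
  can be absorbed into the block and its vacant boundary moves on to these children.\<close>

lemma outer_update_nonpos:
  assumes S: "finite S" "depends_on S F" "\<Lambda> \<subseteq> S" and x: "x \<in> \<Lambda>" "x \<notin> A"
    and I: "(A, \<zeta>) \<in> enclosures S \<Lambda> A\<^sub>0"
    and mx: "\<And>A' \<zeta>'. (A', \<zeta>') \<in> enclosures S \<Lambda> A\<^sub>0 \<Longrightarrow> block_integral A' F \<zeta>' \<le> block_integral A F \<zeta>"
  shows "ad_rate x \<zeta> * (block_integral A (site_average p x F) \<zeta> - block_integral A F \<zeta>) \<le> 0"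
proof (cases "ad_rate x \<zeta> = 0")
  case False
  then have ch: "\<not> \<zeta> (x @ [b])" for b by (cases b) (auto simp: ad_rate_def split: if_splits)
  have "block_integral A (site_average p x F) \<zeta> \<le> block_integral A F \<zeta>"
  proof (cases "\<exists>y\<in>A. \<exists>b. x = y @ [b]")
    case True
    then have "(insert x A, \<zeta>) \<in> enclosures S \<Lambda> A\<^sub>0"
      using I x ch by (auto simp: enclosures_def prefix_closed_def vacant_boundary_def)
    from mx[OF this] show ?thesis by (simp add: block_integral_insert[OF S(1,2) x(2)])
  next
    case False
    \<comment> \<open>Here \<open>x\<close> is not a child of a site of \<open>A\<close>, so it is
      not a boundary site and changing it leaves the boundary vacant.\<close>
    then have "(A, \<zeta>(x := b)) \<in> enclosures S \<Lambda> A\<^sub>0" for b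
      using I x S(3) by (auto simp: enclosures_def vacant_boundary_def supported_iff)
    from mx[OF this]
    have "p * block_integral A F (\<zeta>(x := True)) + (1 - p) * block_integral A F (\<zeta>(x := False))
        \<le> p * block_integral A F \<zeta> + (1 - p) * block_integral A F \<zeta>"
      using p_nonneg p_le_1 by (intro add_mono mult_left_mono) auto
    then show ?thesis by (simp add: block_integral_site_average[OF S(1,2) x(2)] algebra_simps)
  qed
  then show ?thesis by (simp add: mult_nonneg_nonpos)
qed simp

text \<open>The maximum principle with growth rate 0: inner updates integrate to zero, outer ones
  are nonpositive at a maximising pair, and every block contains the sites on which
  \<open>G 0\<close> depends. \<open>G\<close> is abstract so that both the flow and its negative
  are covered.\<close>

lemma block_integral_le_initial:
  assumes S: "finite S" "\<Lambda> \<union> children \<Lambda> \<subseteq> S" "\<And>t. depends_on S (G t)"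
    and deriv: "\<And>t \<eta>. ((\<lambda>t. G t \<eta>) has_real_derivative partial_generator \<Lambda> (G t) \<eta>) (at t)"
    and A\<^sub>0: "depends_on A\<^sub>0 (G 0)"
    and I: "(A, \<zeta>) \<in> enclosures S \<Lambda> A\<^sub>0" and t: "0 \<le> t"
  shows "block_integral A (G t) \<zeta> \<le> (\<integral>\<eta>. G 0 \<eta> \<partial>\<mu>)"
proof -
  define v where "v = (\<lambda>(A, \<zeta>) t. block_integral A (G t) \<zeta>)"
  define v' where "v' = (\<lambda>(A, \<zeta>) t. block_integral A (partial_generator \<Lambda> (G t)) \<zeta>)"
  have pgS: "depends_on S (partial_generator \<Lambda> (G t))" for t by (rule depends_on_partial_generator[OF S(3,2)])
  have fin: "finite \<Lambda>" using S(1,2) finite_subset by blast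
  have "v (A, \<zeta>) t \<le> exp (0 * t) * (\<integral>\<eta>. G 0 \<eta> \<partial>\<mu>)"
  proof (rule finite_maximum_principle[where v'=v', OF finite_enclosures[OF S(1) fin] _ _ _ I t])
    show "(v i has_real_derivative v' i t) (at t)" for i t
      unfolding v_def v'_def block_integral_def
      by (cases i, simp) (intro has_derivative_integral[OF S(1)] depends_on_override_on' S(3) pgS deriv)
    show "v i 0 \<le> (\<integral>\<eta>. G 0 \<eta> \<partial>\<mu>)" if "i \<in> enclosures S \<Lambda> A\<^sub>0" for i
    proof -
      obtain A \<zeta> where i: "i = (A, \<zeta>)" "A\<^sub>0 \<subseteq> A" using \<open>i \<in> enclosures S \<Lambda> A\<^sub>0\<close> by (cases i) (auto simp: enclosures_def)
      then have "G 0 (override_on \<zeta> \<sigma> A) = G 0 \<sigma>" for \<sigma>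
        by (intro depends_onD[OF A\<^sub>0]) (auto simp: override_on_def)
      then show ?thesis by (simp add: i v_def block_integral_def)
    qed
    show "v' i t \<le> 0 * v i t" if "i \<in> enclosures S \<Lambda> A\<^sub>0" and mx: "\<And>j. j \<in> enclosures S \<Lambda> A\<^sub>0 \<Longrightarrow> v j t \<le> v i t" for i t
    proof -
      obtain A \<zeta> where i: "i = (A, \<zeta>)" "(A, \<zeta>) \<in> enclosures S \<Lambda> A\<^sub>0" using \<open>i \<in> enclosures S \<Lambda> A\<^sub>0\<close> by (cases i) auto
      then have A: "prefix_closed A" by (auto simp: enclosures_def)
      have mx': "block_integral A' (G t) \<zeta>' \<le> block_integral A (G t) \<zeta>" if "(A', \<zeta>') \<in> enclosures S \<Lambda> A\<^sub>0" for A' \<zeta>'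
        using mx[OF that] by (simp add: i v_def)
      let ?F = "\<lambda>x \<eta>. ad_rate x \<eta> * (site_average p x (G t) \<eta> - G t \<eta>)"
      have FS: "depends_on S (?F x)" "depends_on S (ad_rate x)" if "x \<in> \<Lambda>" for x
      proof -
        show "depends_on S (ad_rate x)"
          using that S(2) by (intro depends_on_ad_rate) (auto simp: children_def)
        then show "depends_on S (?F x)"
          by (intro depends_on_map2[where h="(*)"] depends_on_map2[where h="(-)"] depends_on_site_average S)
      qed
      have "block_integral A (partial_generator \<Lambda> (G t)) \<zeta> = (\<Sum>x\<in>\<Lambda>. block_integral A (?F x) \<zeta>)"
        unfolding block_integral_def partial_generator_def
        by (intro Bochner_Integration.integral_sum integrable_depends_on[OF S(1)] depends_on_override_on'[OF FS(1)])
      also have "\<dots> \<le> (\<Sum>x\<in>\<Lambda>. 0)"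
      proof (rule sum_mono)
        fix x assume x: "x \<in> \<Lambda>"
        show "block_integral A (?F x) \<zeta> \<le> 0"
        proof (cases "x \<in> A")
          case True
          have upd: "(override_on \<zeta> \<sigma> A)(x := b) = override_on \<zeta> (\<sigma>(x := b)) A" for \<sigma> b
            using True by (auto simp: override_on_def fun_eq_iff)
          have "block_integral A (?F x) \<zeta> = (\<integral>\<sigma>. ad_rate x (override_on \<zeta> \<sigma> A) *
              (site_average p x (\<lambda>\<sigma>. G t (override_on \<zeta> \<sigma> A)) \<sigma> - G t (override_on \<zeta> \<sigma> A)) \<partial>\<mu>)"
            by (simp add: block_integral_def site_average_eq upd)
          also have "\<dots> = 0"
            by (intro integral_mult_site_average_diff[OF S(1)] depends_on_override_on' S FS x)
               (simp add: upd[symmetric])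
          finally show ?thesis by simp
        next
          case False
          have int: "integrable \<mu> (\<lambda>\<sigma>. H (override_on \<zeta> \<sigma> A))" if "depends_on S H" for H :: "config \<Rightarrow> real"
            by (rule integrable_depends_on[OF S(1) depends_on_override_on'[OF that]])
          have "block_integral A (?F x) \<zeta> = ad_rate x \<zeta> * (block_integral A (site_average p x (G t)) \<zeta> - block_integral A (G t) \<zeta>)"
            using int[OF S(3)] int[OF depends_on_site_average[OF S(3)]]
            by (simp add: block_integral_def ad_rate_override_on_outside[OF A False])
          also have "\<dots> \<le> 0"
            using outer_update_nonpos[OF S(1,3) _ x False i(2) mx'] S(2) by auto
          finally show ?thesis .
        qed
      qed
      finally show ?thesis by (simp add: i v'_def)
    qed
  qed
  then show ?thesis by (simp add: v_def)
qed

lemma partial_generator_uminus: "partial_generator \<Lambda> (\<lambda>\<eta>. - g \<eta>) \<eta> = - partial_generator \<Lambda> g \<eta>"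
  by (simp add: partial_generator_def site_average_eq algebra_simps flip: sum_negf)

text \<open>The one-sided bound for the flow and for its negative gives both inequalities. Since the
  mean over each enclosure keeps its equilibrium value, a second moment about that value is a
  genuine block variance.\<close>

lemma block_integral_partial_flow:
  assumes S: "finite S" "depends_on S f" "\<Lambda> \<union> children \<Lambda> \<subseteq> S" and A\<^sub>0: "depends_on A\<^sub>0 f"
    and I: "(A, \<zeta>) \<in> enclosures S \<Lambda> A\<^sub>0" and t: "0 \<le> t"
  shows "block_integral A (partial_flow \<Lambda> f t) \<zeta> = (\<integral>\<eta>. f \<eta> \<partial>\<mu>)"
proof (rule antisym)
  show "block_integral A (partial_flow \<Lambda> f t) \<zeta> \<le> (\<integral>\<eta>. f \<eta> \<partial>\<mu>)"
    using block_integral_le_initial[OF S(1,3) depends_on_partial_flow[OF S(2,3)] partial_flow_deriv[OF S(1,2)] _ I t] A\<^sub>0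
    by simp
  have "block_integral A (\<lambda>\<eta>. - partial_flow \<Lambda> f t \<eta>) \<zeta> \<le> (\<integral>\<eta>. - partial_flow \<Lambda> f 0 \<eta> \<partial>\<mu>)"
    by (rule block_integral_le_initial[OF S(1,3) _ _ _ I t, where G="\<lambda>t \<eta>. - partial_flow \<Lambda> f t \<eta>"])
       (auto simp: partial_generator_uminus intro!: depends_on_map[where h=uminus] depends_on_partial_flow[OF S(2,3)]
         DERIV_minus partial_flow_deriv[OF S(1,2)] A\<^sub>0)
  then show "(\<integral>\<eta>. f \<eta> \<partial>\<mu>) \<le> block_integral A (partial_flow \<Lambda> f t) \<zeta>" by (simp add: block_integral_def)
qed

text \<open>At a maximising pair the outer terms are nonpositive after a convexity estimate, and the
  inner ones add up to at most minus the infinite-volume Dirichlet form of \<open>h\<close>, a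
  function of the block sites. Since \<open>h\<close> has mean zero the gap applies; the 2 in the
  rate comes from differentiating a square.\<close>

lemma block_variance_decay:
  assumes gap: "\<And>S h. finite S \<Longrightarrow> depends_on S h \<Longrightarrow>
      \<gamma> * (\<integral>\<eta>. (h \<eta> - (\<integral>\<omega>. h \<omega> \<partial>\<mu>))\<^sup>2 \<partial>\<mu>) \<le> (\<integral>\<eta>. h \<eta> * (- ad_generator p h \<eta>) \<partial>\<mu>)"
    and S: "finite S" "depends_on S f" "\<Lambda> \<union> children \<Lambda> \<subseteq> S" and A\<^sub>0: "depends_on A\<^sub>0 f"
    and I: "(A, \<zeta>) \<in> enclosures S \<Lambda> A\<^sub>0" and t: "0 \<le> t" and c: "c = (\<integral>\<eta>. f \<eta> \<partial>\<mu>)"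
  shows "block_integral A (\<lambda>\<eta>. (partial_flow \<Lambda> f t \<eta> - c)\<^sup>2) \<zeta> \<le> exp (- 2 * \<gamma> * t) * (\<integral>\<eta>. (f \<eta> - c)\<^sup>2 \<partial>\<mu>)"
proof -
  define u where "u t \<eta> = partial_flow \<Lambda> f t \<eta> - c" for t \<eta>
  have uS: "depends_on S (u t)" for t
    unfolding u_def by (rule depends_on_map[where h="\<lambda>r. r - c", OF depends_on_partial_flow[OF S(2,3)]])
  have pg: "partial_generator \<Lambda> (u t) = partial_generator \<Lambda> (partial_flow \<Lambda> f t)" for t
    by (simp add: fun_eq_iff partial_generator_def site_average_eq u_def algebra_simps)
  define v where "v = (\<lambda>(A, \<zeta>) t. block_integral A (\<lambda>\<eta>. (u t \<eta>)\<^sup>2) \<zeta>)"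
  define v' where "v' = (\<lambda>(A, \<zeta>) t. block_integral A (\<lambda>\<eta>. 2 * (u t \<eta> * partial_generator \<Lambda> (u t) \<eta>)) \<zeta>)"
  have fin: "finite \<Lambda>" using S(1,3) finite_subset by blast
  have sqS: "depends_on S (\<lambda>\<eta>. (u t \<eta>)\<^sup>2)" for t by (rule depends_on_map[OF uS])
  have "v (A, \<zeta>) t \<le> exp (- 2 * \<gamma> * t) * (\<integral>\<eta>. (f \<eta> - c)\<^sup>2 \<partial>\<mu>)"
  proof (rule finite_maximum_principle[where v'=v', OF finite_enclosures[OF S(1) fin] _ _ _ I t])
    show "(v i has_real_derivative v' i t) (at t)" for i t
      unfolding v_def v'_def block_integral_def
    proof (cases i, simp only: prod.case, rule has_derivative_integral[OF S(1)])
      fix A \<zeta> and \<sigma> :: config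
      show "((\<lambda>t. (u t (override_on \<zeta> \<sigma> A))\<^sup>2) has_real_derivative
        2 * (u t (override_on \<zeta> \<sigma> A) * partial_generator \<Lambda> (u t) (override_on \<zeta> \<sigma> A))) (at t)"
        unfolding pg unfolding u_def by (auto intro!: derivative_eq_intros partial_flow_deriv[OF S(1,2)])
    qed (intro depends_on_override_on' sqS depends_on_map[where h="\<lambda>r. 2 * r"] depends_on_map2[where h="(*)"]
        depends_on_partial_generator uS S)+
    show "v i 0 \<le> (\<integral>\<eta>. (f \<eta> - c)\<^sup>2 \<partial>\<mu>)" if "i \<in> enclosures S \<Lambda> A\<^sub>0" for i
    proof -
      obtain A \<zeta> where i: "i = (A, \<zeta>)" "A\<^sub>0 \<subseteq> A" using \<open>i \<in> enclosures S \<Lambda> A\<^sub>0\<close> by (cases i) (auto simp: enclosures_def)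
      then have "f (override_on \<zeta> \<sigma> A) = f \<sigma>" for \<sigma>
        by (intro depends_onD[OF A\<^sub>0]) (auto simp: override_on_def)
      then show ?thesis by (simp add: i v_def u_def block_integral_def)
    qed
    show "v' i t \<le> (- 2 * \<gamma>) * v i t" if "i \<in> enclosures S \<Lambda> A\<^sub>0" and t: "0 \<le> t"
      and mx: "\<And>j. j \<in> enclosures S \<Lambda> A\<^sub>0 \<Longrightarrow> v j t \<le> v i t" for i t
    proof -
      obtain A \<zeta> where i: "i = (A, \<zeta>)" "(A, \<zeta>) \<in> enclosures S \<Lambda> A\<^sub>0" using \<open>i \<in> enclosures S \<Lambda> A\<^sub>0\<close> by (cases i) auto
      then have A: "prefix_closed A" "vacant_boundary A \<zeta>" "A \<subseteq> \<Lambda>" by (auto simp: enclosures_def)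
      have mx': "block_integral A' (\<lambda>\<eta>. (u t \<eta>)\<^sup>2) \<zeta>' \<le> block_integral A (\<lambda>\<eta>. (u t \<eta>)\<^sup>2) \<zeta>"
        if "(A', \<zeta>') \<in> enclosures S \<Lambda> A\<^sub>0" for A' \<zeta>'
        using mx[OF that] by (simp add: i v_def)
      have int: "integrable \<mu> (\<lambda>\<sigma>. H (override_on \<zeta> \<sigma> A))" if "depends_on S H" for H :: "config \<Rightarrow> real"
        by (rule integrable_depends_on[OF S(1) depends_on_override_on'[OF that]])
      let ?F = "\<lambda>x \<eta>. ad_rate x \<eta> * (u t \<eta> * (site_average p x (u t) \<eta> - u t \<eta>))"
      have FS: "depends_on S (?F x)" "depends_on S (ad_rate x)" if "x \<in> \<Lambda>" for x
      proof -
        show "depends_on S (ad_rate x)"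
          using that S(3) by (intro depends_on_ad_rate) (auto simp: children_def)
        then show "depends_on S (?F x)"
          by (intro depends_on_map2[where h="(*)"] depends_on_map2[where h="(-)"] depends_on_site_average uS)
      qed
      define h where "h \<sigma> = u t (override_on \<zeta> \<sigma> A)" for \<sigma>
      have hS: "depends_on S h" unfolding h_def by (rule depends_on_override_on'[OF uS])
      have hA: "depends_on A h" unfolding h_def by (rule depends_on_mono[OF depends_on_override_on[OF uS]]) auto
      have finA: "finite A" using A(3) fin finite_subset by blast
      have out: "block_integral A (?F x) \<zeta> \<le> 0" if x: "x \<in> \<Lambda> - A" for x
      proof -
        \<comment> \<open>Convexity: twice \<open>u\<close> times its increment is at most the
          increment of the square, so the inequality for outer updates can be applied to the square
          itself.\<close>
        have sq: "2 * ?F x \<eta> \<le> ad_rate x \<eta> * (site_average p x (\<lambda>\<eta>. (u t \<eta>)\<^sup>2) \<eta> - (u t \<eta>)\<^sup>2)" for \<eta>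
        proof -
          have "site_average p x (\<lambda>\<eta>. (u t \<eta>)\<^sup>2) \<eta> - (u t \<eta>)\<^sup>2 - 2 * (u t \<eta> * (site_average p x (u t) \<eta> - u t \<eta>)) =
            p * (u t (\<eta>(x := True)) - u t \<eta>)\<^sup>2 + (1 - p) * (u t (\<eta>(x := False)) - u t \<eta>)\<^sup>2"
            by (simp add: site_average_eq power2_eq_square algebra_simps)
          also have "\<dots> \<ge> 0" using p_nonneg p_le_1 by simp
          finally have "2 * (u t \<eta> * (site_average p x (u t) \<eta> - u t \<eta>)) \<le> site_average p x (\<lambda>\<eta>. (u t \<eta>)\<^sup>2) \<eta> - (u t \<eta>)\<^sup>2" by simp
          from mult_left_mono[OF this ad_rate_nonneg[of x \<eta>]] show ?thesis by (simp add: mult.left_commute)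
        qed
        have avS: "depends_on S (site_average p x (\<lambda>\<eta>. (u t \<eta>)\<^sup>2))" by (rule depends_on_site_average[OF sqS])
        have "2 * block_integral A (?F x) \<zeta> = block_integral A (\<lambda>\<eta>. 2 * ?F x \<eta>) \<zeta>" by (simp add: block_integral_def)
        also have "\<dots> \<le> block_integral A (\<lambda>\<eta>. ad_rate x \<eta> * (site_average p x (\<lambda>\<eta>. (u t \<eta>)\<^sup>2) \<eta> - (u t \<eta>)\<^sup>2)) \<zeta>"
          unfolding block_integral_def using x
          by (intro integral_mono int sq depends_on_map[where h="\<lambda>r. 2 * r"] FS
              depends_on_map2[where h="(*)"] depends_on_map2[where h="(-)"] avS sqS) auto
        also have "\<dots> = ad_rate x \<zeta> * (block_integral A (site_average p x (\<lambda>\<eta>. (u t \<eta>)\<^sup>2)) \<zeta> - block_integral A (\<lambda>\<eta>. (u t \<eta>)\<^sup>2) \<zeta>)"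
          using int[OF avS] int[OF sqS] x by (simp add: block_integral_def ad_rate_override_on_outside[OF A(1)])
        also have "\<dots> \<le> 0"
          using outer_update_nonpos[OF S(1) sqS _ _ _ i(2) mx'] S(3) x by auto
        finally show ?thesis by simp
      qed
      have inn: "block_integral A (?F x) \<zeta> \<le>
          - (\<integral>\<eta>. ad_rate x \<eta> * (p * (1 - p) * (h (\<eta>(x := True)) - h (\<eta>(x := False)))\<^sup>2) \<partial>\<mu>)" if x: "x \<in> A" for x
      proof -
        have upd: "(override_on \<zeta> \<sigma> A)(x := b) = override_on \<zeta> (\<sigma>(x := b)) A" for \<sigma> b
          using x by (auto simp: override_on_def fun_eq_iff)
        have "x \<in> \<Lambda>" using x A by auto
        have gS: "depends_on S (\<lambda>\<eta>. p * (1 - p) * (h (\<eta>(x := True)) - h (\<eta>(x := False)))\<^sup>2)"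
          by (intro depends_on_map2[where h="\<lambda>a b. p * (1 - p) * (a - b)\<^sup>2"] depends_on_fun_upd' hS)
        have rS: "depends_on S (\<lambda>\<sigma>. ad_rate x (override_on \<zeta> \<sigma> A))"
          by (rule depends_on_override_on'[OF FS(2)[OF \<open>x \<in> \<Lambda>\<close>]])
        have "block_integral A (?F x) \<zeta> = (\<integral>\<sigma>. ad_rate x (override_on \<zeta> \<sigma> A) * (h \<sigma> * (site_average p x h \<sigma> - h \<sigma>)) \<partial>\<mu>)"
          by (simp add: block_integral_def site_average_eq upd h_def)
        also have "\<dots> = - (\<integral>\<sigma>. ad_rate x (override_on \<zeta> \<sigma> A) * (p * (1 - p) * (h (\<sigma>(x := True)) - h (\<sigma>(x := False)))\<^sup>2) \<partial>\<mu>)"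
          by (rule integral_dirichlet_term[OF S(1) rS hS]) (simp add: upd[symmetric])
        \<comment> \<open>The vacant boundary enters here: the actual rates are at least those read
          from \<sigma> alone.\<close>
        also have "\<dots> \<le> - (\<integral>\<sigma>. ad_rate x \<sigma> * (p * (1 - p) * (h (\<sigma>(x := True)) - h (\<sigma>(x := False)))\<^sup>2) \<partial>\<mu>)"
          using p_nonneg p_le_1
          by (intro le_imp_neg_le integral_mono integrable_depends_on[OF S(1)] depends_on_map2[where h="(*)"] gS rS
              FS \<open>x \<in> \<Lambda>\<close> mult_right_mono ad_rate_override_on_mono[OF A(2) x]) auto
        finally show ?thesis .
      qed
      have mean: "(\<integral>\<sigma>. h \<sigma> \<partial>\<mu>) = 0"
      proof -
        have "(\<integral>\<sigma>. h \<sigma> \<partial>\<mu>) = block_integral A (partial_flow \<Lambda> f t) \<zeta> - c"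
          using int[OF depends_on_partial_flow[OF S(2,3)]] prob_space.prob_space[OF prob_space_bernoulli_product, of p]
          by (simp add: h_def u_def block_integral_def Bochner_Integration.integral_diff integrable_depends_on[of "{}"])
        then show ?thesis using block_integral_partial_flow[OF S A\<^sub>0 i(2) t] c by simp
      qed
      have e1: "v' i t = 2 * (\<Sum>x\<in>\<Lambda>. block_integral A (?F x) \<zeta>)"
      proof -
        have "u t \<eta> * partial_generator \<Lambda> (u t) \<eta> = (\<Sum>x\<in>\<Lambda>. ?F x \<eta>)" for \<eta>
          by (simp add: partial_generator_def sum_distrib_left mult.left_commute)
        moreover have "block_integral A (\<lambda>\<eta>. \<Sum>x\<in>\<Lambda>. ?F x \<eta>) \<zeta> = (\<Sum>x\<in>\<Lambda>. block_integral A (?F x) \<zeta>)"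
          unfolding block_integral_def by (intro Bochner_Integration.integral_sum int FS)
        ultimately show ?thesis by (simp add: i v'_def block_integral_def)
      qed
      have e2: "(\<Sum>x\<in>\<Lambda>. block_integral A (?F x) \<zeta>) =
          (\<Sum>x\<in>A. block_integral A (?F x) \<zeta>) + (\<Sum>x\<in>\<Lambda> - A. block_integral A (?F x) \<zeta>)"
        using fin A(3) by (simp add: sum.subset_diff)
      have e3: "(\<Sum>x\<in>\<Lambda> - A. block_integral A (?F x) \<zeta>) \<le> 0" by (rule sum_nonpos[OF out])
      \<comment> \<open>\<open>h\<close> depends on \<open>A\<close> only, so its infinite-volume
        form is a sum over exactly the sites of \<open>A\<close>.\<close>
      have e4: "(\<Sum>x\<in>A. block_integral A (?F x) \<zeta>) \<le> - (\<integral>\<eta>. h \<eta> * (- ad_generator p h \<eta>) \<partial>\<mu>)"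
        unfolding dirichlet_form[OF finA hA] sum_negf[symmetric] by (rule sum_mono[OF inn])
      have e5: "\<gamma> * (\<integral>\<eta>. (h \<eta>)\<^sup>2 \<partial>\<mu>) \<le> (\<integral>\<eta>. h \<eta> * (- ad_generator p h \<eta>) \<partial>\<mu>)"
        using gap[OF finA hA] unfolding mean by simp
      have "v' i t \<le> 2 * - (\<gamma> * (\<integral>\<eta>. (h \<eta>)\<^sup>2 \<partial>\<mu>))" using e1 e2 e3 e4 e5 by linarith
      then show ?thesis by (simp add: i v_def h_def block_integral_def)
    qed
  qed
  then show ?thesis by (simp add: v_def u_def)
qed

end

section \<open>Transfer to the process started from a fixed configuration\<close>

context ad_semigroup begin

text \<open>With \<open>q = min p (1 - p)\<close>, the pattern of \<eta> on \<open>A\<close> has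
  weight at least \<open>q ^ card A\<close>, so the squared deviation at \<eta> is at most the block
  second moment divided by this weight; a square root gives the base \<open>1 / sqrt q\<close>. The
  bound is uniform in the truncation depth \<open>N\<close> and passes to the limit.\<close>

lemma relaxation_from_enclosure:
  assumes p: "0 < p" "p < 1"
    and gap: "\<And>S h. finite S \<Longrightarrow> depends_on S h \<Longrightarrow>
      \<gamma> * (\<integral>\<eta>. (h \<eta> - (\<integral>\<omega>. h \<omega> \<partial>\<mu>))\<^sup>2 \<partial>\<mu>) \<le> (\<integral>\<eta>. h \<eta> * (- ad_generator p h \<eta>) \<partial>\<mu>)"
    and f: "depends_on {x. length x < n} f" "\<And>\<omega>. \<bar>f \<omega>\<bar> \<le> B"
    and A: "finite A" "{x. length x < n} \<subseteq> A" "prefix_closed A" "vacant_boundary A \<eta>" and t: "0 \<le> t"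
  shows "\<bar>T t f \<eta> - (\<integral>\<omega>. f \<omega> \<partial>\<mu>)\<bar> \<le> 2 * B * (1 / sqrt (min p (1 - p))) ^ card A * exp (- \<gamma> * t)"
proof -
  define c where "c = (\<integral>\<omega>. f \<omega> \<partial>\<mu>)"
  define q where "q = min p (1 - p)"
  have q: "0 < q" using p by (simp add: q_def)
  have B: "0 \<le> B" using f(2)[of "\<lambda>_. True"] by linarith
  have cB: "\<bar>c\<bar> \<le> B" unfolding c_def by (rule abs_integral_local_le[OF _ f]) simp
  have var: "(\<integral>\<omega>. (f \<omega> - c)\<^sup>2 \<partial>\<mu>) \<le> (2 * B)\<^sup>2"
  proof -
    have "(\<integral>\<omega>. (f \<omega> - c)\<^sup>2 \<partial>\<mu>) \<le> (\<integral>\<omega>. (2 * B)\<^sup>2 \<partial>\<mu>)"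
    proof (rule integral_mono)
      show "integrable \<mu> (\<lambda>\<omega>. (f \<omega> - c)\<^sup>2)"
        by (rule integrable_depends_on[OF _ depends_on_map[where h="\<lambda>r. (r - c)\<^sup>2", OF f(1)]]) simp
      show "(f \<omega> - c)\<^sup>2 \<le> (2 * B)\<^sup>2" for \<omega> using f(2)[of \<omega>] cB by (intro abs_le_square_iff[THEN iffD1]) linarith
    qed (rule integrable_depends_on[of "{}"], auto)
    then show ?thesis by (simp only: integral_const_bernoulli_product)
  qed
  obtain N\<^sub>0 where N\<^sub>0: "\<And>x. x \<in> A \<Longrightarrow> length x < N\<^sub>0"
    using finite_nat_set_iff_bounded[of "length ` A"] A(1) by auto
  have bound: "\<bar>partial_flow {x. length x < N} f t \<eta> - c\<bar> \<le> 2 * B * (1 / sqrt q) ^ card A * exp (- \<gamma> * t)"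
    if N: "max N\<^sub>0 n \<le> N" for N
  proof -
    let ?\<Lambda> = "{x :: vertex. length x < N}" and ?S = "{x :: vertex. length x \<le> N}" and ?A\<^sub>0 = "{x :: vertex. length x < n}"
    let ?g = "partial_flow ?\<Lambda> f t" and ?\<zeta> = "restrict_config {x. length x \<le> N} \<eta>"
    have S: "finite ?S" "depends_on ?S f" "?\<Lambda> \<union> children ?\<Lambda> \<subseteq> ?S"
      using N by (auto simp: children_def intro: depends_on_mono[OF f(1)])
    have AN: "A \<subseteq> ?\<Lambda>" using N\<^sub>0 N by fastforce
    then have I: "(A, ?\<zeta>) \<in> enclosures ?S ?\<Lambda> ?A\<^sub>0"
      using A by (auto simp: enclosures_def vacant_boundary_def restrict_config_def supported_iff)
    let ?F = "\<lambda>\<sigma>. (?g (override_on ?\<zeta> \<sigma> A) - c)\<^sup>2"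
    have FA: "depends_on A ?F"
      by (rule depends_on_mono[OF depends_on_map[where h="\<lambda>r. (r - c)\<^sup>2", OF depends_on_override_on[OF depends_on_partial_flow[OF S(2,3)]]]]) auto
    have sq: "(sqrt q ^ card A)\<^sup>2 = q ^ card A"
      by (subst power_mult[symmetric], subst mult.commute, subst power_mult) (use q in simp)
    have "override_on ?\<zeta> \<eta> A x = \<eta> x" if "x \<in> ?S" for x
      using that by (auto simp: override_on_def restrict_config_def)
    then have "?g (override_on ?\<zeta> \<eta> A) = ?g \<eta>"
      by (intro depends_onD[OF depends_on_partial_flow[OF S(2,3)]])
    then have "q ^ card A * (?g \<eta> - c)\<^sup>2 = q ^ card A * ?F \<eta>" by simp
    also have "\<dots> \<le> weight A {x \<in> A. \<eta> x} * ?F \<eta>"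
      unfolding q_def by (intro mult_right_mono weight_ge A) auto
    also have "\<dots> \<le> (\<integral>\<sigma>. ?F \<sigma> \<partial>\<mu>)" by (rule pattern_weight_le_integral[OF A(1) FA]) simp
    also have "\<dots> \<le> exp (- 2 * \<gamma> * t) * (\<integral>\<omega>. (f \<omega> - c)\<^sup>2 \<partial>\<mu>)"
      using block_variance_decay[OF gap S f(1) I t c_def] by (simp add: block_integral_def)
    also have "\<dots> \<le> exp (- 2 * \<gamma> * t) * (2 * B)\<^sup>2" by (intro mult_left_mono var) auto
    finally have "(?g \<eta> - c)\<^sup>2 \<le> exp (- 2 * \<gamma> * t) * (2 * B)\<^sup>2 / q ^ card A"
      using q by (simp add: pos_le_divide_eq mult.commute)
    also have "exp (- 2 * \<gamma> * t) = (exp (- \<gamma> * t))\<^sup>2" by (simp add: power2_eq_square flip: exp_add)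
    also have "(exp (- \<gamma> * t))\<^sup>2 * (2 * B)\<^sup>2 / q ^ card A = (2 * B * (1 / sqrt q) ^ card A * exp (- \<gamma> * t))\<^sup>2"
      using sq by (simp add: power_mult_distrib power_divide)
    finally have "\<bar>?g \<eta> - c\<bar>\<^sup>2 \<le> (2 * B * (1 / sqrt q) ^ card A * exp (- \<gamma> * t))\<^sup>2" by simp
    then show ?thesis using B q by (rule_tac power2_le_imp_le) auto
  qed
  have "(\<lambda>N. \<bar>partial_flow {x. length x < N} f t \<eta> - c\<bar>) \<longlonglongrightarrow> \<bar>T t f \<eta> - c\<bar>"
    by (intro tendsto_intros partial_flow_tendsto_T[OF f(1) t])
  from LIMSEQ_le_const2[OF this] bound show ?thesis unfolding c_def q_def by blast
qed

end

section \<open>Density zero: a decreasing weight in place of the spectral gap\<close>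

lemma (in bernoulli_parameter) integral_density_zero:
  fixes F :: "config \<Rightarrow> real"
  assumes "p = 0" "finite S" "depends_on S F"
  shows "(\<integral>\<eta>. F \<eta> \<partial>\<mu>) = F (\<lambda>_. False)"
proof -
  have "(\<integral>\<eta>. F \<eta> \<partial>\<mu>) = (\<Sum>B\<in>Pow S. weight S B * F (\<lambda>x. x \<in> B))"
    by (rule integral_eq_sum_patterns[OF assms(2,3)])
  also have "\<dots> = (\<Sum>B\<in>{{}}. weight S B * F (\<lambda>x. x \<in> B))"
  proof (rule sum.mono_neutral_right)
    show "\<forall>B\<in>Pow S - {{}}. weight S B * F (\<lambda>x. x \<in> B) = 0"
    proof
      fix B assume "B \<in> Pow S - {{}}"
      then obtain x where "x \<in> S" "x \<in> B" by auto
      then have "weight S B = 0" using assms(1,2) unfolding weight_def by (intro prod_zero) auto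
      then show "weight S B * F (\<lambda>x. x \<in> B) = 0" by simp
    qed
  qed (use assms(2) in auto)
  also have "\<dots> = F (\<lambda>_. False)" unfolding weight_def using assms(1) by simp
  finally show ?thesis .
qed

lemma prefix_closed_take: "prefix_closed A \<Longrightarrow> x \<in> A \<Longrightarrow> take k x \<in> A"
proof (induction x rule: rev_induct)
  case (snoc b x)
  then have "x \<in> A" by (auto simp: prefix_closed_def)
  with snoc show ?case by (cases "k \<le> length x") auto
qed simp

text \<open>The prefixes of \<open>x\<close> are \<open>length x + 1\<close> distinct elements of
  \<open>A\<close>.\<close>

lemma prefix_closed_length_less_card:
  assumes "prefix_closed A" "finite A" "x \<in> A"
  shows "length x < card A"
proof -
  have inj: "inj_on (\<lambda>k. take k x) {..length x}" by (rule inj_on_inverseI[where g=length]) auto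
  have "(\<lambda>k. take k x) ` {..length x} \<subseteq> A" using prefix_closed_take[OF assms(1,3)] by auto
  from card_mono[OF assms(2) this] show ?thesis by (simp add: card_image[OF inj])
qed

context ad_semigroup begin

text \<open>Gronwall along the semigroup: \<open>exp (a * s) * T s f \<eta>\<close> is
  nonincreasing. The error \<open>w\<close> accommodates boundary sites whose contribution has zero
  expectation from the given \<eta>.\<close>

lemma T_decay:
  assumes f: "finite S" "depends_on S f" and w: "finite S'" "depends_on S' w"
    and le: "\<And>\<omega>. ad_generator p f \<omega> \<le> - a * f \<omega> + w \<omega>"
    and w0: "\<And>s. 0 \<le> s \<Longrightarrow> T s w \<eta> = 0" and t: "0 \<le> t"
  shows "T t f \<eta> \<le> exp (- a * t) * f \<eta>"
proof (cases "t = 0")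
  case True
  then show ?thesis using T_0[OF measurable_depends_on[OF f]] by simp
next
  case False
  let ?S = "S \<union> S' \<union> children S"
  have LS: "finite ?S" "depends_on ?S (ad_generator p f)" "depends_on ?S f" "depends_on ?S w"
    using f w by (auto intro: depends_on_mono depends_on_mono[OF depends_on_ad_generator[OF f]])
  define F where "F s = exp (a * s) * T s f \<eta>" for s
  have TL: "T s (ad_generator p f) \<eta> \<le> - a * T s f \<eta>" if s: "0 \<le> s" for s
  proof -
    have rS: "depends_on ?S (\<lambda>\<omega>. - a * f \<omega> + w \<omega>)"
      by (rule depends_on_map2[where h="\<lambda>r r'. - a * r + r'", OF LS(3,4)])
    obtain B1 where B1: "\<And>\<omega>. \<bar>ad_generator p f \<omega>\<bar> \<le> B1" using bounded_depends_on[OF LS(1,2)] by metis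
    obtain B2 where B2: "\<And>\<omega>. \<bar>- a * f \<omega> + w \<omega>\<bar> \<le> B2" using bounded_depends_on[OF LS(1) rS] by metis
    obtain B3 where B3: "\<And>\<omega>. \<bar>f \<omega>\<bar> \<le> B3" using bounded_depends_on[OF LS(1,3)] by metis
    obtain B4 where B4: "\<And>\<omega>. \<bar>w \<omega>\<bar> \<le> B4" using bounded_depends_on[OF LS(1,4)] by metis
    have "T s (ad_generator p f) \<eta> \<le> T s (\<lambda>\<omega>. - a * f \<omega> + w \<omega>) \<eta>"
      by (rule T_mono[OF s measurable_depends_on[OF LS(1,2)] B1 measurable_depends_on[OF LS(1) rS] B2 le])
    also have "\<dots> = - a * T s f \<eta> + T s w \<eta>"
      using kernel_integrable[OF s measurable_depends_on[OF LS(1,3)] B3] kernel_integrable[OF s measurable_depends_on[OF LS(1,4)] B4]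
      by (simp add: T_def)
    finally show ?thesis using w0[OF s] by simp
  qed
  have dF: "(F has_real_derivative exp (a * s) * (a * T s f \<eta> + T s (ad_generator p f) \<eta>)) (at s)" if "0 < s" for s
    unfolding F_def by (auto intro!: derivative_eq_intros T_deriv_at[OF f that] simp: algebra_simps)
  have "continuous_on {0..t} F" unfolding F_def
    by (intro continuous_intros continuous_on_subset[OF T_continuous[OF f]]) auto
  then obtain l z where z: "0 < z" "z < t" "(F has_real_derivative l) (at z)" "F t - F 0 = (t - 0) * l"
    using MVT[of 0 t F] dF t False by (auto simp: real_differentiable_def)
  have "l = exp (a * z) * (a * T z f \<eta> + T z (ad_generator p f) \<eta>)" using z dF DERIV_unique by blast
  also have "\<dots> \<le> 0" using TL[of z] z by (intro mult_nonneg_nonpos) auto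
  finally have "F t \<le> F 0" using z(4) mult_nonneg_nonpos[OF t, of l] by simp
  then have "exp (- a * t) * F t \<le> exp (- a * t) * F 0" by simp
  then show ?thesis using T_0[OF measurable_depends_on[OF f]] by (simp add: F_def exp_minus field_simps)
qed

text \<open>At density zero the product measure is a point mass and there is no \<open>L\<^sup>2\<close> theory. Instead the
  weight \<open>2 ^ length x\<close> on the occupied sites decreases: every blocked site is compensated by half
  the weight of an occupied child.\<close>

lemma relaxation_from_enclosure_density_zero:
  assumes p0: "p = 0" and f: "depends_on {x. length x < n} f" "\<And>\<omega>. \<bar>f \<omega>\<bar> \<le> B"
    and A: "finite A" "{x. length x < n} \<subseteq> A" "prefix_closed A" "vacant_boundary A \<eta>" and t: "0 \<le> t"
  shows "\<bar>T t f \<eta> - (\<integral>\<omega>. f \<omega> \<partial>\<mu>)\<bar> \<le> 2 * B * 4 ^ card A * exp (- (1 / 2) * t)"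
proof -
  define o1 where "o1 x \<omega> = (if \<omega> x then 2 ^ length x else 0 :: real)" for x :: vertex and \<omega> :: config
  define V where "V \<omega> = (\<Sum>x\<in>A. o1 x \<omega>)" for \<omega>
  let ?D = "children A - A"
  define W where "W \<omega> = (\<Sum>x\<in>?D. 1 / 2 * o1 x \<omega>)" for \<omega>
  have o1S: "depends_on S (o1 x)" if "x \<in> S" for x S
    unfolding o1_def by (rule depends_on_coordinate[OF that])
  have VA: "depends_on A V" unfolding V_def by (intro depends_on_sum o1S)
  have WD: "depends_on ?D W" unfolding W_def by (intro depends_on_sum depends_on_map[where h="\<lambda>r. 1 / 2 * r"] o1S)
  have av: "site_average p x F \<omega> - F \<omega> = (if \<omega> x then F (fun_upd \<omega> x False) - F \<omega> else 0)" for x F \<omega>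
    by (subst site_average_eq) (auto simp: p0 fun_upd_idem)
  \<comment> \<open>At density zero updates only empty sites, so a site that starts vacant stays
    vacant; this disposes of the boundary term \<open>W\<close>.\<close>
  have o1_0: "T s (o1 x) \<eta> = 0" if x: "x \<in> ?D" and s: "0 \<le> s" for x s
  proof (rule antisym)
    have "\<not> \<eta> x" using x A(4) by (auto simp: children_def vacant_boundary_def)
    then have "o1 x \<eta> = 0" by (simp add: o1_def)
    have "ad_generator p (o1 x) \<omega> \<le> - 0 * o1 x \<omega> + 0" for \<omega>
      unfolding ad_generator_eq_sum[OF finite.insertI[OF finite.emptyI] o1S[OF insertI1]] av
      by (simp add: o1_def)
    from T_decay[where \<eta>=\<eta> and S="{x}", OF _ o1S[OF insertI1] finite.emptyI depends_on_const this _ s]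
    have "T s (o1 x) \<eta> \<le> exp (- 0 * s) * o1 x \<eta>" by (simp add: T_def)
    with \<open>o1 x \<eta> = 0\<close> show "T s (o1 x) \<eta> \<le> 0" by simp
    show "0 \<le> T s (o1 x) \<eta>" unfolding T_def by (intro integral_nonneg_AE AE_I2) (simp add: o1_def)
  qed
  have W0: "T s W \<eta> = 0" if s: "0 \<le> s" for s
  proof -
    have "T s W \<eta> = (\<Sum>x\<in>?D. T s (\<lambda>\<omega>. 1 / 2 * o1 x \<omega>) \<eta>)"
      unfolding W_def by (rule T_sum[OF s, where S="?D"])
        (use A(1) in simp, intro depends_on_map[where h="\<lambda>r. 1 / 2 * r"] o1S)
    also have "\<dots> = 0" unfolding T_cmult by (simp add: o1_0 s)
    finally show ?thesis .
  qed
  have LV: "ad_generator p V \<omega> \<le> - (1 / 2) * V \<omega> + W \<omega>" for \<omega>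
  proof -
    have "ad_generator p V \<omega> = (\<Sum>x\<in>A. - (ad_rate x \<omega> * o1 x \<omega>))"
      unfolding ad_generator_eq_sum[OF A(1) VA] av
    proof (intro sum.cong refl)
      fix x assume x: "x \<in> A"
      have "V (fun_upd \<omega> x False) - V \<omega> = (\<Sum>y\<in>A. o1 y (fun_upd \<omega> x False) - o1 y \<omega>)"
        by (simp add: V_def sum_subtractf)
      also have "\<dots> = (\<Sum>y\<in>A. if y = x then - o1 x \<omega> else 0)" by (intro sum.cong) (auto simp: o1_def)
      also have "\<dots> = - o1 x \<omega>" using x A(1) by simp
      finally show "ad_rate x \<omega> * (if \<omega> x then V (fun_upd \<omega> x False) - V \<omega> else 0) = - (ad_rate x \<omega> * o1 x \<omega>)"
        by (simp add: o1_def)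
    qed
    also have "\<dots> \<le> (\<Sum>x\<in>A. - o1 x \<omega> + (\<Sum>b\<in>UNIV. 1 / 2 * o1 (x @ [b]) \<omega>))"
      by (intro sum_mono) (auto simp: ad_rate_def o1_def UNIV_bool)
    also have "\<dots> = - V \<omega> + (\<Sum>x\<in>A. \<Sum>b\<in>UNIV. 1 / 2 * o1 (x @ [b]) \<omega>)"
      by (simp only: V_def sum.distrib sum_negf)
    \<comment> \<open>A nonroot site has a single parent, so no child is charged twice.\<close>
    also have "(\<Sum>x\<in>A. \<Sum>b\<in>UNIV. 1 / 2 * o1 (x @ [b]) \<omega>) = (\<Sum>y\<in>children A. 1 / 2 * o1 y \<omega>)"
    proof -
      have inj: "inj_on (\<lambda>(x, b). x @ [b]) (A \<times> (UNIV :: bool set))" by (auto simp: inj_on_def)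
      have "children A = (\<lambda>(x, b). x @ [b]) ` (A \<times> UNIV)" by (auto simp: children_def image_iff UNIV_bool)
      then have "(\<Sum>y\<in>children A. 1 / 2 * o1 y \<omega>) = (\<Sum>z\<in>A \<times> UNIV. 1 / 2 * o1 ((\<lambda>(x, b). x @ [b]) z) \<omega>)"
        by (simp only: sum.reindex[OF inj] comp_def)
      then show ?thesis by (simp add: sum.cartesian_product case_prod_unfold)
    qed
    also have "\<dots> = (\<Sum>y\<in>children A \<inter> A. 1 / 2 * o1 y \<omega>) + W \<omega>"
      using A(1) unfolding W_def by (subst sum.Int_Diff[where B=A]) auto
    also have "(\<Sum>y\<in>children A \<inter> A. 1 / 2 * o1 y \<omega>) \<le> (\<Sum>y\<in>A. 1 / 2 * o1 y \<omega>)"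
      using A(1) by (intro sum_mono2) (auto simp: o1_def)
    also have "\<dots> = 1 / 2 * V \<omega>" by (simp add: V_def sum_distrib_left)
    finally show ?thesis by simp
  qed
  have "finite ?D" using A(1) by simp
  from T_decay[OF A(1) VA this WD LV W0 t] have TV: "T t V \<eta> \<le> exp (- (1 / 2) * t) * V \<eta>" by simp
  have V4: "V \<eta> \<le> 4 ^ card A"
  proof -
    \<comment> \<open>Depths in \<open>A\<close> are below \<open>card A\<close>, and
      \<open>card A * 2 ^ card A \<le> 4 ^ card A\<close>.\<close>
    have "V \<eta> \<le> (\<Sum>x\<in>A. 2 ^ card A)"
      unfolding V_def o1_def using prefix_closed_length_less_card[OF A(3,1)]
      by (intro sum_mono) (auto intro!: power_increasing less_imp_le)
    also have "\<dots> \<le> 2 ^ card A * 2 ^ card A"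
      using of_nat_less_two_power[where 'a=real, of "card A"] by (simp add: mult_right_mono less_imp_le)
    finally show ?thesis by (simp flip: power_mult_distrib)
  qed
  let ?c = "f (\<lambda>_. False)"
  have B: "0 \<le> B" using f(2)[of "\<lambda>_. True"] by linarith
  have diff: "\<bar>f \<omega> - ?c\<bar> \<le> 2 * B * V \<omega>" for \<omega>
  proof (cases "\<exists>x\<in>{x. length x < n}. \<omega> x")
    case True
    then obtain x where x: "x \<in> A" "\<omega> x" using A(2) by auto
    have "1 \<le> o1 x \<omega>" using x by (simp add: o1_def)
    also have "\<dots> \<le> V \<omega>" unfolding V_def using x A(1) by (intro member_le_sum) (auto simp: o1_def)
    finally have "2 * B * 1 \<le> 2 * B * V \<omega>" using B by (intro mult_left_mono) auto
    then show ?thesis using f(2)[of \<omega>] f(2)[of "\<lambda>_. False"] by linarith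
  next
    case False
    then have "f \<omega> = ?c" by (intro depends_onD[OF f(1)]) auto
    moreover have "0 \<le> V \<omega>" unfolding V_def by (intro sum_nonneg) (auto simp: o1_def)
    ultimately show ?thesis using B by simp
  qed
  obtain BV where BV: "\<And>\<omega>. \<bar>V \<omega>\<bar> \<le> BV" using bounded_depends_on[OF A(1) VA] by metis
  have fm: "f \<in> borel_measurable config_space" by (rule measurable_depends_on[OF _ f(1)]) simp
  interpret K: prob_space "K t \<eta>" by (rule prob_space_kernel[OF t])
  have int: "integrable (K t \<eta>) f" "integrable (K t \<eta>) V"
    using kernel_integrable[OF t fm f(2)] kernel_integrable[OF t measurable_depends_on[OF A(1) VA] BV] by auto
  have "T t f \<eta> - ?c = (\<integral>\<omega>. f \<omega> - ?c \<partial>K t \<eta>)"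
    using int K.prob_space by (simp add: T_def)
  also have "\<bar>\<dots>\<bar> \<le> (\<integral>\<omega>. \<bar>f \<omega> - ?c\<bar> \<partial>K t \<eta>)" by (rule integral_abs_bound)
  also have "\<dots> \<le> (\<integral>\<omega>. 2 * B * V \<omega> \<partial>K t \<eta>)" using int diff by (intro integral_mono) auto
  also have "\<dots> = 2 * B * T t V \<eta>" by (simp add: T_def)
  also have "\<dots> \<le> 2 * B * (exp (- (1 / 2) * t) * 4 ^ card A)"
    using B TV V4 by (intro mult_left_mono order_trans[OF TV]) auto
  finally show ?thesis
    using integral_density_zero[OF p0 _ f(1)] by (simp add: mult.assoc mult.left_commute mult.commute)
qed

text \<open>The rate \<gamma> and the base \<kappa> depend on neither \<open>f\<close> nor the
  enclosure, so the final exponent can be fixed before \<open>f\<close> is chosen.\<close>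

lemma relaxation:
  assumes "p < 1" "ad_gap p > 0"
  obtains \<gamma> \<kappa> :: real where "0 < \<gamma>" "1 \<le> \<kappa>"
    "\<And>n f B A \<eta> t. depends_on {x. length x < n} f \<Longrightarrow> (\<And>\<omega>. \<bar>f \<omega>\<bar> \<le> B) \<Longrightarrow> finite A \<Longrightarrow>
      {x. length x < n} \<subseteq> A \<Longrightarrow> prefix_closed A \<Longrightarrow> vacant_boundary A \<eta> \<Longrightarrow> 0 \<le> t \<Longrightarrow>
      \<bar>T t f \<eta> - (\<integral>\<omega>. f \<omega> \<partial>\<mu>)\<bar> \<le> 2 * B * \<kappa> ^ card A * exp (- \<gamma> * t)"
proof (cases "p = 0")
  case True
  show ?thesis
    by (rule that[of "1 / 2" 4]) (auto intro: relaxation_from_enclosure_density_zero[OF True, simplified])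
next
  case False
  then have p: "0 < p" using p_nonneg by simp
  from spectral_gap_inequality[OF assms(2)] obtain \<gamma> where \<gamma>: "0 < \<gamma>" "\<And>S h. finite S \<Longrightarrow> depends_on S h \<Longrightarrow>
    \<gamma> * (\<integral>\<eta>. (h \<eta> - (\<integral>\<omega>. h \<omega> \<partial>\<mu>))\<^sup>2 \<partial>\<mu>) \<le> (\<integral>\<eta>. h \<eta> * (- ad_generator p h \<eta>) \<partial>\<mu>)" by blast
  show ?thesis
    by (rule that[OF \<gamma>(1) _ relaxation_from_enclosure[OF p assms(1) \<gamma>(2)]]) (use p assms(1) in auto)
qed

end

section \<open>Subcritical clusters\<close>

definition subtree :: "vertex \<Rightarrow> vertex set" where
  "subtree x = range (\<lambda>z. x @ z)"

text \<open>Truncation at depth \<open>n\<close> keeps the set finite; the full occupied cluster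
  below \<open>x\<close> is the increasing union over \<open>n\<close>.\<close>

primrec cluster :: "config \<Rightarrow> nat \<Rightarrow> vertex \<Rightarrow> vertex set" where
  "cluster \<eta> 0 x = {}"
| "cluster \<eta> (Suc n) x =
    (if \<eta> x then insert x (cluster \<eta> n (x @ [False]) \<union> cluster \<eta> n (x @ [True])) else {})"

text \<open>Equal to \<open>a ^ card (cluster \<eta> n x)\<close>, but written as a product over the
  two child subtrees so that their independence can be used.\<close>

primrec cluster_weight :: "real \<Rightarrow> nat \<Rightarrow> vertex \<Rightarrow> config \<Rightarrow> real" where
  "cluster_weight a 0 x \<eta> = 1"
| "cluster_weight a (Suc n) x \<eta> =
    (if \<eta> x then a * cluster_weight a n (x @ [False]) \<eta> * cluster_weight a n (x @ [True]) \<eta> else 1)"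

lemma finite_cluster [simp]: "finite (cluster \<eta> n x)"
  by (induction n arbitrary: x) auto

lemma cluster_weight_ge_1: "1 \<le> a \<Longrightarrow> 1 \<le> cluster_weight a n x \<eta>"
  by (induction n arbitrary: x) (auto simp: mult_ge1_I)

lemma power_card_cluster_le: "1 \<le> a \<Longrightarrow> a ^ card (cluster \<eta> n x) \<le> cluster_weight a n x \<eta>"
proof (induction n arbitrary: x)
  case (Suc n)
  show ?case
  proof (cases "\<eta> x")
    case True
    let ?c = "\<lambda>b. cluster \<eta> n (x @ [b])"
    have "card (insert x (?c False \<union> ?c True)) \<le> Suc (card (?c False \<union> ?c True))" by (rule card_insert_le_m1) auto
    also have "\<dots> \<le> Suc (card (?c False) + card (?c True))" using card_Un_le by auto
    finally have "a ^ card (insert x (?c False \<union> ?c True)) \<le> a ^ Suc (card (?c False) + card (?c True))"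
      using Suc.prems by (intro power_increasing) auto
    also have "\<dots> = a * a ^ card (?c False) * a ^ card (?c True)" by (simp add: power_add)
    also have "\<dots> \<le> a * cluster_weight a n (x @ [False]) \<eta> * cluster_weight a n (x @ [True]) \<eta>"
      using Suc.IH[OF Suc.prems] Suc.prems order_trans[OF zero_le_one cluster_weight_ge_1[OF Suc.prems]]
      by (intro mult_mono) auto
    finally show ?thesis using True by simp
  qed simp
qed simp

lemma cluster_mono_Suc: "cluster \<eta> n x \<subseteq> cluster \<eta> (Suc n) x"
proof (induction n arbitrary: x)
  case (Suc n)
  from Suc[of "x @ [False]"] Suc[of "x @ [True]"] show ?case by (auto simp del: cluster.simps(2) simp: cluster.simps(2)[of \<eta> _ x])
qed simp

lemma cluster_weight_mono_Suc: "1 \<le> a \<Longrightarrow> cluster_weight a n x \<eta> \<le> cluster_weight a (Suc n) x \<eta>"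
proof (induction n arbitrary: x)
  case 0
  show ?case using cluster_weight_ge_1[OF 0, of "Suc 0"] by simp
next
  case (Suc n)
  show ?case
    using Suc.IH[OF Suc.prems] Suc.prems order_trans[OF zero_le_one cluster_weight_ge_1[OF Suc.prems]]
    by (subst (1 2) cluster_weight.simps(2)) (auto simp del: cluster_weight.simps intro!: mult_mono)
qed

text \<open>An occupied child of a cluster site is found one level deeper; once the truncated
  clusters stop growing, this says that every child left out is vacant.\<close>

lemma cluster_extend: "x \<in> cluster \<eta> n y \<Longrightarrow> \<eta> (x @ [b]) \<Longrightarrow> x @ [b] \<in> cluster \<eta> (Suc n) y"
proof (induction n arbitrary: y)
  case (Suc n)
  then have y: "\<eta> y" and x: "x = y \<or> (\<exists>c. x \<in> cluster \<eta> n (y @ [c]))" by (auto split: if_splits)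
  have "\<exists>c. x @ [b] \<in> cluster \<eta> (Suc n) (y @ [c])"
  proof (cases "x = y")
    case True
    then show ?thesis using Suc.prems(2) by (intro exI[of _ b]) simp
  next
    case False
    then show ?thesis using x Suc.IH Suc.prems(2) by blast
  qed
  then obtain c where "x @ [b] \<in> cluster \<eta> (Suc n) (y @ [c])" by blast
  then show ?case using y by (cases c) (simp_all only: cluster.simps(2)[of _ "Suc n"] if_True, auto)
qed simp

lemma cluster_parent: "x @ [b] \<in> cluster \<eta> n y \<Longrightarrow> x @ [b] = y \<or> x \<in> cluster \<eta> n y"
proof (induction n arbitrary: y)
  case (Suc n)
  then have y: "\<eta> y" and x: "x @ [b] = y \<or> (\<exists>c. x @ [b] \<in> cluster \<eta> n (y @ [c]))" by (auto split: if_splits)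
  show ?case
  proof (cases "x @ [b] = y")
    case False
    then obtain c where "x @ [b] \<in> cluster \<eta> n (y @ [c])" using x by blast
    from Suc.IH[OF this] show ?thesis using y by (cases c) auto
  qed simp
qed simp

section \<open>Exponential moments of cluster sizes\<close>

context bernoulli_parameter begin

lemma depends_on_cluster_weight: "depends_on {x @ z |z. length z < n} (cluster_weight a n x)"
proof (induction n arbitrary: x)
  case (Suc n)
  have sub: "{(x @ [b]) @ z |z. length z < n} \<subseteq> {x @ z |z. length z < Suc n}" for b
  proof
    fix y assume "y \<in> {(x @ [b]) @ z |z. length z < n}"
    then obtain z where "y = x @ ([b] @ z)" "length z < n" by auto
    then show "y \<in> {x @ z |z. length z < Suc n}" by (intro CollectI exI[of _ "[b] @ z"]) simp
  qed
  show ?case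
  proof (rule depends_onI)
    fix \<eta> \<eta>' :: config assume eq: "\<And>y. y \<in> {x @ z |z. length z < Suc n} \<Longrightarrow> \<eta> y = \<eta>' y"
    have "\<eta> x = \<eta>' x" by (rule eq) auto
    moreover have "cluster_weight a n (x @ [b]) \<eta> = cluster_weight a n (x @ [b]) \<eta>'" for b
      by (rule depends_onD[OF Suc]) (use eq sub in blast)
    ultimately show "cluster_weight a (Suc n) x \<eta> = cluster_weight a (Suc n) x \<eta>'" by simp
  qed
qed (simp add: depends_on_def)

lemma finite_cluster_sites: "finite {x @ z |z. length z < (n::nat)} \<and> {x @ z |z. length z < n} \<subseteq> subtree (x :: vertex)"
proof -
  have "finite ((\<lambda>z. x @ z) ` {z. length z < n})" by simp
  moreover have "{x @ z |z. length z < n} = (\<lambda>z. x @ z) ` {z. length z < n}" by auto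
  ultimately show ?thesis by (auto simp: subtree_def)
qed

text \<open>The fixed point inequality \<open>b\<close> is that of the generating function of the total progeny of a
  binary branching process with retention probability \<open>p\<close>.\<close>

lemma integral_mult_cluster_weight_le:
  assumes a: "1 \<le> a" and b: "1 - p + p * a * b\<^sup>2 \<le> b" "1 \<le> b"
    and H: "finite S" "depends_on S H" "\<And>\<eta>. 0 \<le> H \<eta>" "S \<inter> subtree x = {}"
  shows "(\<integral>\<eta>. H \<eta> * cluster_weight a n x \<eta> \<partial>\<mu>) \<le> b * (\<integral>\<eta>. H \<eta> \<partial>\<mu>)"
  using H
\<comment> \<open>The factor \<open>H\<close> is generalised because the weight of one child subtree
  joins it while the other child subtree is integrated out.\<close>
proof (induction n arbitrary: S H x)
  case 0
  have "0 \<le> (\<integral>\<eta>. H \<eta> \<partial>\<mu>)" using 0(3) by simp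
  then show ?case using b(2) by (simp add: mult_le_cancel_right1)
next
  case (Suc n)
  define G where "G c = cluster_weight a n (x @ [c])" for c
  define R where "R c = {(x @ [c]) @ z |z. length z < n}" for c
  have R: "finite (R c)" "R c \<subseteq> subtree (x @ [c])" for c
    unfolding R_def by (rule finite_cluster_sites[THEN conjunct1], rule finite_cluster_sites[THEN conjunct2])
  have sub: "subtree (x @ [c]) \<subseteq> subtree x - {x}" for c by (auto simp: subtree_def)
  have GR: "depends_on (R c) (G c)" for c unfolding G_def R_def by (rule depends_on_cluster_weight)
  have G0: "0 \<le> G c \<eta>" for c \<eta>
    unfolding G_def using cluster_weight_ge_1[OF a] order_trans zero_le_one by blast
  have xS: "x \<notin> S" using Suc.prems(4) unfolding subtree_def by (metis append_Nil2 disjoint_iff rangeI)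
  have updH: "H (\<eta>(x := c)) = H \<eta>" for \<eta> c
    by (rule depends_onD[OF Suc.prems(2)]) (use xS in auto)
  have updG: "G d (\<eta>(x := c)) = G d \<eta>" for \<eta> c d
    by (rule depends_onD[OF GR]) (use R(2)[of d] sub[of d] in auto)
  note upd = updH updG
  let ?F = "\<lambda>\<eta>. H \<eta> * cluster_weight a (Suc n) x \<eta>"
  let ?T = "S \<union> (R False \<union> R True)"
  have T: "finite ?T" using Suc.prems(1) R by simp
  have dH: "depends_on ?T H" by (rule depends_on_mono[OF Suc.prems(2)]) auto
  have dG: "depends_on ?T (G c)" for c by (rule depends_on_mono[OF GR]) (cases c; auto)
  have dF: "depends_on (S \<union> {x @ z |z. length z < Suc n}) ?F"
    by (intro depends_on_map2[where h="(*)"] depends_on_mono[OF Suc.prems(2)] depends_on_mono[OF depends_on_cluster_weight]) auto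
  have "(\<integral>\<eta>. ?F \<eta> \<partial>\<mu>) = (\<integral>\<eta>. site_average p x ?F \<eta> \<partial>\<mu>)"
    using integral_site_average[OF _ dF, of x] Suc.prems(1) finite_cluster_sites by simp
  also have "\<dots> = (\<integral>\<eta>. p * a * (H \<eta> * G False \<eta> * G True \<eta>) + (1 - p) * H \<eta> \<partial>\<mu>)"
    by (rule Bochner_Integration.integral_cong[OF refl]) (simp add: site_average_eq upd G_def[symmetric])
  also have "\<dots> = p * a * (\<integral>\<eta>. H \<eta> * G False \<eta> * G True \<eta> \<partial>\<mu>) + (1 - p) * (\<integral>\<eta>. H \<eta> \<partial>\<mu>)"
    by (subst Bochner_Integration.integral_add)
       (auto intro!: integrable_mult_right integrable_depends_on[OF T] depends_on_map2[where h="(*)"] dH dG)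
  also have "(\<integral>\<eta>. H \<eta> * G False \<eta> * G True \<eta> \<partial>\<mu>) \<le> b * (b * (\<integral>\<eta>. H \<eta> \<partial>\<mu>))"
  proof -
    have "(\<integral>\<eta>. (H \<eta> * G False \<eta>) * cluster_weight a n (x @ [True]) \<eta> \<partial>\<mu>) \<le> b * (\<integral>\<eta>. H \<eta> * G False \<eta> \<partial>\<mu>)"
    proof (rule Suc.IH)
      show "finite (S \<union> R False)" using Suc.prems(1) R by simp
      show "depends_on (S \<union> R False) (\<lambda>\<eta>. H \<eta> * G False \<eta>)"
        by (intro depends_on_map2[where h="(*)"] depends_on_mono[OF Suc.prems(2)] depends_on_mono[OF GR]) auto
      show "0 \<le> H \<eta> * G False \<eta>" for \<eta> using Suc.prems(3) G0 by simp
      have "subtree (x @ [False]) \<inter> subtree (x @ [True]) = {}" by (auto simp: subtree_def)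
      then show "(S \<union> R False) \<inter> subtree (x @ [True]) = {}" using R(2)[of False] sub[of True] Suc.prems(4) by blast
    qed
    also have "(\<integral>\<eta>. H \<eta> * G False \<eta> \<partial>\<mu>) \<le> b * (\<integral>\<eta>. H \<eta> \<partial>\<mu>)"
      unfolding G_def using sub[of False] Suc.prems(4) by (intro Suc.IH[OF Suc.prems(1-3)]) blast
    finally show ?thesis using b(2) by (simp add: G_def)
  qed
  also have "p * a * (b * (b * (\<integral>\<eta>. H \<eta> \<partial>\<mu>))) + (1 - p) * (\<integral>\<eta>. H \<eta> \<partial>\<mu>) = (1 - p + p * a * b\<^sup>2) * (\<integral>\<eta>. H \<eta> \<partial>\<mu>)"
    by (simp add: algebra_simps power2_eq_square)
  also have "\<dots> \<le> b * (\<integral>\<eta>. H \<eta> \<partial>\<mu>)" using b(1) Suc.prems(3) by (intro mult_right_mono) auto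
  finally show ?case using a p_nonneg by (simp add: mult_left_mono)
qed

text \<open>Distinct sites of one generation root disjoint subtrees, so each weight can be
  integrated out with the remaining ones as independent factor.\<close>

lemma integral_prod_cluster_weight_le:
  assumes a: "1 \<le> a" and b: "1 - p + p * a * b\<^sup>2 \<le> b" "1 \<le> b"
    and Y: "finite Y" "\<And>y. y \<in> Y \<Longrightarrow> length y = m"
  shows "(\<integral>\<eta>. (\<Prod>y\<in>Y. cluster_weight a n y \<eta>) \<partial>\<mu>) \<le> b ^ card Y"
  using Y
proof (induction Y rule: finite_induct)
  case (insert x Y)
  let ?S = "\<Union>y\<in>Y. {y @ z |z. length z < n}"
  have "(\<integral>\<eta>. (\<Prod>y\<in>Y. cluster_weight a n y \<eta>) * cluster_weight a n x \<eta> \<partial>\<mu>) \<le> b * (\<integral>\<eta>. (\<Prod>y\<in>Y. cluster_weight a n y \<eta>) \<partial>\<mu>)"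
  proof (rule integral_mult_cluster_weight_le[OF a b])
    show "finite ?S" using insert.hyps finite_cluster_sites by blast
    show "depends_on ?S (\<lambda>\<eta>. \<Prod>y\<in>Y. cluster_weight a n y \<eta>)"
      by (intro depends_on_prod depends_on_mono[OF depends_on_cluster_weight]) auto
    show "0 \<le> (\<Prod>y\<in>Y. cluster_weight a n y \<eta>)" for \<eta>
      using cluster_weight_ge_1[OF a] order_trans[OF zero_le_one] by (intro prod_nonneg) blast
    show "?S \<inter> subtree x = {}" using insert.hyps insert.prems by (auto simp: subtree_def)
  qed
  also have "\<dots> \<le> b * b ^ card Y" using insert b(2) by (intro mult_left_mono) auto
  finally show ?case using insert.hyps by (simp add: mult.commute)
qed simp

text \<open>The enclosure consists of all sites above generation \<open>m\<close> and the clusters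
  of the sites of generation \<open>m\<close>. Exponential moments bounded uniformly in the depth
  make the limiting weight finite almost surely, so the truncated clusters stabilise.\<close>

lemma subcritical_enclosure:
  assumes p: "p < 1 / 2"
  obtains a :: real where "1 < a" "\<And>m. \<exists>Y. integrable \<mu> Y \<and> (\<forall>\<eta>. 0 \<le> Y \<eta>) \<and>
    (AE \<eta> in \<mu>. \<exists>A. finite A \<and> {x. length x < m} \<subseteq> A \<and> prefix_closed A \<and> vacant_boundary A \<eta> \<and> a ^ card A \<le> Y \<eta>)"
proof -
  \<comment> \<open>For \<open>a = 1\<close> this \<open>b\<close> satisfies the fixed point
    inequality with slack exactly \<open>s\<close>. Since \<open>p * b\<^sup>2 \<le> 4\<close>,
    raising \<open>a\<close> by \<open>s / 4\<close> uses up at most this slack.\<close>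
  define b where "b = 2 - 2 * p"
  define s where "s = (1 - 2 * p)\<^sup>2 * (1 - p)"
  define a where "a = 1 + s / 4"
  have s: "0 < s" using p p_le_1 by (simp add: s_def)
  then have a: "1 < a" "1 \<le> a" by (auto simp: a_def)
  have b1: "1 \<le> b" using p by (simp add: b_def)
  have "p * (1 - p)\<^sup>2 \<le> 1 * 1" using p_nonneg p_le_1 by (intro mult_mono) (auto simp: power_le_one)
  then have "p * b\<^sup>2 \<le> 4" by (simp add: b_def power2_eq_square algebra_simps)
  then have "s / 4 * (p * b\<^sup>2) \<le> s / 4 * 4" using s by (intro mult_left_mono) auto
  moreover have "1 - p + p * b\<^sup>2 + s = b" by (simp add: b_def s_def power2_eq_square algebra_simps)
  ultimately have b: "1 - p + p * a * b\<^sup>2 \<le> b" by (simp add: a_def algebra_simps)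
  show ?thesis
  proof (rule that[OF a(1)])
    fix m :: nat
    let ?L = "{x :: vertex. length x = m}" and ?B = "{x :: vertex. length x < m}"
    have fin: "finite ?L" and finB: "finite ?B" by simp_all
    define G where "G n \<eta> = (\<Prod>y\<in>?L. cluster_weight a n y \<eta>)" for n \<eta>
    have G1: "1 \<le> G n \<eta>" for n \<eta> unfolding G_def using cluster_weight_ge_1[OF a(2)] by (intro prod_ge_1) auto
    have G0: "0 \<le> G n \<eta>" for n \<eta> using G1[of n \<eta>] by linarith
    have Gmono: "G n \<eta> \<le> G (Suc n) \<eta>" for n \<eta> unfolding G_def
      using cluster_weight_mono_Suc[OF a(2)] cluster_weight_ge_1[OF a(2)] order_trans[OF zero_le_one]
      by (intro prod_mono) blast
    have Gd: "depends_on (\<Union>y\<in>?L. {y @ z |z. length z < n}) (G n)" for n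
      unfolding G_def by (intro depends_on_prod depends_on_mono[OF depends_on_cluster_weight]) auto
    have Gf: "finite (\<Union>y\<in>?L. {y @ z |z. length z < n})" for n using fin finite_cluster_sites by blast
    have Gm [measurable]: "G n \<in> borel_measurable config_space" for n by (rule measurable_depends_on[OF Gf Gd])
    define Z where "Z \<eta> = (SUP n. ennreal (G n \<eta>))" for \<eta>
    have "(\<integral>\<^sup>+\<eta>. Z \<eta> \<partial>\<mu>) = (SUP n. \<integral>\<^sup>+\<eta>. ennreal (G n \<eta>) \<partial>\<mu>)"
      unfolding Z_def by (rule nn_integral_monotone_convergence_SUP)
        (auto intro!: incseq_SucI le_funI ennreal_leI Gmono)
    also have "\<dots> \<le> ennreal (b ^ card ?L)"
    proof (rule SUP_least)
      fix n
      have "(\<integral>\<^sup>+\<eta>. ennreal (G n \<eta>) \<partial>\<mu>) = ennreal (\<integral>\<eta>. G n \<eta> \<partial>\<mu>)"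
        using G0 by (intro nn_integral_eq_integral integrable_depends_on[OF Gf Gd]) auto
      also have "\<dots> \<le> ennreal (b ^ card ?L)"
        unfolding G_def using integral_prod_cluster_weight_le[OF a(2) b b1 fin] by (intro ennreal_leI) auto
      finally show "(\<integral>\<^sup>+\<eta>. ennreal (G n \<eta>) \<partial>\<mu>) \<le> ennreal (b ^ card ?L)" .
    qed
    finally have Zint: "(\<integral>\<^sup>+\<eta>. Z \<eta> \<partial>\<mu>) < \<infinity>" by (simp add: order_le_less_trans)
    have Zm [measurable]: "Z \<in> borel_measurable config_space" unfolding Z_def by measurable
    have ZAE: "AE \<eta> in \<mu>. Z \<eta> \<noteq> \<infinity>" by (rule nn_integral_noteq_infinite) (use Zint in auto)
    \<comment> \<open>\<open>enn2real\<close> sends infinity to 0, so \<open>Y\<close> bounds the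
      cluster weights only where \<open>Z\<close> is finite, which is almost everywhere.\<close>
    define Y where "Y \<eta> = a ^ card ?B * enn2real (Z \<eta>)" for \<eta>
    have "integrable \<mu> (\<lambda>\<eta>. enn2real (Z \<eta>))"
    proof (rule integrableI_nonneg)
      have "(\<integral>\<^sup>+\<eta>. ennreal (enn2real (Z \<eta>)) \<partial>\<mu>) \<le> (\<integral>\<^sup>+\<eta>. Z \<eta> \<partial>\<mu>)"
        by (intro nn_integral_mono) (simp add: ennreal_enn2real_if)
      then show "(\<integral>\<^sup>+\<eta>. ennreal (enn2real (Z \<eta>)) \<partial>\<mu>) < \<infinity>" using Zint by (rule order_le_less_trans)
    qed auto
    then have "integrable \<mu> Y" unfolding Y_def by simp
    moreover have "\<forall>\<eta>. 0 \<le> Y \<eta>" using a by (simp add: Y_def)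
    moreover have "AE \<eta> in \<mu>. \<exists>A. finite A \<and> ?B \<subseteq> A \<and> prefix_closed A \<and> vacant_boundary A \<eta> \<and> a ^ card A \<le> Y \<eta>"
      using ZAE
    proof eventually_elim
      case (elim \<eta>)
      define A where "A n = ?B \<union> (\<Union>y\<in>?L. cluster \<eta> n y)" for n
      have finA: "finite (A n)" for n using fin finB by (simp add: A_def)
      have AY: "a ^ card (A n) \<le> Y \<eta>" for n
      proof -
        have "card (A n) \<le> card ?B + (\<Sum>y\<in>?L. card (cluster \<eta> n y))"
          unfolding A_def by (rule order_trans[OF card_Un_le add_left_mono[OF card_UN_le[OF fin]]])
        then have "a ^ card (A n) \<le> a ^ (card ?B + (\<Sum>y\<in>?L. card (cluster \<eta> n y)))"
          using a by (intro power_increasing) auto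
        also have "\<dots> = a ^ card ?B * (\<Prod>y\<in>?L. a ^ card (cluster \<eta> n y))" by (simp add: power_add power_sum)
        also have "\<dots> \<le> a ^ card ?B * G n \<eta>"
          unfolding G_def using a power_card_cluster_le[OF a(2)] by (intro mult_left_mono prod_mono) auto
        also have "G n \<eta> \<le> enn2real (Z \<eta>)"
        proof -
          have "ennreal (G n \<eta>) \<le> Z \<eta>" unfolding Z_def by (rule SUP_upper) simp
          from enn2real_mono[OF this] elim show ?thesis using G0 by (simp add: top.not_eq_extremum)
        qed
        finally show ?thesis using a by (simp add: Y_def)
      qed
      have mono: "A n \<subseteq> A (Suc n)" for n unfolding A_def using cluster_mono_Suc by blast
      \<comment> \<open>Growth at every step would make the cardinalities unbounded, against the
        fixed bound \<open>Y \<eta>\<close> on \<open>a ^ card (A n)\<close>.\<close>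
      have "\<exists>n. A (Suc n) = A n"
      proof (rule ccontr)
        assume "\<not> ?thesis"
        then have "A n \<subset> A (Suc n)" for n using mono[of n] by auto
        then have step: "card (A n) < card (A (Suc n))" for n by (intro psubset_card_mono finA)
        have ge: "n \<le> card (A n)" for n
        proof (induction n)
          case (Suc n)
          then show ?case using step[of n] by linarith
        qed simp
        obtain n where "Y \<eta> < a ^ n" using real_arch_pow[OF a(1)] by blast
        also have "\<dots> \<le> a ^ card (A n)" using a ge by (intro power_increasing) auto
        finally show False using AY[of n] by simp
      qed
      then obtain n where n: "A (Suc n) = A n" by blast
      have "prefix_closed (A n)"
        unfolding prefix_closed_def
      proof (intro allI impI)
        fix x b assume "x @ [b] \<in> A n"
        then consider "length (x @ [b]) < m" | y where "length y = m" "x @ [b] \<in> cluster \<eta> n y" by (auto simp: A_def)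
        then show "x \<in> A n"
        proof cases
          case 2
          from cluster_parent[OF 2(2)] show ?thesis
          proof
            assume "x @ [b] = y"
            then show ?thesis using 2(1) by (auto simp: A_def)
          qed (use 2(1) in \<open>auto simp: A_def\<close>)
        qed (auto simp: A_def)
      qed
      moreover have "vacant_boundary (A n) \<eta>"
        unfolding vacant_boundary_def
      proof (intro ballI allI)
        fix x b assume x: "x \<in> A n"
        \<comment> \<open>An occupied child stays above generation \<open>m\<close>, starts its own
          cluster there, or extends an existing cluster by one level.\<close>
        have "x @ [b] \<in> A (Suc n)" if "\<eta> (x @ [b])"
        proof (cases "length x < m")
          case True
          show ?thesis
          proof (cases "Suc (length x) < m")
            case False
            then have "length (x @ [b]) = m" using True by simp
            moreover have "x @ [b] \<in> cluster \<eta> (Suc n) (x @ [b])" using that by simp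
            ultimately show ?thesis unfolding A_def by blast
          qed (simp add: A_def)
        next
          case False
          then obtain y where "y \<in> ?L" "x \<in> cluster \<eta> n y" using x by (auto simp: A_def)
          then show ?thesis using cluster_extend[of x \<eta> n y b] that unfolding A_def by blast
        qed
        then show "x @ [b] \<in> A n \<or> \<not> \<eta> (x @ [b])" using n by auto
      qed
      ultimately show ?case using finA[of n] AY[of n] by (intro exI[of _ "A n"]) (auto simp: A_def)
    qed
    ultimately show "\<exists>Y. integrable \<mu> Y \<and> (\<forall>\<eta>. 0 \<le> Y \<eta>) \<and>
      (AE \<eta> in \<mu>. \<exists>A. finite A \<and> ?B \<subseteq> A \<and> prefix_closed A \<and> vacant_boundary A \<eta> \<and> a ^ card A \<le> Y \<eta>)" by blast
  qed
qed

end

section \<open>The threshold is at most one half\<close>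

definition path_open :: "vertex \<Rightarrow> config \<Rightarrow> real" where
  "path_open x \<eta> = (if \<forall>k\<le>length x. \<eta> (take k x) then 1 else 0)"

lemma path_open_snoc: "path_open (x @ [b]) \<eta> = path_open x \<eta> * of_bool (\<eta> (x @ [b]))"
proof -
  have iff: "(\<forall>k\<le>length (x @ [b]). \<eta> (take k (x @ [b]))) \<longleftrightarrow> (\<forall>k\<le>length x. \<eta> (take k x)) \<and> \<eta> (x @ [b])"
  proof (intro iffI conjI allI impI)
    fix k assume *: "\<forall>k\<le>length (x @ [b]). \<eta> (take k (x @ [b]))" and "k \<le> length x"
    then show "\<eta> (take k x)" using *[rule_format, of k] by simp
  next
    assume "\<forall>k\<le>length (x @ [b]). \<eta> (take k (x @ [b]))"
    from this[rule_format, of "length (x @ [b])"] show "\<eta> (x @ [b])" by simp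
  next
    fix k assume *: "(\<forall>k\<le>length x. \<eta> (take k x)) \<and> \<eta> (x @ [b])" and "k \<le> length (x @ [b])"
    then show "\<eta> (take k (x @ [b]))" by (cases "k \<le> length x") (auto simp: not_le)
  qed
  have gen: "(A \<longleftrightarrow> B \<and> C) \<Longrightarrow> (if A then 1 else 0 :: real) = (if B then 1 else 0) * of_bool C" for A B C
    by auto
  show ?thesis unfolding path_open_def by (rule gen[OF iff])
qed

lemma depends_on_path_open: "depends_on {take k x |k. True} (path_open x)"
  unfolding path_open_def depends_on_def by auto

lemma depends_on_path_open': "length x \<le> n \<Longrightarrow> depends_on {y. length y \<le> n} (path_open x)"
  by (rule depends_on_mono[OF depends_on_path_open]) auto

lemma path_open_bounds [simp]: "0 \<le> path_open x \<eta>" "path_open x \<eta> \<le> 1"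
  by (auto simp: path_open_def)

lemma path_open_square: "(path_open x \<eta>)\<^sup>2 = path_open x \<eta>"
  by (simp add: path_open_def)

lemma sum_generation_Suc:
  "(\<Sum>y\<in>{y :: vertex. length y = Suc n}. h y) = (\<Sum>x\<in>{x. length x = n}. h (x @ [False]) + h (x @ [True]) :: real)"
proof -
  have inj: "inj_on (\<lambda>(x, b). x @ [b]) ({x. length x = n} \<times> (UNIV :: bool set))" by (auto simp: inj_on_def)
  have "{y :: vertex. length y = Suc n} = (\<lambda>(x, b). x @ [b]) ` ({x. length x = n} \<times> UNIV)"
  proof (intro equalityI subsetI)
    fix y :: vertex assume "y \<in> {y. length y = Suc n}"
    then have "y = (\<lambda>(x, b). x @ [b]) (butlast y, last y)" "length (butlast y) = n"
      by (auto simp: append_butlast_last_id intro!: append_butlast_last_id[symmetric])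
    then show "y \<in> (\<lambda>(x, b). x @ [b]) ` ({x. length x = n} \<times> UNIV)" by blast
  qed auto
  then have "(\<Sum>y\<in>{y :: vertex. length y = Suc n}. h y) = (\<Sum>z\<in>{x. length x = n} \<times> UNIV. h ((\<lambda>(x, b). x @ [b]) z))"
    by (simp only: sum.reindex[OF inj] comp_def)
  also have "\<dots> = (\<Sum>x\<in>{x. length x = n}. \<Sum>b\<in>UNIV. h (x @ [b]))"
    by (simp add: sum.cartesian_product case_prod_unfold)
  finally show ?thesis by (simp add: UNIV_bool)
qed

text \<open>With \<open>\<rho> = sqrt r\<close> the increments satisfy
  \<open>u \<le> u\<^sup>2 / \<rho> ^ n + \<rho> ^ n\<close>, so their L^1 norms are summable and
  the sequence converges almost surely. Fatou's lemma then shows that the pointwise limit is also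
  the L^2 limit.\<close>

lemma (in prob_space) L2_geometric_limit:
  fixes X :: "nat \<Rightarrow> 'a \<Rightarrow> real"
  assumes X [measurable]: "\<And>n. X n \<in> borel_measurable M" and int: "\<And>n m. integrable M (\<lambda>x. (X n x - X m x)\<^sup>2)"
    and r: "0 < r" "r < 1"
    and dist: "\<And>n m. n \<le> m \<Longrightarrow> (\<integral>x. (X n x - X m x)\<^sup>2 \<partial>M) \<le> C * r ^ n"
  obtains W where "W \<in> borel_measurable M" "\<And>n. integrable M (\<lambda>x. (X n x - W x)\<^sup>2)"
    "(\<lambda>n. \<integral>x. (X n x - W x)\<^sup>2 \<partial>M) \<longlonglongrightarrow> 0"
proof -
  define \<rho> where "\<rho> = sqrt r"
  have \<rho>: "0 < \<rho>" "\<rho> < 1" "\<rho> * \<rho> = r" using r by (auto simp: \<rho>_def real_sqrt_lt_1_iff)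
  define u where "u n x = \<bar>X (Suc n) x - X n x\<bar>" for n x
  have u2: "(\<integral>x. (u n x)\<^sup>2 \<partial>M) \<le> C * r ^ n" "integrable M (\<lambda>x. (u n x)\<^sup>2)" for n
    using dist[of n "Suc n"] int[of "Suc n" n] by (auto simp: u_def power2_commute)
  have C: "0 \<le> C"
  proof -
    have "0 \<le> (\<integral>x. (u 0 x)\<^sup>2 \<partial>M)" by simp
    also have "\<dots> \<le> C" using u2(1)[of 0] by simp
    finally show ?thesis .
  qed
  have um [measurable]: "u n \<in> borel_measurable M" for n unfolding u_def by measurable
  have amgm: "u n x \<le> (u n x)\<^sup>2 / \<rho> ^ n + \<rho> ^ n" for n x
  proof (cases "u n x \<le> \<rho> ^ n")
    case True
    then show ?thesis using \<rho> by (intro order_trans[OF True]) simp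
  next
    case False
    then have "u n x * \<rho> ^ n \<le> u n x * u n x" using \<rho> by (intro mult_left_mono) (auto simp: u_def)
    then have "u n x \<le> (u n x)\<^sup>2 / \<rho> ^ n" using \<rho> by (simp add: pos_le_divide_eq power2_eq_square)
    then show ?thesis using \<rho> by (smt (verit) zero_le_power)
  qed
  have nn: "(\<integral>\<^sup>+x. ennreal (u n x) \<partial>M) \<le> ennreal ((C + 1) * \<rho> ^ n)" for n
  proof -
    have i: "integrable M (\<lambda>x. (u n x)\<^sup>2 / \<rho> ^ n + \<rho> ^ n)" using u2(2) by simp
    have "(\<integral>\<^sup>+x. ennreal (u n x) \<partial>M) \<le> (\<integral>\<^sup>+x. ennreal ((u n x)\<^sup>2 / \<rho> ^ n + \<rho> ^ n) \<partial>M)"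
      by (intro nn_integral_mono ennreal_leI amgm)
    also have "\<dots> = ennreal (\<integral>x. (u n x)\<^sup>2 / \<rho> ^ n + \<rho> ^ n \<partial>M)"
      using \<rho> by (intro nn_integral_eq_integral i) auto
    also have "(\<integral>x. (u n x)\<^sup>2 / \<rho> ^ n + \<rho> ^ n \<partial>M) = (\<integral>x. (u n x)\<^sup>2 \<partial>M) / \<rho> ^ n + \<rho> ^ n"
      using u2(2) prob_space by simp
    also have "\<dots> \<le> C * r ^ n / \<rho> ^ n + \<rho> ^ n" using u2(1) \<rho> by (intro add_right_mono divide_right_mono) auto
    also have "C * r ^ n / \<rho> ^ n + \<rho> ^ n = (C + 1) * \<rho> ^ n"
      using \<rho>(1) unfolding \<rho>(3)[symmetric] by (simp add: power_mult_distrib algebra_simps)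
    finally show ?thesis by (simp add: ennreal_leI)
  qed
  have "(\<integral>\<^sup>+x. (\<Sum>n. ennreal (u n x)) \<partial>M) = (\<Sum>n. \<integral>\<^sup>+x. ennreal (u n x) \<partial>M)"
    by (rule nn_integral_suminf) measurable
  also have "\<dots> \<le> (\<Sum>n. ennreal ((C + 1) * \<rho> ^ n))" by (intro suminf_le nn) auto
  also have "\<dots> < \<infinity>"
    using \<rho> C summable_mult[OF summable_geometric[of \<rho>], of "C + 1"] by (subst suminf_ennreal2) auto
  finally have "(\<integral>\<^sup>+x. (\<Sum>n. ennreal (u n x)) \<partial>M) \<noteq> \<infinity>" by simp
  then have "AE x in M. (\<Sum>n. ennreal (u n x)) \<noteq> \<infinity>" by (intro nn_integral_noteq_infinite) auto
  then have conv: "AE x in M. convergent (\<lambda>n. X n x)"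
  proof eventually_elim
    case (elim x)
    then have "summable (\<lambda>n. norm (X (Suc n) x - X n x))"
      using summable_suminf_not_top[of "\<lambda>n. u n x"] by (simp add: u_def)
    then have "summable (\<lambda>n. X (Suc n) x - X n x)" by (rule summable_norm_cancel)
    then have "convergent (\<lambda>n. \<Sum>k<n. X (Suc k) x - X k x)" by (simp add: summable_iff_convergent)
    then have "convergent (\<lambda>n. X n x - X 0 x)" by (simp only: sum_lessThan_telescope[of "\<lambda>k. X k x"])
    then show "convergent (\<lambda>n. X n x)" by (simp add: convergent_diff_const_right_iff)
  qed
  \<comment> \<open>Where the sequence diverges \<open>lim\<close> is an unspecified value, but only
    on a null set.\<close>
  define W where "W x = lim (\<lambda>n. X n x)" for x
  have W [measurable]: "W \<in> borel_measurable M" unfolding W_def by measurable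
  have bound: "(\<integral>\<^sup>+x. ennreal ((X n x - W x)\<^sup>2) \<partial>M) \<le> ennreal (C * r ^ n)" for n
  proof -
    have "(\<integral>\<^sup>+x. ennreal ((X n x - W x)\<^sup>2) \<partial>M) = (\<integral>\<^sup>+x. liminf (\<lambda>m. ennreal ((X n x - X m x)\<^sup>2)) \<partial>M)"
    proof (rule nn_integral_cong_AE, use conv in eventually_elim)
      case (elim x)
      then have "(\<lambda>m. X m x) \<longlonglongrightarrow> W x" by (simp add: W_def convergent_LIMSEQ_iff)
      then have "(\<lambda>m. ennreal ((X n x - X m x)\<^sup>2)) \<longlonglongrightarrow> ennreal ((X n x - W x)\<^sup>2)"
        by (intro tendsto_ennrealI tendsto_intros)
      from lim_imp_Liminf[OF sequentially_bot this] show ?case by simp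
    qed
    also have "\<dots> \<le> liminf (\<lambda>m. \<integral>\<^sup>+x. ennreal ((X n x - X m x)\<^sup>2) \<partial>M)"
      by (rule nn_integral_liminf) measurable
    also have "\<dots> \<le> ennreal (C * r ^ n)"
    proof (rule Liminf_le)
      show "\<forall>\<^sub>F m in sequentially. (\<integral>\<^sup>+x. ennreal ((X n x - X m x)\<^sup>2) \<partial>M) \<le> ennreal (C * r ^ n)"
        using eventually_ge_at_top[of n]
        by eventually_elim (simp add: nn_integral_eq_integral int dist ennreal_leI)
    qed simp
    finally show ?thesis .
  qed
  have iW: "integrable M (\<lambda>x. (X n x - W x)\<^sup>2)" for n
    by (rule integrableI_nonneg) (use bound[of n] in \<open>auto intro: order_le_less_trans\<close>)
  have le: "(\<integral>x. (X n x - W x)\<^sup>2 \<partial>M) \<le> C * r ^ n" for n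
  proof -
    have "ennreal (\<integral>x. (X n x - W x)\<^sup>2 \<partial>M) \<le> ennreal (C * r ^ n)"
      using bound[of n] by (simp add: nn_integral_eq_integral iW)
    then show ?thesis using C r by (simp add: ennreal_le_iff)
  qed
  have "(\<lambda>n. C * r ^ n) \<longlonglongrightarrow> 0" using r by (intro tendsto_mult_right_zero LIMSEQ_power_zero) simp
  then have "(\<lambda>n. \<integral>x. (X n x - W x)\<^sup>2 \<partial>M) \<longlonglongrightarrow> 0"
    by (rule tendsto_sandwich[OF _ _ tendsto_const, rotated 2]) (auto intro!: always_eventually le)
  with W iW show ?thesis by (rule that)
qed

section \<open>The martingale of open paths and its limit in the kernel\<close>

context bernoulli_parameter begin

lemma integral_mult_coordinate:
  assumes H: "finite S" "depends_on S H" "y \<notin> S"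
  shows "(\<integral>\<eta>. H \<eta> * h (\<eta> y) \<partial>\<mu>) = (p * h True + (1 - p) * h False) * (\<integral>\<eta>. H \<eta> \<partial>\<mu>)"
proof -
  have d: "depends_on (insert y S) (\<lambda>\<eta>. H \<eta> * h (\<eta> y))"
    by (intro depends_on_map2[where h="(*)"] depends_on_mono[OF H(2)] depends_on_coordinate) auto
  have upd: "H (\<eta>(y := b)) = H \<eta>" for \<eta> b by (rule depends_onD[OF H(2)]) (use H(3) in auto)
  have "(\<integral>\<eta>. H \<eta> * h (\<eta> y) \<partial>\<mu>) = (\<integral>\<eta>. site_average p y (\<lambda>\<eta>. H \<eta> * h (\<eta> y)) \<eta> \<partial>\<mu>)"
    using integral_site_average[OF _ d] H(1) by simp
  also have "\<dots> = (\<integral>\<eta>. (p * h True + (1 - p) * h False) * H \<eta> \<partial>\<mu>)"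
    by (simp add: site_average_eq upd algebra_simps)
  finally show ?thesis by simp
qed

lemma integral_path_open: "(\<integral>\<eta>. path_open x \<eta> \<partial>\<mu>) = p ^ Suc (length x)"
proof (induction x rule: rev_induct)
  case Nil
  have "path_open [] \<eta> = 1 * of_bool (\<eta> [])" for \<eta> by (simp add: path_open_def)
  then have "(\<integral>\<eta>. path_open [] \<eta> \<partial>\<mu>) = (\<integral>\<eta>. 1 * of_bool (\<eta> []) \<partial>\<mu>)" by simp
  also have "\<dots> = p" by (subst integral_mult_coordinate[of "{}"]) auto
  finally show ?case by simp
next
  case (snoc b x)
  have "(\<integral>\<eta>. path_open (x @ [b]) \<eta> \<partial>\<mu>) = (\<integral>\<eta>. path_open x \<eta> * of_bool (\<eta> (x @ [b])) \<partial>\<mu>)"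
    by (simp add: path_open_snoc)
  also have "\<dots> = p * (\<integral>\<eta>. path_open x \<eta> \<partial>\<mu>)"
    by (subst integral_mult_coordinate[OF finite_vertex_ball depends_on_path_open'[OF order_refl]]) auto
  finally show ?case using snoc by simp
qed

text \<open>For a nonroot \<open>y\<close> this is
  \<open>path_open y \<eta> - p * path_open (butlast y) \<eta>\<close>, the contribution of
  \<open>y\<close> to the martingale increment; it has mean zero given all other sites.\<close>

definition path_increment :: "vertex \<Rightarrow> config \<Rightarrow> real" where
  "path_increment y \<eta> = path_open (butlast y) \<eta> * (of_bool (\<eta> y) - p)"

lemma depends_on_path_increment: "length y \<le> n \<Longrightarrow> depends_on {x. length x \<le> n} (path_increment y)"
  unfolding path_increment_def
  by (intro depends_on_map2[where h="(*)"] depends_on_path_open' depends_on_coordinate) auto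

lemma integral_mult_path_increment:
  assumes "finite S" "depends_on S H" "y \<notin> S" "length y = Suc n"
  shows "(\<integral>\<eta>. H \<eta> * path_increment y \<eta> \<partial>\<mu>) = 0"
proof -
  have d: "depends_on (S \<union> {x. length x \<le> n}) (\<lambda>\<eta>. H \<eta> * path_open (butlast y) \<eta>)"
    using assms(4) by (intro depends_on_map2[where h="(*)"] depends_on_mono[OF assms(2)]
        depends_on_mono[OF depends_on_path_open'[where n=n]]) auto
  have "(\<integral>\<eta>. (H \<eta> * path_open (butlast y) \<eta>) * (of_bool (\<eta> y) - p) \<partial>\<mu>) = 0"
    by (subst integral_mult_coordinate[OF _ d]) (use assms finite_vertex_ball in \<open>auto simp: algebra_simps\<close>)
  then show ?thesis by (simp add: path_increment_def mult.assoc)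
qed

text \<open>Increments at distinct sites of one generation are orthogonal.\<close>

lemma integral_square_increments_le:
  assumes h: "\<And>y. length y = Suc n \<Longrightarrow> depends_on S (h y)" "finite S" "\<And>y. y \<in> S \<Longrightarrow> length y \<noteq> Suc n"
    and h01: "\<And>y \<eta>. 0 \<le> h y \<eta>" "\<And>y \<eta>. h y \<eta> \<le> 1"
  shows "(\<integral>\<eta>. (\<Sum>y\<in>{y. length y = Suc n}. h y \<eta> * path_increment y \<eta>)\<^sup>2 \<partial>\<mu>) \<le> (2 * p) ^ Suc n"
proof -
  \<comment> \<open>The coefficients \<open>h\<close> will be the constant 1 for the martingale and,
    for its generator, the update rates, which read generation \<open>n + 2\<close>.\<close>
  let ?L = "{y :: vertex. length y = Suc n}" and ?T = "S \<union> {x. length x \<le> Suc n}"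
  define e where "e y z \<eta> = (h y \<eta> * path_increment y \<eta>) * (h z \<eta> * path_increment z \<eta>)" for y z \<eta>
  have T: "finite ?T" using h(2) finite_vertex_ball by simp
  have dh: "depends_on ?T (h y)" "depends_on ?T (path_increment y)" if "y \<in> ?L" for y
    using that by (auto intro: depends_on_mono[OF h(1)] depends_on_mono[OF depends_on_path_increment[OF order_refl]])
  have de: "depends_on ?T (e y z)" if "y \<in> ?L" "z \<in> ?L" for y z
    unfolding e_def using that by (intro depends_on_map2[where h="(*)"] dh)
  have "(\<integral>\<eta>. (\<Sum>y\<in>?L. h y \<eta> * path_increment y \<eta>)\<^sup>2 \<partial>\<mu>) = (\<integral>\<eta>. (\<Sum>y\<in>?L. \<Sum>z\<in>?L. e y z \<eta>) \<partial>\<mu>)"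
    by (simp add: power2_eq_square sum_product e_def)
  also have "\<dots> = (\<Sum>y\<in>?L. \<Sum>z\<in>?L. \<integral>\<eta>. e y z \<eta> \<partial>\<mu>)"
    by (subst Bochner_Integration.integral_sum, intro integrable_depends_on[OF T] depends_on_sum de, assumption+,
        intro sum.cong refl Bochner_Integration.integral_sum integrable_depends_on[OF T] de)
  also have "\<dots> \<le> (\<Sum>y\<in>?L. \<Sum>z\<in>?L. if z = y then p ^ Suc n else 0)"
  proof (intro sum_mono)
    fix y z assume yz: "y \<in> ?L" "z \<in> ?L"
    show "(\<integral>\<eta>. e y z \<eta> \<partial>\<mu>) \<le> (if z = y then p ^ Suc n else 0)"
    proof (cases "z = y")
      case True
      have "e y y \<eta> \<le> path_open (butlast y) \<eta>" for \<eta>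
      proof -
        have "(of_bool (\<eta> y) - p)\<^sup>2 \<le> (1::real)" using p_nonneg p_le_1 by (auto simp: abs_square_le_1)
        then have "(h y \<eta>)\<^sup>2 * (of_bool (\<eta> y) - p)\<^sup>2 \<le> 1 * 1"
          using h01 by (intro mult_mono) (auto simp: power_le_one)
        then have "path_open (butlast y) \<eta> * ((h y \<eta>)\<^sup>2 * (of_bool (\<eta> y) - p)\<^sup>2) \<le> path_open (butlast y) \<eta> * 1"
          by (intro mult_left_mono) auto
        moreover have "e y y \<eta> = (path_open (butlast y) \<eta>)\<^sup>2 * ((h y \<eta>)\<^sup>2 * (of_bool (\<eta> y) - p)\<^sup>2)"
          by (simp add: e_def path_increment_def power2_eq_square mult_ac)
        ultimately show ?thesis by (simp add: path_open_square)
      qed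
      then have "(\<integral>\<eta>. e y y \<eta> \<partial>\<mu>) \<le> (\<integral>\<eta>. path_open (butlast y) \<eta> \<partial>\<mu>)"
        by (intro integral_mono integrable_depends_on[OF T de] yz
            integrable_depends_on[OF finite_vertex_ball depends_on_path_open'[OF order_refl]]) auto
      then show ?thesis using True yz by (simp add: integral_path_open)
    next
      case False
      let ?S = "S \<union> ({x. length x \<le> n} \<union> {y})"
      have "depends_on ?S (path_increment y)"
        unfolding path_increment_def using yz
        by (intro depends_on_map2[where h="(*)"] depends_on_mono[OF depends_on_path_open'[where n=n]] depends_on_coordinate) auto
      then have "depends_on ?S (\<lambda>\<eta>. (h y \<eta> * path_increment y \<eta>) * h z \<eta>)"
        using yz by (intro depends_on_map2[where h="(*)"]) (auto intro: depends_on_mono[OF h(1)])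
      from integral_mult_path_increment[OF _ this, of z n]
      have "(\<integral>\<eta>. (h y \<eta> * path_increment y \<eta>) * h z \<eta> * path_increment z \<eta> \<partial>\<mu>) = 0"
        using False yz h(2,3) finite_vertex_ball by auto
      then show ?thesis using False by (simp add: e_def mult.assoc)
    qed
  qed
  also have "\<dots> = (2 * p) ^ Suc n"
    using finite_generation card_generation[of "Suc n"] by (simp add: power_mult_distrib)
  finally show ?thesis .
qed

text \<open>The size of generation \<open>n\<close> in the branching process of sites joined to the
  root by occupied paths, normalised by its growth \<open>(2 * p) ^ n\<close>.\<close>

definition path_martingale :: "nat \<Rightarrow> config \<Rightarrow> real" where
  "path_martingale n \<eta> = (\<Sum>x\<in>{x. length x = n}. path_open x \<eta>) / (2 * p) ^ n"

lemma depends_on_path_martingale: "depends_on {x. length x \<le> n} (path_martingale n)"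
  unfolding path_martingale_def
  by (intro depends_on_map[where h="\<lambda>r. r / _"] depends_on_sum depends_on_path_open') auto

lemma path_martingale_increment:
  assumes "0 < p"
  shows "path_martingale (Suc n) \<eta> - path_martingale n \<eta> =
    (\<Sum>y\<in>{y. length y = Suc n}. 1 * path_increment y \<eta>) / (2 * p) ^ Suc n"
proof -
  have "(\<Sum>y\<in>{y. length y = Suc n}. path_increment y \<eta>) =
      (\<Sum>y\<in>{y. length y = Suc n}. path_open y \<eta>) - 2 * p * (\<Sum>x\<in>{x. length x = n}. path_open x \<eta>)"
    unfolding sum_generation_Suc sum_distrib_left sum_subtractf[symmetric]
    by (intro sum.cong refl) (simp add: path_increment_def path_open_snoc algebra_simps)
  then show ?thesis using assms by (simp add: path_martingale_def field_simps)
qed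

text \<open>Increments of different generations are orthogonal. The unnormalised increment into
  generation \<open>k + 1\<close> has second moment at most \<open>(2 * p) ^ Suc k\<close>, and the
  normalisation divides by the square of that power.\<close>

lemma path_martingale_L2_dist:
  assumes p: "1 / 2 < p" and "n \<le> m"
  shows "(\<integral>\<eta>. (path_martingale n \<eta> - path_martingale m \<eta>)\<^sup>2 \<partial>\<mu>) \<le> (\<Sum>k\<in>{n..<m}. (1 / (2 * p)) ^ Suc k)"
  using \<open>n \<le> m\<close>
proof (induction m rule: dec_induct)
  case (step m)
  let ?X = path_martingale and ?S = "\<lambda>m. {x :: vertex. length x \<le> m}"
  define I where "I \<eta> = (\<Sum>y\<in>{y. length y = Suc m}. 1 * path_increment y \<eta>)" for \<eta>
  define q where "q = (2 * p) ^ Suc m"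
  have q: "0 < q" using p by (simp add: q_def)
  have p0: "0 < p" using p by simp
  define H where "H \<eta> = ?X n \<eta> - ?X m \<eta>" for \<eta>
  have dH: "depends_on (?S m) H"
    unfolding H_def using step.hyps
    by (intro depends_on_map2[where h="(-)"] depends_on_mono[OF depends_on_path_martingale]) auto
  have dI: "depends_on (?S (Suc m)) (\<lambda>\<eta>. 1 * path_increment y \<eta>)" if "length y = Suc m" for y
    using that by (intro depends_on_map[where h="\<lambda>r. 1 * r"] depends_on_path_increment) simp
  have HI: "(\<integral>\<eta>. H \<eta> * I \<eta> \<partial>\<mu>) = 0"
  proof -
    have "(\<integral>\<eta>. H \<eta> * I \<eta> \<partial>\<mu>) = (\<integral>\<eta>. (\<Sum>y\<in>{y. length y = Suc m}. H \<eta> * path_increment y \<eta>) \<partial>\<mu>)"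
      by (simp add: I_def sum_distrib_left)
    also have "\<dots> = (\<Sum>y\<in>{y. length y = Suc m}. \<integral>\<eta>. H \<eta> * path_increment y \<eta> \<partial>\<mu>)"
      by (intro Bochner_Integration.integral_sum integrable_depends_on[OF finite_vertex_ball[of "Suc m"]]
          depends_on_map2[where h="(*)"] depends_on_mono[OF dH] depends_on_path_increment) auto
    also have "\<dots> = 0"
      by (intro sum.neutral ballI integral_mult_path_increment[OF finite_vertex_ball dH]) auto
    finally show ?thesis .
  qed
  have II: "(\<integral>\<eta>. (I \<eta>)\<^sup>2 \<partial>\<mu>) \<le> q"
    unfolding I_def q_def by (rule integral_square_increments_le[where S="{}"]) auto
  have eq: "(?X n \<eta> - ?X (Suc m) \<eta>)\<^sup>2 = (H \<eta>)\<^sup>2 - 2 / q * (H \<eta> * I \<eta>) + (I \<eta>)\<^sup>2 / q\<^sup>2" for \<eta>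
  proof -
    have "?X n \<eta> - ?X (Suc m) \<eta> = H \<eta> - I \<eta> / q"
      using path_martingale_increment[OF p0, of m \<eta>] by (simp add: H_def I_def q_def)
    then show ?thesis by (simp add: power2_diff power_divide)
  qed
  have dI': "depends_on (?S (Suc m)) I" unfolding I_def by (intro depends_on_sum dI) auto
  have dH': "depends_on (?S (Suc m)) H" by (rule depends_on_mono[OF dH]) auto
  note int = integrable_depends_on[OF finite_vertex_ball[of "Suc m"]]
  have "(\<integral>\<eta>. (?X n \<eta> - ?X (Suc m) \<eta>)\<^sup>2 \<partial>\<mu>) = (\<integral>\<eta>. (H \<eta>)\<^sup>2 \<partial>\<mu>) - 2 / q * (\<integral>\<eta>. H \<eta> * I \<eta> \<partial>\<mu>) + (\<integral>\<eta>. (I \<eta>)\<^sup>2 \<partial>\<mu>) / q\<^sup>2"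
    unfolding eq
    using int[OF depends_on_map[OF dH', of "\<lambda>r. r\<^sup>2"]] int[OF depends_on_map[OF dI', of "\<lambda>r. r\<^sup>2"]]
      int[OF depends_on_map2[OF dH' dI', of "(*)"]] by simp
  also have "\<dots> \<le> (\<Sum>k\<in>{n..<m}. (1 / (2 * p)) ^ Suc k) + q / q\<^sup>2"
    unfolding HI using step.IH II by (simp add: H_def[symmetric] add_mono divide_right_mono)
  also have "q / q\<^sup>2 = (1 / (2 * p)) ^ Suc m" using q by (simp add: power2_eq_square power_one_over q_def)
  finally show ?case using step.hyps by (simp add: sum.atLeastLessThan_Suc)
qed simp

lemma path_martingale_L2_geometric:
  assumes p: "1 / 2 < p" and "n \<le> m"
  shows "(\<integral>\<eta>. (path_martingale n \<eta> - path_martingale m \<eta>)\<^sup>2 \<partial>\<mu>) \<le> 1 / (1 - 1 / (2 * p)) * (1 / (2 * p)) ^ n"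
proof -
  define r where "r = 1 / (2 * p)"
  have r: "0 < r" "r < 1" using p by (auto simp: r_def field_simps)
  have "(\<Sum>k\<in>{n..<m}. r ^ Suc k) \<le> (r ^ n - r ^ m) / (1 - r)"
    using \<open>n \<le> m\<close>
  proof (induction m rule: dec_induct)
    case (step m)
    have "r ^ Suc m \<le> r ^ m" using r by (simp add: mult_left_le_one_le)
    moreover have "(r ^ n - r ^ m) / (1 - r) + r ^ m = (r ^ n - r ^ Suc m) / (1 - r)" using r by (simp add: field_simps)
    ultimately show ?case using step by (simp add: sum.atLeastLessThan_Suc)
  qed simp
  also have "\<dots> \<le> 1 / (1 - r) * r ^ n" using r by (simp add: divide_right_mono)
  finally show ?thesis using path_martingale_L2_dist[OF assms] by (simp add: r_def)
qed

text \<open>A legal update at \<open>y\<close> finds both children vacant, so neither before nor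
  after it does an open path pass through \<open>y\<close> to a later generation. Hence legal
  updates above the last generation leave the martingale unchanged, and only the sites of generation
  \<open>n + 1\<close> contribute.\<close>

lemma ad_generator_path_martingale:
  "ad_generator p (path_martingale (Suc n)) \<eta> =
    (\<Sum>y\<in>{y. length y = Suc n}. ad_rate y \<eta> * path_increment y \<eta>) * (- 1 / (2 * p) ^ Suc n)"
proof -
  let ?X = "path_martingale (Suc n)" and ?L = "{y :: vertex. length y = Suc n}" and ?S = "{x :: vertex. length x \<le> Suc n}"
  have far: "path_open x (\<eta>(y := b)) = path_open x \<eta>" if "\<And>k. take k x \<noteq> y" for x y b
    by (rule depends_onD[OF depends_on_path_open]) (use that in auto)
  have blocked: "path_open x (\<eta>(y := b)) = path_open x \<eta>" if y: "length y < length x" "\<not> \<eta> (y @ [False])" "\<not> \<eta> (y @ [True])" for x y b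
  proof (cases "\<exists>k. take k x = y")
    case True
    then obtain k where k: "take k x = y" by blast
    have kx: "k < length x" "length y = k" using y(1) k by auto
    then have t: "take (Suc k) x = y @ [x ! k]" using k by (simp add: take_Suc_conv_app_nth)
    have z: "path_open x \<xi> = 0" if "\<not> \<xi> (take (Suc k) x)" for \<xi>
    proof -
      have "\<not> (\<forall>j\<le>length x. \<xi> (take j x))" using that kx(1) Suc_leI by blast
      then show ?thesis by (simp only: path_open_def if_False)
    qed
    have v: "\<not> \<eta> (y @ [x ! k])" using y(2,3) by (cases "x ! k") simp_all
    then have "path_open x \<eta> = 0" "path_open x (\<eta>(y := b)) = 0"
      by (intro z, simp add: t)+
    then show ?thesis by simp
  qed (use far in blast)
  have each: "ad_rate y \<eta> * (site_average p y ?X \<eta> - ?X \<eta>) =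
      (if length y = Suc n then ad_rate y \<eta> * path_increment y \<eta> * (- 1 / (2 * p) ^ Suc n) else 0)" if "y \<in> ?S" for y
  proof (cases "length y = Suc n")
    case True
    have s: "(\<Sum>x\<in>?L. path_open x (\<eta>(y := b))) = (\<Sum>x\<in>?L - {y}. path_open x \<eta>) + path_open (butlast y) \<eta> * of_bool b" for b
    proof -
      have "path_open x (\<eta>(y := b)) = path_open x \<eta>" if "x \<in> ?L - {y}" for x
      proof (rule far)
        fix k show "take k x \<noteq> y"
        proof
          assume e: "take k x = y"
          from arg_cong[OF e, of length] that True have "length x \<le> k" by simp
          with e that show False by simp
        qed
      qed
      moreover have "path_open y (\<eta>(y := b)) = path_open (butlast y) \<eta> * of_bool b"
      proof -
        have y: "y = butlast y @ [last y]" using True by (cases y rule: rev_cases) auto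
        have "path_open (butlast y) (\<eta>(y := b)) = path_open (butlast y) \<eta>"
        proof (rule far)
          fix k show "take k (butlast y) \<noteq> y"
          proof
            assume "take k (butlast y) = y"
            from arg_cong[OF this, of length] True show False by simp
          qed
        qed
        then show ?thesis using path_open_snoc[of "butlast y" "last y" "\<eta>(y := b)"] y by simp
      qed
      ultimately show ?thesis using True by (subst sum.remove[OF finite_generation, of y]) auto
    qed
    have "?X (\<eta>(y := b)) - ?X \<eta> = path_open (butlast y) \<eta> * (of_bool b - of_bool (\<eta> y)) / (2 * p) ^ Suc n" for b
      using s[of b] s[of "\<eta> y"] by (simp add: path_martingale_def algebra_simps flip: diff_divide_distrib)
    moreover have "site_average p y ?X \<eta> - ?X \<eta> = p * (?X (\<eta>(y := True)) - ?X \<eta>) + (1 - p) * (?X (\<eta>(y := False)) - ?X \<eta>)"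
      by (simp add: site_average_eq algebra_simps)
    moreover have alg: "p * (P * (1 - w) / Q) + (1 - p) * (P * (0 - w) / Q) = P * (w - p) * (- 1 / Q)" for P w Q :: real
      by (simp add: divide_inverse algebra_simps)
    ultimately have "site_average p y ?X \<eta> - ?X \<eta> = path_increment y \<eta> * (- 1 / (2 * p) ^ Suc n)"
      by (simp only: path_increment_def of_bool_eq alg)
    then show ?thesis using True by simp
  next
    case False
    then have len: "length y < Suc n" using that by simp
    have "site_average p y ?X \<eta> = ?X \<eta>" if "ad_rate y \<eta> \<noteq> 0"
    proof -
      have "\<not> \<eta> (y @ [False])" "\<not> \<eta> (y @ [True])" using that by (auto simp: ad_rate_def split: if_splits)
      then have "?X (\<eta>(y := b)) = ?X \<eta>" for b
        unfolding path_martingale_def using len by (intro arg_cong2[where f="(/)"] sum.cong refl blocked) auto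
      then show ?thesis by (simp add: site_average_eq algebra_simps)
    qed
    then show ?thesis using False by auto
  qed
  have "ad_generator p ?X \<eta> = (\<Sum>y\<in>?S. if length y = Suc n then ad_rate y \<eta> * path_increment y \<eta> * (- 1 / (2 * p) ^ Suc n) else 0)"
    unfolding ad_generator_eq_sum[OF finite_vertex_ball depends_on_path_martingale] by (intro sum.cong refl each)
  also have "\<dots> = (\<Sum>y\<in>?L. ad_rate y \<eta> * path_increment y \<eta> * (- 1 / (2 * p) ^ Suc n))"
    by (rule sum.mono_neutral_cong_right) (use finite_vertex_ball in auto)
  finally show ?thesis by (simp only: sum_distrib_right)
qed

lemma ad_generator_path_martingale_L2:
  assumes p: "1 / 2 < p"
  shows "(\<integral>\<eta>. (ad_generator p (path_martingale (Suc n)) \<eta>)\<^sup>2 \<partial>\<mu>) \<le> (1 / (2 * p)) ^ Suc n"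
proof -
  define q where "q = (2 * p) ^ Suc n"
  have q: "0 < q" using p by (simp add: q_def)
  define I where "I \<eta> = (\<Sum>y\<in>{y. length y = Suc n}. ad_rate y \<eta> * path_increment y \<eta>)" for \<eta>
  have II: "(\<integral>\<eta>. (I \<eta>)\<^sup>2 \<partial>\<mu>) \<le> q"
    unfolding I_def q_def
  proof (rule integral_square_increments_le[where S="{x. length x = Suc (Suc n)}"])
    show "depends_on {x. length x = Suc (Suc n)} (ad_rate y)" if "length y = Suc n" for y
      using that by (intro depends_on_ad_rate) auto
  qed (auto simp: finite_generation)
  have "(\<integral>\<eta>. (ad_generator p (path_martingale (Suc n)) \<eta>)\<^sup>2 \<partial>\<mu>) = (\<integral>\<eta>. (I \<eta>)\<^sup>2 * (1 / q\<^sup>2) \<partial>\<mu>)"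
    unfolding ad_generator_path_martingale I_def q_def[symmetric] by (simp only: power_mult_distrib power_divide) simp
  also have "\<dots> = (\<integral>\<eta>. (I \<eta>)\<^sup>2 \<partial>\<mu>) / q\<^sup>2" by simp
  also have "\<dots> \<le> q / q\<^sup>2" using II by (rule divide_right_mono) simp
  also have "\<dots> = (1 / (2 * p)) ^ Suc n" using q by (simp add: power2_eq_square power_one_over q_def)
  finally show ?thesis .
qed

lemma const_in_ad_L2_generator: "(\<lambda>_. 1, \<lambda>_. 0) \<in> ad_L2_generator p"
proof -
  have "ad_generator p (\<lambda>_. 1) \<eta> = 0" for \<eta>
    using ad_generator_eq_sum[of "{}" "\<lambda>_. 1"] by simp
  moreover have "local_function (\<lambda>_. 1 :: real)" by (auto simp: local_function_def)
  ultimately show ?thesis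
    unfolding ad_L2_generator_def square_integrable_def
    by (intro CollectI case_prodI conjI exI[of _ "\<lambda>_ _. 1"] allI) (simp_all add: integrable_depends_on[of "{}"])
qed

text \<open>The L^2 limit \<open>W\<close> of the martingale is annihilated by the generator, as are
  the constants. If 0 were simple, \<open>W\<close> would equal a constant \<open>k\<close>; vacancy
  of the root forces \<open>k = 0\<close>, whereas the mean of the martingale stays at
  \<open>p > 0\<close>.\<close>

lemma not_simple_eigenvalue_supercritical:
  assumes p: "1 / 2 < p" "p < 1"
  shows "\<not> ad_simple_eigenvalue p 0"
proof
  assume simple: "ad_simple_eigenvalue p 0"
  interpret M: prob_space \<mu> by (rule prob_space_bernoulli_product)
  let ?X = path_martingale
  define r where "r = 1 / (2 * p)"
  have r: "0 < r" "r < 1" using p by (auto simp: r_def field_simps)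
  note dX = depends_on_path_martingale and fin = finite_vertex_ball
  have Xm: "?X n \<in> borel_measurable \<mu>" for n
    unfolding measurable_cong_sets[OF sets_bernoulli_product refl] by (rule measurable_depends_on[OF fin dX])
  have Xint: "integrable \<mu> (\<lambda>\<eta>. (?X n \<eta> - ?X m \<eta>)\<^sup>2)" for n m
    by (intro integrable_depends_on[OF fin[of "max n m"]] depends_on_map2[where h="\<lambda>a b. (a - b)\<^sup>2"]
        depends_on_mono[OF dX]) auto
  obtain W where W: "W \<in> borel_measurable \<mu>" "\<And>n. integrable \<mu> (\<lambda>\<eta>. (?X n \<eta> - W \<eta>)\<^sup>2)"
    "(\<lambda>n. \<integral>\<eta>. (?X n \<eta> - W \<eta>)\<^sup>2 \<partial>\<mu>) \<longlonglongrightarrow> 0"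
    using M.L2_geometric_limit[OF Xm Xint r path_martingale_L2_geometric[OF p(1), folded r_def]] by blast
  have X2: "integrable \<mu> (\<lambda>\<eta>. (?X n \<eta>)\<^sup>2)" "integrable \<mu> (?X n)" for n
    by (rule integrable_depends_on[OF fin depends_on_map[where h="\<lambda>r. r\<^sup>2", OF dX]],
        rule integrable_depends_on[OF fin dX])
  have W2: "integrable \<mu> (\<lambda>\<eta>. (W \<eta>)\<^sup>2)"
  proof (rule Bochner_Integration.integrable_bound[where f="\<lambda>\<eta>. 2 * (?X 0 \<eta>)\<^sup>2 + 2 * (?X 0 \<eta> - W \<eta>)\<^sup>2"])
    show "AE \<eta> in \<mu>. norm ((W \<eta>)\<^sup>2) \<le> norm (2 * (?X 0 \<eta>)\<^sup>2 + 2 * (?X 0 \<eta> - W \<eta>)\<^sup>2)"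
    proof (rule AE_I2)
      fix \<eta>
      have "0 \<le> (2 * ?X 0 \<eta> - W \<eta>)\<^sup>2" by simp
      then show "norm ((W \<eta>)\<^sup>2) \<le> norm (2 * (?X 0 \<eta>)\<^sup>2 + 2 * (?X 0 \<eta> - W \<eta>)\<^sup>2)"
        by (simp add: power2_eq_square algebra_simps)
    qed
  qed (use W X2 in auto)
  have "(W, \<lambda>\<eta>. 0 * W \<eta>) \<in> ad_L2_generator p"
  proof -
    have "(\<lambda>n. \<integral>\<eta>. (?X (Suc n) \<eta> - W \<eta>)\<^sup>2 \<partial>\<mu>) \<longlonglongrightarrow> 0" by (rule LIMSEQ_Suc[OF W(3)])
    moreover have "(\<lambda>n. \<integral>\<eta>. (ad_generator p (?X (Suc n)) \<eta> - 0 * W \<eta>)\<^sup>2 \<partial>\<mu>) \<longlonglongrightarrow> 0"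
    proof (rule tendsto_sandwich[OF _ _ tendsto_const])
      show "(\<lambda>n. r ^ Suc n) \<longlonglongrightarrow> 0" using r by (intro LIMSEQ_Suc LIMSEQ_power_zero) simp
      show "\<forall>\<^sub>F n in sequentially. (\<integral>\<eta>. (ad_generator p (?X (Suc n)) \<eta> - 0 * W \<eta>)\<^sup>2 \<partial>\<mu>) \<le> r ^ Suc n"
        using ad_generator_path_martingale_L2[OF p(1)] by (simp add: r_def)
    qed simp
    moreover have "local_function (?X (Suc n))" for n unfolding local_function_iff using fin dX by blast
    ultimately show ?thesis
      using W(1) W2 by (auto simp: ad_L2_generator_def square_integrable_def intro!: exI[of _ "\<lambda>n. ?X (Suc n)"])
  qed
  moreover have "(\<lambda>_. 1, \<lambda>\<eta>. 0 * 1) \<in> ad_L2_generator p" using const_in_ad_L2_generator by simp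
  moreover obtain h where "\<And>f. (f, \<lambda>\<omega>. 0 * f \<omega>) \<in> ad_L2_generator p \<Longrightarrow> \<exists>c. AE \<omega> in \<mu>. f \<omega> = c * h \<omega>"
    using simple unfolding ad_simple_eigenvalue_def by blast
  ultimately obtain c d where hc: "AE \<eta> in \<mu>. W \<eta> = c * h \<eta>" "AE \<eta> in \<mu>. 1 = d * h \<eta>"
    by meson
  have "AE \<eta> in \<mu>. W \<eta> = c / d"
    using hc
  proof eventually_elim
    case (elim \<eta>)
    then have "d \<noteq> 0" by auto
    with elim(2) have "h \<eta> = 1 / d" by (simp add: nonzero_eq_divide_eq mult.commute)
    with elim(1) show ?case by simp
  qed
  define k where "k = c / d"
  have lim: "(\<lambda>n. \<integral>\<eta>. (?X n \<eta> - k)\<^sup>2 \<partial>\<mu>) \<longlonglongrightarrow> 0"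
  proof -
    have "(\<integral>\<eta>. (?X n \<eta> - W \<eta>)\<^sup>2 \<partial>\<mu>) = (\<integral>\<eta>. (?X n \<eta> - k)\<^sup>2 \<partial>\<mu>)" for n
      using W(1) Xm[of n] \<open>AE \<eta> in \<mu>. W \<eta> = c / d\<close> by (intro integral_cong_AE) (auto simp: k_def)
    then show ?thesis using W(3) by simp
  qed
  have Xk: "integrable \<mu> (\<lambda>\<eta>. (?X n \<eta> - k)\<^sup>2)" for n
    by (rule integrable_depends_on[OF fin depends_on_map[OF dX]])
  \<comment> \<open>When the root is vacant, which has probability \<open>1 - p\<close>, every term
    of the martingale vanishes.\<close>
  have "k\<^sup>2 * (1 - p) \<le> (\<integral>\<eta>. (?X n \<eta> - k)\<^sup>2 \<partial>\<mu>)" for n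
  proof -
    have "(\<integral>\<eta>. k\<^sup>2 * of_bool (\<not> \<eta> []) \<partial>\<mu>) = (p * of_bool (\<not> True) + (1 - p) * of_bool (\<not> False)) * (\<integral>\<eta>. k\<^sup>2 \<partial>\<mu>)"
      by (rule integral_mult_coordinate[where h="\<lambda>b. of_bool (\<not> b)" and S="{}"]) auto
    then have "k\<^sup>2 * (1 - p) = (\<integral>\<eta>. k\<^sup>2 * of_bool (\<not> \<eta> []) \<partial>\<mu>)" by auto
    also have "\<dots> \<le> (\<integral>\<eta>. (?X n \<eta> - k)\<^sup>2 \<partial>\<mu>)"
    proof (rule integral_mono[OF _ Xk])
      show "integrable \<mu> (\<lambda>\<eta>. k\<^sup>2 * of_bool (\<not> \<eta> []))"
        by (rule integrable_depends_on[of "{[]}"]) (auto intro: depends_on_coordinate)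
      show "k\<^sup>2 * of_bool (\<not> \<eta> []) \<le> (?X n \<eta> - k)\<^sup>2" for \<eta>
      proof (cases "\<eta> []")
        case False
        then have "path_open x \<eta> = 0" for x by (auto simp: path_open_def intro!: exI[of _ 0])
        then show ?thesis by (simp add: path_martingale_def)
      qed simp
    qed
    finally show ?thesis .
  qed
  then have "k\<^sup>2 * (1 - p) \<le> 0" by (intro LIMSEQ_le_const[OF lim]) auto
  then have k0: "k = 0" using p by (simp add: mult_le_0_iff)
  \<comment> \<open>The tangent to the square at \<open>p\<close> turns the constant mean
    \<open>p\<close> into a lower bound for the second moment.\<close>
  have "p\<^sup>2 \<le> (\<integral>\<eta>. (?X n \<eta> - k)\<^sup>2 \<partial>\<mu>)" for n
  proof -
    have "(\<integral>\<eta>. ?X n \<eta> \<partial>\<mu>) = (\<Sum>x\<in>{x :: vertex. length x = n}. p ^ Suc n) / (2 * p) ^ n"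
      unfolding path_martingale_def
      using integrable_depends_on[OF fin depends_on_path_open'[OF order_refl]]
      by (simp add: integral_path_open)
    also have "\<dots> = p" using p by (simp add: card_generation power_mult_distrib)
    finally have EX: "(\<integral>\<eta>. ?X n \<eta> \<partial>\<mu>) = p" .
    have "2 * p * p - p\<^sup>2 = (\<integral>\<eta>. 2 * p * ?X n \<eta> - p\<^sup>2 \<partial>\<mu>)" using X2(2)[of n] by (simp add: EX)
    also have "\<dots> \<le> (\<integral>\<eta>. (?X n \<eta> - k)\<^sup>2 \<partial>\<mu>)"
    proof (rule integral_mono[OF _ Xk])
      show "integrable \<mu> (\<lambda>\<eta>. 2 * p * ?X n \<eta> - p\<^sup>2)" using X2(2)[of n] by simp
      fix \<eta>
      have "0 \<le> (?X n \<eta> - p)\<^sup>2" by simp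
      then show "2 * p * ?X n \<eta> - p\<^sup>2 \<le> (?X n \<eta> - k)\<^sup>2" by (simp add: k0 power2_eq_square algebra_simps)
    qed
    finally show ?thesis by (simp add: power2_eq_square)
  qed
  then have "p\<^sup>2 \<le> 0" by (intro LIMSEQ_le_const[OF lim]) auto
  then show False using p by simp
qed

lemma AE_density_zero:
  assumes "p = 0"
  shows "AE \<eta> in \<mu>. \<eta> = (\<lambda>_. False)"
proof -
  have "AE \<eta> in \<mu>. \<not> \<eta> x" for x
  proof -
    have d: "depends_on {x} (\<lambda>\<eta>. of_bool (\<eta> x) :: real)" by (rule depends_on_coordinate) simp
    have "(\<integral>\<eta>. 1 * of_bool (\<eta> x) \<partial>\<mu>) = (0::real)"
      by (subst integral_mult_coordinate[of "{}"]) (auto simp: assms)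
    then have "AE \<eta> in \<mu>. of_bool (\<eta> x) = (0::real)"
      using integrable_depends_on[OF _ d] by (subst integral_nonneg_eq_0_iff_AE[symmetric]) auto
    then show ?thesis by eventually_elim simp
  qed
  then have "AE \<eta> in \<mu>. \<forall>x. \<not> \<eta> x" by (simp add: AE_all_countable)
  then show ?thesis by eventually_elim auto
qed

end

text \<open>The supremum is over a nonempty set: \<open>p = 0\<close> belongs to it, since every
  function is almost surely constant under a point mass.\<close>

lemma ad_critical_le_half: "ad_critical \<le> 1 / 2"
  unfolding ad_critical_def
proof (rule cSup_least)
  interpret bernoulli_parameter 0 by unfold_locales auto
  have "ad_simple_eigenvalue 0 0"
    unfolding ad_simple_eigenvalue_def
  proof (intro exI[of _ "\<lambda>_. 1"] conjI allI impI)
    show "(\<lambda>_. 1, \<lambda>_. 0 * 1) \<in> ad_L2_generator 0" using const_in_ad_L2_generator by simp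
    show "\<not> (AE \<eta> in \<mu>. (1::real) = 0)"
      by (simp add: prob_space.AE_const[OF prob_space_bernoulli_product])
    fix f :: "config \<Rightarrow> real"
    show "\<exists>c. AE \<eta> in \<mu>. f \<eta> = c * 1"
      using AE_density_zero by (intro exI[of _ "f (\<lambda>_. False)"]) (auto elim: eventually_mono)
  qed
  then show "{p. 0 \<le> p \<and> p < 1 \<and> ad_simple_eigenvalue p 0} \<noteq> {}" by (intro ex_in_conv[THEN iffD1] exI[of _ 0]) simp
  fix p :: real assume p: "p \<in> {p. 0 \<le> p \<and> p < 1 \<and> ad_simple_eigenvalue p 0}"
  then interpret q: bernoulli_parameter p by unfold_locales auto
  show "p \<le> 1 / 2" using q.not_simple_eigenvalue_supercritical p by (rule_tac ccontr) auto
qed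

section \<open>Exponential relaxation\<close>

text \<open>Interpolating the bound from the enclosure with the trivial one turns \<open>\<kappa> ^ card A\<close>, which need
  not be integrable, into the integrable \<open>a ^ card A\<close>, at the price of a smaller rate.\<close>

lemma min_le_powr:
  fixes z s :: real
  assumes "0 < z" "0 \<le> s" "s \<le> 1"
  shows "min 1 z \<le> z powr s"
proof (cases "1 \<le> z")
  case True
  then show ?thesis using assms(2) ge_one_powr_ge_zero[of z s] by simp
next
  case False
  then have "z powr 1 \<le> z powr s" using assms by (intro powr_mono') auto
  then show ?thesis using assms(1) False by simp
qed

theorem theorem4p3:
  fixes p p' :: real and K :: "real \<Rightarrow> config \<Rightarrow> config measure"
  assumes "0 \<le> p" and "p < 1"
    and "0 \<le> p'" and "p' < ad_critical"
    and "ad_process p K"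
    and "ad_gap p > 0"
  shows "\<exists>m>0. \<forall>f. local_function f \<longrightarrow> (\<exists>C :: real.
     (\<forall>t>0. (\<integral>\<eta>. \<bar>(\<integral>\<omega>. f \<omega> \<partial>K t \<eta>) - (\<integral>\<omega>. f \<omega> \<partial>bernoulli_product p)\<bar> \<partial>bernoulli_product p')
               \<le> C * exp (- m * t)) \<and>
     (AE \<eta> in bernoulli_product p'. \<exists>t0. \<forall>t>t0.
        \<bar>(\<integral>\<omega>. f \<omega> \<partial>K t \<eta>) - (\<integral>\<omega>. f \<omega> \<partial>bernoulli_product p)\<bar> \<le> C * exp (- m * t)))"
proof -
  interpret ad_semigroup p K using assms by unfold_locales auto
  have p': "p' < 1 / 2" using assms(4) ad_critical_le_half by simp
  interpret q: bernoulli_parameter p' using assms(3) p' by unfold_locales auto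
  interpret \<nu>: prob_space "bernoulli_product p'" by (rule prob_space_bernoulli_product)
  obtain \<gamma> \<kappa> where \<gamma>: "0 < \<gamma>" and \<kappa>: "1 \<le> \<kappa>" and relax:
    "\<And>n f B A \<eta> t. depends_on {x. length x < n} f \<Longrightarrow> (\<And>\<omega>. \<bar>f \<omega>\<bar> \<le> B) \<Longrightarrow> finite A \<Longrightarrow>
      {x. length x < n} \<subseteq> A \<Longrightarrow> prefix_closed A \<Longrightarrow> vacant_boundary A \<eta> \<Longrightarrow> 0 \<le> t \<Longrightarrow>
      \<bar>T t f \<eta> - (\<integral>\<omega>. f \<omega> \<partial>\<mu>)\<bar> \<le> 2 * B * \<kappa> ^ card A * exp (- \<gamma> * t)"
  proof (rule relaxation[OF assms(2,6)], goal_cases)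
    case (1 \<gamma> \<kappa>)
    show ?case by (rule that[OF 1(2,3)]) (rule 1(4))
  qed
  obtain a :: real where a: "1 < a" and enclosure: "\<And>m. \<exists>Y. integrable (bernoulli_product p') Y \<and> (\<forall>\<eta>. 0 \<le> Y \<eta>) \<and>
    (AE \<eta> in bernoulli_product p'. \<exists>A. finite A \<and> {x. length x < m} \<subseteq> A \<and> prefix_closed A \<and> vacant_boundary A \<eta> \<and> a ^ card A \<le> Y \<eta>)"
  proof (rule q.subcritical_enclosure[OF p'], goal_cases)
    case (1 a)
    show ?case by (rule that[OF 1(2)]) (rule 1(3))
  qed
  \<comment> \<open>Chosen so that \<open>\<kappa> powr s \<le> a\<close>; the added 1 keeps the
    denominator positive when \<open>\<kappa> = 1\<close>.\<close>
  define s where "s = min 1 (ln a / (ln \<kappa> + 1))"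
  have l: "0 \<le> ln \<kappa>" "0 < ln a" using a \<kappa> by auto
  then have s: "0 < s" "s \<le> 1" by (auto simp: s_def)
  have "s * ln \<kappa> \<le> ln a / (ln \<kappa> + 1) * (ln \<kappa> + 1)" using l by (intro mult_mono) (auto simp: s_def)
  also have "\<dots> = ln a" using l by simp
  finally have "exp (s * ln \<kappa>) \<le> exp (ln a)" by simp
  then have \<kappa>s: "\<kappa> powr s \<le> a" using a \<kappa> by (simp add: powr_def)
  \<comment> \<open>Interpolation gives the rate \<open>s * \<gamma>\<close>; half of it is kept in
    reserve to absorb the random factor \<open>Y \<eta>\<close> in the almost sure bound.\<close>
  define m where "m = s * \<gamma> / 2"
  have m: "0 < m" using s \<gamma> by (simp add: m_def)
  show ?thesis
  proof (rule exI[of _ m], intro conjI m allI impI)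
    fix f assume "local_function f"
    then obtain S where S: "finite S" "depends_on S f" by (auto simp: local_function_iff)
    define n where "n = Suc (Max (insert 0 (length ` S)))"
    have "S \<subseteq> {x. length x < n}" using S(1) by (auto simp: n_def less_Suc_eq_le)
    then have f: "depends_on {x. length x < n} f" by (rule depends_on_mono[OF S(2)])
    obtain B where B: "0 \<le> B" "\<And>\<omega>. \<bar>f \<omega>\<bar> \<le> B" using bounded_depends_on[OF S] by metis
    have fm: "f \<in> borel_measurable config_space" by (rule measurable_depends_on[OF S])
    obtain Y where Y: "integrable (bernoulli_product p') Y" "\<And>\<eta>. 0 \<le> Y \<eta>"
      and AEY: "AE \<eta> in bernoulli_product p'. \<exists>A. finite A \<and> {x. length x < n} \<subseteq> A \<and> prefix_closed A \<and> vacant_boundary A \<eta> \<and> a ^ card A \<le> Y \<eta>"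
      using enclosure[of n] by blast
    define c where "c = (\<integral>\<omega>. f \<omega> \<partial>\<mu>)"
    define X where "X t \<eta> = \<bar>T t f \<eta> - c\<bar>" for t \<eta>
    have cB: "\<bar>c\<bar> \<le> B" unfolding c_def by (rule abs_integral_local_le[OF S B(2)])
    have XB: "X t \<eta> \<le> 2 * B" if "0 \<le> t" for t \<eta>
      using T_abs_le[OF that fm B(2), of \<eta>] cB unfolding X_def by linarith
    \<comment> \<open>The enclosure depends on \<eta> but not on \<open>t\<close>, so one null set
      serves all times.\<close>
    have AEX: "AE \<eta> in bernoulli_product p'. \<forall>t\<ge>0. X t \<eta> \<le> 2 * B * Y \<eta> * exp (- (2 * m) * t)"
      using AEY
    proof eventually_elim
      case (elim \<eta>)
      then obtain A where A: "finite A" "{x. length x < n} \<subseteq> A" "prefix_closed A" "vacant_boundary A \<eta>" "a ^ card A \<le> Y \<eta>"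
        by blast
      show ?case
      proof (intro allI impI)
        fix t :: real assume t: "0 \<le> t"
        define z where "z = \<kappa> ^ card A * exp (- \<gamma> * t)"
        have z: "0 < z" using \<kappa> by (simp add: z_def)
        have "X t \<eta> \<le> 2 * B * z"
          using relax[OF f B(2) A(1-4) t] by (simp add: X_def c_def z_def mult.assoc)
        with XB[OF t, of \<eta>] have "X t \<eta> \<le> 2 * B * min 1 z" by (simp add: min_def)
        also have "\<dots> \<le> 2 * B * z powr s" using B(1) min_le_powr[OF z less_imp_le[OF s(1)] s(2)] by (intro mult_left_mono) auto
        also have "z powr s = (\<kappa> powr s) ^ card A * exp (- (2 * m) * t)"
          using \<kappa> by (simp add: z_def powr_mult m_def powr_realpow[symmetric] powr_powr exp_powr_real mult_ac)
        also have "2 * B * \<dots> \<le> 2 * B * (Y \<eta> * exp (- (2 * m) * t))"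
          using B(1) \<kappa>s by (intro mult_left_mono mult_right_mono order_trans[OF power_mono A(5)]) auto
        finally show "X t \<eta> \<le> 2 * B * Y \<eta> * exp (- (2 * m) * t)" by (simp add: mult.assoc)
      qed
    qed
    \<comment> \<open>The first summand serves the integrated bound, the second the almost sure
      one.\<close>
    define C where "C = 2 * B * (\<integral>\<eta>. Y \<eta> \<partial>bernoulli_product p') + 2 * B"
    have IY: "0 \<le> (\<integral>\<eta>. Y \<eta> \<partial>bernoulli_product p')" using Y(2) by simp
    have "(\<integral>\<eta>. X t \<eta> \<partial>bernoulli_product p') \<le> C * exp (- m * t)" if t: "0 < t" for t
    proof -
      have tm: "T t f \<in> borel_measurable (bernoulli_product p')"
        unfolding measurable_cong_sets[OF sets_bernoulli_product refl] using t by (intro T_measurable[OF _ fm B(2)]) simp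
      have "integrable (bernoulli_product p') (X t)"
        using XB[of t] t tm unfolding X_def by (intro \<nu>.integrable_const_bound[of _ "2 * B"]) auto
      then have "(\<integral>\<eta>. X t \<eta> \<partial>bernoulli_product p') \<le> (\<integral>\<eta>. 2 * B * Y \<eta> * exp (- (2 * m) * t) \<partial>bernoulli_product p')"
        using Y(1) AEX t by (intro integral_mono_AE) (auto elim: eventually_mono)
      also have "\<dots> = 2 * B * (\<integral>\<eta>. Y \<eta> \<partial>bernoulli_product p') * exp (- (2 * m) * t)" by simp
      also have "\<dots> \<le> C * exp (- m * t)"
        using B(1) IY t m by (intro mult_mono) (auto simp: C_def)
      finally show ?thesis .
    qed
    moreover have "AE \<eta> in bernoulli_product p'. \<exists>t0. \<forall>t>t0. X t \<eta> \<le> C * exp (- m * t)"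
      using AEX
    proof eventually_elim
      case (elim \<eta>)
      show ?case
      \<comment> \<open>From this time on \<open>Y \<eta> * exp (- m * t) \<le> 1\<close>; the added
        1 makes the logarithm nonnegative, so only nonnegative times occur.\<close>
      proof (intro exI[of _ "ln (Y \<eta> + 1) / m"] allI impI)
        fix t assume t: "ln (Y \<eta> + 1) / m < t"
        have "0 \<le> ln (Y \<eta> + 1) / m" using Y(2)[of \<eta>] m by simp
        then have t0: "0 \<le> t" using t by linarith
        have "ln (Y \<eta> + 1) < m * t" using t m by (simp add: pos_divide_less_eq mult.commute)
        from exp_less_mono[OF this] have "Y \<eta> + 1 < exp (m * t)" using Y(2)[of \<eta>] by (simp add: add_nonneg_pos)
        then have Y1: "Y \<eta> * exp (- m * t) \<le> 1" by (simp add: exp_minus field_simps)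
        have "X t \<eta> \<le> 2 * B * Y \<eta> * exp (- (2 * m) * t)" using elim t0 by blast
        also have "\<dots> = 2 * B * (Y \<eta> * exp (- m * t)) * exp (- m * t)" by (simp add: mult.assoc flip: exp_add)
        also have "\<dots> \<le> 2 * B * 1 * exp (- m * t)" using B(1) Y1 by (intro mult_right_mono mult_left_mono) auto
        also have "\<dots> \<le> C * exp (- m * t)" using B(1) IY by (intro mult_right_mono) (auto simp: C_def)
        finally show "X t \<eta> \<le> C * exp (- m * t)" .
      qed
    qed
    ultimately show "\<exists>C. (\<forall>t>0. (\<integral>\<eta>. \<bar>(\<integral>\<omega>. f \<omega> \<partial>K t \<eta>) - (\<integral>\<omega>. f \<omega> \<partial>\<mu>)\<bar> \<partial>bernoulli_product p') \<le> C * exp (- m * t)) \<and>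
      (AE \<eta> in bernoulli_product p'. \<exists>t0. \<forall>t>t0. \<bar>(\<integral>\<omega>. f \<omega> \<partial>K t \<eta>) - (\<integral>\<omega>. f \<omega> \<partial>\<mu>)\<bar> \<le> C * exp (- m * t))"
      unfolding X_def T_def c_def by blast
  qed
qed

end
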